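(* Let $K$ be a field of characteristic zero and let $R$ be a commutative $K$-algebra which is either a Noetherian unique factorization domain or an affine domain, with a derivation $\delta$ such that $R$ is $\delta$-simple. Then $R[\theta;\delta]$ satisfies $(\diamond)$ if and only if the Krull dimension of $R$ is at most $1$.
   Context: An affine domain is an integral domain that is a finitely generated commutative $K$-algebra. A derivation of a commutative ring $R$ is an additive map $\delta: R\to R$ with $\delta(ab)=\delta(a)b+a\delta(b)$ (it is not required to be $K$-linear). A $\delta$-ideal is an ideal $I$ of $R$ with $\delta(I)\subseteq I$; $R$ is $\delta$-simple if $0$ and $R$ are its only $\delta$-ideals. The differential operator ring $R[\theta;\delta]$ is the free left $R$-module with basis $1,\theta,\theta^2,\ldots$ with multiplication extending that of $R$ and determined by $\theta a = a\theta+\delta(a)$ for $a\in R$. A Noetherian ring $S$ satisfies property $(\diamond)$ if every cyclic essential extension of a simple $S$-module is Artinian; modules are left modules. *)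

theory Defs
  imports
    "HOL-Algebra.Ring_Divisibility"
    "HOL-Algebra.Generated_Rings"
    "HOL-Algebra.UnivPoly"
    "HOL-Library.Extended_Nat"
begin

definition ring_char_zero :: "('k, 'm) ring_scheme \<Rightarrow> bool" where
  "ring_char_zero K \<longleftrightarrow> (\<forall>n::nat. n > 0 \<longrightarrow> [n] \<cdot>\<^bsub>K\<^esub> \<one>\<^bsub>K\<^esub> \<noteq> \<zero>\<^bsub>K\<^esub>)"

definition noetherian_ufd :: "('a, 'm) ring_scheme \<Rightarrow> bool" where
  "noetherian_ufd R \<longleftrightarrow> noetherian_domain R \<and> factorial_domain R"

text \<open>The \<open>K\<close>-subalgebra generated by \<open>X\<close> is the subring generated by \<open>X\<close> together
  with the image \<open>K \<cdot> 1\<close> of the structure map.\<close>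

definition finitely_generated_algebra ::
    "('k, 'm) ring_scheme \<Rightarrow> ('k, 'a, 'n) module_scheme \<Rightarrow> bool" where
  "finitely_generated_algebra K R \<longleftrightarrow>
     (\<exists>X \<subseteq> carrier R. finite X \<and>
        generate_ring R ((\<lambda>k. k \<odot>\<^bsub>R\<^esub> \<one>\<^bsub>R\<^esub>) ` carrier K \<union> X) = carrier R)"

definition affine_domain ::
    "('k, 'm) ring_scheme \<Rightarrow> ('k, 'a, 'n) module_scheme \<Rightarrow> bool" where
  "affine_domain K R \<longleftrightarrow> domain R \<and> finitely_generated_algebra K R"

definition krull_dim :: "('a, 'm) ring_scheme \<Rightarrow> enat" where
  "krull_dim R =
     (SUP n \<in> {n. \<exists>P :: nat \<Rightarrow> 'a set.
                    (\<forall>i\<le>n. primeideal (P i) R) \<and> (\<forall>i<n. P i \<subset> P (Suc i))}. enat n)"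


section \<open>Derivations and differential operator rings\<close>

locale derivation = cring R for R (structure) +
  fixes \<delta> :: "'a \<Rightarrow> 'a"
  assumes deriv_closed: "a \<in> carrier R \<Longrightarrow> \<delta> a \<in> carrier R"
    and deriv_add: "\<lbrakk>a \<in> carrier R; b \<in> carrier R\<rbrakk> \<Longrightarrow> \<delta> (a \<oplus> b) = \<delta> a \<oplus> \<delta> b"
    and deriv_mult: "\<lbrakk>a \<in> carrier R; b \<in> carrier R\<rbrakk> \<Longrightarrow> \<delta> (a \<otimes> b) = \<delta> a \<otimes> b \<oplus> a \<otimes> \<delta> b"

definition delta_ideal :: "('a, 'm) ring_scheme \<Rightarrow> ('a \<Rightarrow> 'a) \<Rightarrow> 'a set \<Rightarrow> bool" where
  "delta_ideal R \<delta> I \<longleftrightarrow> ideal I R \<and> \<delta> ` I \<subseteq> I"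

definition delta_simple :: "('a, 'm) ring_scheme \<Rightarrow> ('a \<Rightarrow> 'a) \<Rightarrow> bool" where
  "delta_simple R \<delta> \<longleftrightarrow> (\<forall>I. delta_ideal R \<delta> I \<longrightarrow> I = {\<zero>\<^bsub>R\<^esub>} \<or> I = carrier R)"

text \<open>The rule \<open>\<theta> a = a \<theta> + \<delta> a\<close> forces
  \<open>\<theta> (\<Sum>j. q\<^sub>j \<theta>\<^sup>j) = \<Sum>j. q\<^sub>j \<theta>\<^sup>j\<^sup>+\<^sup>1 + \<delta> q\<^sub>j \<theta>\<^sup>j\<close>; this is the map on coefficient sequences.\<close>

definition theta_mult ::
    "('a, 'm) ring_scheme \<Rightarrow> ('a \<Rightarrow> 'a) \<Rightarrow> (nat \<Rightarrow> 'a) \<Rightarrow> (nat \<Rightarrow> 'a)" where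
  "theta_mult R \<delta> q = (\<lambda>n. (if n = 0 then \<zero>\<^bsub>R\<^esub> else q (n - 1)) \<oplus>\<^bsub>R\<^esub> \<delta> (q n))"

text \<open>As a left \<open>R\<close>-module, the differential operator ring is the library's polynomial module
  \<open>UP R\<close> with basis \<open>1, \<theta>, \<theta>\<^sup>2, \<dots>\<close>; only its multiplication is replaced, by
  \<open>(\<Sum>i. p\<^sub>i \<theta>\<^sup>i) q = \<Sum>i. p\<^sub>i (\<theta>\<^sup>i q)\<close>. The lemmas below show that this is a ring in which
  \<open>\<theta> a = a \<theta> + \<delta> a\<close>, left multiplication by \<open>a \<in> R\<close> is the scalar multiplication, and the powers
  of \<open>\<theta>\<close> are the monomial basis.\<close>

definition diff_op_ring ::
    "('a, 'm) ring_scheme \<Rightarrow> ('a \<Rightarrow> 'a) \<Rightarrow> ('a, nat \<Rightarrow> 'a) up_ring" where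
  "diff_op_ring R \<delta> = (UP R)\<lparr>mult := (\<lambda>p\<in>up R. \<lambda>q\<in>up R.
     \<Oplus>\<^bsub>UP R\<^esub>i\<in>{..deg R p}. p i \<odot>\<^bsub>UP R\<^esub> ((theta_mult R \<delta> ^^ i) q))\<rparr>"

lemma diff_op_ring_simps [simp]:
  "carrier (diff_op_ring R \<delta>) = carrier (UP R)"
  "zero (diff_op_ring R \<delta>) = zero (UP R)"
  "one (diff_op_ring R \<delta>) = one (UP R)"
  "add (diff_op_ring R \<delta>) = add (UP R)"
  "smult (diff_op_ring R \<delta>) = smult (UP R)"
  "monom (diff_op_ring R \<delta>) = monom (UP R)"
  "coeff (diff_op_ring R \<delta>) = coeff (UP R)"
  by (simp_all add: diff_op_ring_def)

context derivation
begin

interpretation UP: UP_cring R "UP R"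
  by unfold_locales auto

abbreviation (input) T :: "(nat \<Rightarrow> 'a) \<Rightarrow> nat \<Rightarrow> 'a" where "T \<equiv> theta_mult R \<delta>"

lemma deriv_zero: "\<delta> \<zero> = \<zero>"
  using deriv_add[of \<zero> \<zero>] deriv_closed[of \<zero>] by (metis local.add.l_cancel_one' r_zero zero_closed)

lemma deriv_one: "\<delta> \<one> = \<zero>"
  using deriv_mult[of \<one> \<one>] deriv_closed[of \<one>] by (metis local.add.l_cancel_one' one_closed l_one r_one)

lemma theta_closed: assumes "q \<in> carrier (UP R)" shows "T q \<in> carrier (UP R)"
proof -
  have q: "q \<in> up R" using assms by (simp add: UP_def)
  then obtain N where N: "bound \<zero> N q" by blast
  have "T q \<in> up R"
  proof
    show "T q n \<in> carrier R" for n
      using q by (auto simp: theta_mult_def intro!: deriv_closed)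
    have "bound \<zero> (Suc N) (T q)"
      using N by (auto simp: theta_mult_def bound_def deriv_zero)
    then show "\<exists>n. bound \<zero> n (T q)" ..
  qed
  then show ?thesis by (simp add: UP_def)
qed

lemma theta_pow_closed: "q \<in> carrier (UP R) \<Longrightarrow> (T ^^ i) q \<in> carrier (UP R)"
  by (induction i) (auto intro: theta_closed)

lemma coeff_UP: "p \<in> carrier (UP R) \<Longrightarrow> coeff (UP R) p = p"
  by (simp add: UP_def)

lemma coeff_theta: "q \<in> carrier (UP R) \<Longrightarrow> coeff (UP R) (T q) n =
    (if n = 0 then \<zero> else coeff (UP R) q (n - 1)) \<oplus> \<delta> (coeff (UP R) q n)"
  using coeff_UP[OF theta_closed[of q]] by (simp add: coeff_UP theta_mult_def)

lemma theta_add: "\<lbrakk>p \<in> carrier (UP R); q \<in> carrier (UP R)\<rbrakk>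
    \<Longrightarrow> T (p \<oplus>\<^bsub>UP R\<^esub> q) = T p \<oplus>\<^bsub>UP R\<^esub> T q"
  by (rule UP.up_eqI) (auto simp: coeff_theta theta_closed deriv_add deriv_closed a_ac)

lemma theta_zero: "T \<zero>\<^bsub>UP R\<^esub> = \<zero>\<^bsub>UP R\<^esub>"
  by (rule UP.up_eqI) (auto simp: coeff_theta theta_closed deriv_zero)

lemma theta_smult: "\<lbrakk>a \<in> carrier R; q \<in> carrier (UP R)\<rbrakk>
    \<Longrightarrow> T (a \<odot>\<^bsub>UP R\<^esub> q) = a \<odot>\<^bsub>UP R\<^esub> T q \<oplus>\<^bsub>UP R\<^esub> \<delta> a \<odot>\<^bsub>UP R\<^esub> q"
  by (rule UP.up_eqI) (auto simp: coeff_theta theta_closed deriv_mult deriv_closed r_distr a_ac)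

lemma theta_pow_add: "\<lbrakk>p \<in> carrier (UP R); q \<in> carrier (UP R)\<rbrakk>
    \<Longrightarrow> (T ^^ i) (p \<oplus>\<^bsub>UP R\<^esub> q) = (T ^^ i) p \<oplus>\<^bsub>UP R\<^esub> (T ^^ i) q"
  by (induction i) (simp_all add: theta_add theta_pow_closed)

lemma theta_finsum: "f \<in> UNIV \<rightarrow> carrier (UP R) \<Longrightarrow>
    T (\<Oplus>\<^bsub>UP R\<^esub>i\<in>{..n::nat}. f i) = (\<Oplus>\<^bsub>UP R\<^esub>i\<in>{..n}. T (f i))"
  by (induction n) (auto simp: Pi_def theta_add theta_closed)

lemma diff_mult_eq:
  assumes p: "p \<in> carrier (UP R)" and q: "q \<in> carrier (UP R)"
    and N: "\<And>i. N < i \<Longrightarrow> coeff (UP R) p i = \<zero>"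
  shows "p \<otimes>\<^bsub>diff_op_ring R \<delta>\<^esub> q =
    (\<Oplus>\<^bsub>UP R\<^esub>i\<in>{..N}. coeff (UP R) p i \<odot>\<^bsub>UP R\<^esub> (T ^^ i) q)"
proof -
  have "p \<otimes>\<^bsub>diff_op_ring R \<delta>\<^esub> q =
      (\<Oplus>\<^bsub>UP R\<^esub>i\<in>{..deg R p}. coeff (UP R) p i \<odot>\<^bsub>UP R\<^esub> (T ^^ i) q)"
    using p q by (simp add: diff_op_ring_def coeff_UP) (simp add: UP_def)
  also have "\<dots> = (\<Oplus>\<^bsub>UP R\<^esub>i\<in>{..N}. coeff (UP R) p i \<odot>\<^bsub>UP R\<^esub> (T ^^ i) q)"
    by (rule UP.P.add.finprod_mono_neutral_cong_left)
       (use p q N in \<open>auto intro!: UP.deg_aboveI simp: UP.deg_aboveD not_le theta_pow_closed\<close>)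
  finally show ?thesis .
qed

lemma diff_mult_deg:
  assumes p: "p \<in> carrier (UP R)" and q: "q \<in> carrier (UP R)"
    and N: "deg R p \<le> N"
  shows "p \<otimes>\<^bsub>diff_op_ring R \<delta>\<^esub> q =
    (\<Oplus>\<^bsub>UP R\<^esub>i\<in>{..N}. coeff (UP R) p i \<odot>\<^bsub>UP R\<^esub> (T ^^ i) q)"
  using assms by (intro diff_mult_eq) (auto intro: UP.deg_aboveD)

lemma diff_mult_closed: "\<lbrakk>p \<in> carrier (UP R); q \<in> carrier (UP R)\<rbrakk>
    \<Longrightarrow> p \<otimes>\<^bsub>diff_op_ring R \<delta>\<^esub> q \<in> carrier (UP R)"
  by (subst diff_mult_deg[OF _ _ order_refl]) (auto intro!: UP.P.finsum_closed simp: theta_pow_closed)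

lemma diff_l_distr:
  assumes "p \<in> carrier (UP R)" "q \<in> carrier (UP R)" "r \<in> carrier (UP R)"
  shows "(p \<oplus>\<^bsub>UP R\<^esub> q) \<otimes>\<^bsub>diff_op_ring R \<delta>\<^esub> r =
    p \<otimes>\<^bsub>diff_op_ring R \<delta>\<^esub> r \<oplus>\<^bsub>UP R\<^esub> q \<otimes>\<^bsub>diff_op_ring R \<delta>\<^esub> r"
proof -
  define N where "N = Max {deg R p, deg R q, deg R (p \<oplus>\<^bsub>UP R\<^esub> q)}"
  have N: "deg R p \<le> N" "deg R q \<le> N" "deg R (p \<oplus>\<^bsub>UP R\<^esub> q) \<le> N"
    by (auto simp: N_def)
  show ?thesis
    using assms
    by (simp add: diff_mult_deg[OF _ _ N(1)] diff_mult_deg[OF _ _ N(2)] diff_mult_deg[OF _ _ N(3)]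
        UP.smult_l_distr theta_pow_closed UP.P.finsum_addf Pi_def)
qed

lemma diff_r_distr:
  assumes "p \<in> carrier (UP R)" "q \<in> carrier (UP R)" "r \<in> carrier (UP R)"
  shows "r \<otimes>\<^bsub>diff_op_ring R \<delta>\<^esub> (p \<oplus>\<^bsub>UP R\<^esub> q) =
    r \<otimes>\<^bsub>diff_op_ring R \<delta>\<^esub> p \<oplus>\<^bsub>UP R\<^esub> r \<otimes>\<^bsub>diff_op_ring R \<delta>\<^esub> q"
  using assms
  by (simp add: diff_mult_deg[OF _ _ order_refl] theta_pow_add UP.smult_r_distr theta_pow_closed
      UP.P.finsum_addf Pi_def)

lemma diff_smult_mult:
  assumes a: "a \<in> carrier R" and q: "q \<in> carrier (UP R)" and r: "r \<in> carrier (UP R)"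
  shows "(a \<odot>\<^bsub>UP R\<^esub> q) \<otimes>\<^bsub>diff_op_ring R \<delta>\<^esub> r = a \<odot>\<^bsub>UP R\<^esub> (q \<otimes>\<^bsub>diff_op_ring R \<delta>\<^esub> r)"
proof -
  have "(a \<odot>\<^bsub>UP R\<^esub> q) \<otimes>\<^bsub>diff_op_ring R \<delta>\<^esub> r =
      (\<Oplus>\<^bsub>UP R\<^esub>i\<in>{..deg R q}. coeff (UP R) (a \<odot>\<^bsub>UP R\<^esub> q) i \<odot>\<^bsub>UP R\<^esub> (T ^^ i) r)"
    by (rule diff_mult_eq) (use a q r in \<open>auto simp: UP.deg_aboveD\<close>)
  also have "\<dots> = (\<Oplus>\<^bsub>UP R\<^esub>i\<in>{..deg R q}. a \<odot>\<^bsub>UP R\<^esub> (coeff (UP R) q i \<odot>\<^bsub>UP R\<^esub> (T ^^ i) r))"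
    by (rule UP.P.finsum_cong') (use a q r in \<open>auto simp: UP.smult_assoc1 theta_pow_closed\<close>)
  also have "\<dots> = a \<odot>\<^bsub>UP R\<^esub> (\<Oplus>\<^bsub>UP R\<^esub>i\<in>{..deg R q}. coeff (UP R) q i \<odot>\<^bsub>UP R\<^esub> (T ^^ i) r)"
    by (rule UP.finsum_smult_ldistr[symmetric]) (use a q r in \<open>auto simp: theta_pow_closed\<close>)
  finally show ?thesis
    using q r by (simp add: diff_mult_deg[OF _ _ order_refl])
qed

lemma diff_theta_mult:
  assumes q: "q \<in> carrier (UP R)" and r: "r \<in> carrier (UP R)"
  shows "T q \<otimes>\<^bsub>diff_op_ring R \<delta>\<^esub> r = T (q \<otimes>\<^bsub>diff_op_ring R \<delta>\<^esub> r)"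
proof -
  let ?N = "deg R q"
  let ?c = "coeff (UP R) q"
  let ?s = "\<lambda>i. if i = 0 then \<zero> else ?c (i - 1)"
  have above: "?c i = \<zero>" if "?N < i" for i
    using that q by (rule UP.deg_aboveD)
  have cl: "?c i \<in> carrier R" "\<delta> (?c i) \<in> carrier R" "(T ^^ i) r \<in> carrier (UP R)" for i
    using q r by (auto simp: theta_pow_closed deriv_closed)
  have tcl: "T ((T ^^ i) r) \<in> carrier (UP R)" for i
    using cl by (simp add: theta_closed)
  have "T q \<otimes>\<^bsub>diff_op_ring R \<delta>\<^esub> r =
      (\<Oplus>\<^bsub>UP R\<^esub>i\<in>{..Suc ?N}. coeff (UP R) (T q) i \<odot>\<^bsub>UP R\<^esub> (T ^^ i) r)"
    by (rule diff_mult_eq) (use q r in \<open>auto simp: theta_closed coeff_theta above deriv_zero\<close>)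
  also have "\<dots> = (\<Oplus>\<^bsub>UP R\<^esub>i\<in>{..Suc ?N}.
      ?s i \<odot>\<^bsub>UP R\<^esub> (T ^^ i) r \<oplus>\<^bsub>UP R\<^esub> \<delta> (?c i) \<odot>\<^bsub>UP R\<^esub> (T ^^ i) r)"
    by (rule UP.P.finsum_cong') (use q cl in \<open>auto simp: coeff_theta UP.smult_l_distr\<close>)
  also have "\<dots> = (\<Oplus>\<^bsub>UP R\<^esub>i\<in>{..Suc ?N}. ?s i \<odot>\<^bsub>UP R\<^esub> (T ^^ i) r) \<oplus>\<^bsub>UP R\<^esub>
      (\<Oplus>\<^bsub>UP R\<^esub>i\<in>{..Suc ?N}. \<delta> (?c i) \<odot>\<^bsub>UP R\<^esub> (T ^^ i) r)"
    by (rule UP.P.finsum_addf) (use cl in auto)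
  also have "(\<Oplus>\<^bsub>UP R\<^esub>i\<in>{..Suc ?N}. ?s i \<odot>\<^bsub>UP R\<^esub> (T ^^ i) r) =
      (\<Oplus>\<^bsub>UP R\<^esub>i\<in>{..?N}. ?c i \<odot>\<^bsub>UP R\<^esub> T ((T ^^ i) r))"
    by (subst UP.P.finsum_Suc2) (use cl tcl r in \<open>auto simp: theta_closed\<close>)
  also have "(\<Oplus>\<^bsub>UP R\<^esub>i\<in>{..Suc ?N}. \<delta> (?c i) \<odot>\<^bsub>UP R\<^esub> (T ^^ i) r) =
      (\<Oplus>\<^bsub>UP R\<^esub>i\<in>{..?N}. \<delta> (?c i) \<odot>\<^bsub>UP R\<^esub> (T ^^ i) r)"
    by (subst UP.P.finsum_Suc) (use cl tcl r in \<open>auto simp: above deriv_zero theta_closed theta_pow_closed\<close>)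
  also have "(\<Oplus>\<^bsub>UP R\<^esub>i\<in>{..?N}. ?c i \<odot>\<^bsub>UP R\<^esub> T ((T ^^ i) r)) \<oplus>\<^bsub>UP R\<^esub>
      (\<Oplus>\<^bsub>UP R\<^esub>i\<in>{..?N}. \<delta> (?c i) \<odot>\<^bsub>UP R\<^esub> (T ^^ i) r) =
      (\<Oplus>\<^bsub>UP R\<^esub>i\<in>{..?N}. ?c i \<odot>\<^bsub>UP R\<^esub> T ((T ^^ i) r) \<oplus>\<^bsub>UP R\<^esub> \<delta> (?c i) \<odot>\<^bsub>UP R\<^esub> (T ^^ i) r)"
    by (rule UP.P.finsum_addf[symmetric]) (use cl tcl in auto)
  also have "\<dots> = (\<Oplus>\<^bsub>UP R\<^esub>i\<in>{..?N}. T (?c i \<odot>\<^bsub>UP R\<^esub> (T ^^ i) r))"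
    by (rule UP.P.finsum_cong') (use cl in \<open>auto simp: theta_smult theta_closed\<close>)
  also have "\<dots> = T (\<Oplus>\<^bsub>UP R\<^esub>i\<in>{..?N}. ?c i \<odot>\<^bsub>UP R\<^esub> (T ^^ i) r)"
    by (rule theta_finsum[symmetric]) (use cl in auto)
  finally show ?thesis
    using q r by (simp add: diff_mult_deg[OF _ _ order_refl])
qed

lemma diff_theta_pow_mult:
  assumes q: "q \<in> carrier (UP R)" and r: "r \<in> carrier (UP R)"
  shows "(T ^^ i) q \<otimes>\<^bsub>diff_op_ring R \<delta>\<^esub> r = (T ^^ i) (q \<otimes>\<^bsub>diff_op_ring R \<delta>\<^esub> r)"
  using assms by (induction i) (simp_all add: diff_theta_mult theta_pow_closed)

lemma diff_finsum_mult:
  assumes "f \<in> UNIV \<rightarrow> carrier (UP R)" "r \<in> carrier (UP R)"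
  shows "(\<Oplus>\<^bsub>UP R\<^esub>i\<in>{..n::nat}. f i) \<otimes>\<^bsub>diff_op_ring R \<delta>\<^esub> r =
    (\<Oplus>\<^bsub>UP R\<^esub>i\<in>{..n}. f i \<otimes>\<^bsub>diff_op_ring R \<delta>\<^esub> r)"
  using assms by (induction n) (auto simp: Pi_def diff_l_distr diff_mult_closed)

lemma diff_assoc:
  assumes p: "p \<in> carrier (UP R)" and q: "q \<in> carrier (UP R)" and r: "r \<in> carrier (UP R)"
  shows "(p \<otimes>\<^bsub>diff_op_ring R \<delta>\<^esub> q) \<otimes>\<^bsub>diff_op_ring R \<delta>\<^esub> r =
    p \<otimes>\<^bsub>diff_op_ring R \<delta>\<^esub> (q \<otimes>\<^bsub>diff_op_ring R \<delta>\<^esub> r)"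
proof -
  have "(p \<otimes>\<^bsub>diff_op_ring R \<delta>\<^esub> q) \<otimes>\<^bsub>diff_op_ring R \<delta>\<^esub> r =
     (\<Oplus>\<^bsub>UP R\<^esub>i\<in>{..deg R p}. (coeff (UP R) p i \<odot>\<^bsub>UP R\<^esub> (T ^^ i) q) \<otimes>\<^bsub>diff_op_ring R \<delta>\<^esub> r)"
    using p q r by (simp add: diff_mult_deg[OF p q order_refl] diff_finsum_mult theta_pow_closed Pi_def)
  also have "\<dots> = (\<Oplus>\<^bsub>UP R\<^esub>i\<in>{..deg R p}.
      coeff (UP R) p i \<odot>\<^bsub>UP R\<^esub> (T ^^ i) (q \<otimes>\<^bsub>diff_op_ring R \<delta>\<^esub> r))"
    by (rule UP.P.finsum_cong')
       (use p q r in \<open>auto simp: diff_smult_mult diff_theta_pow_mult theta_pow_closed diff_mult_closed\<close>)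
  finally show ?thesis
    using p q r by (simp add: diff_mult_deg[OF p _ order_refl] diff_mult_closed)
qed

lemma diff_l_one: "p \<in> carrier (UP R) \<Longrightarrow> \<one>\<^bsub>UP R\<^esub> \<otimes>\<^bsub>diff_op_ring R \<delta>\<^esub> p = p"
  by (subst diff_mult_eq[where N = 0]) auto

lemma theta_monom_one: "T (monom (UP R) \<one> n) = monom (UP R) \<one> (Suc n)"
  by (rule UP.up_eqI) (auto simp: coeff_theta theta_closed deriv_zero deriv_one)

lemma theta_pow_one: "(T ^^ i) \<one>\<^bsub>UP R\<^esub> = monom (UP R) \<one> i"
proof (induction i)
  case 0
  show ?case by (rule UP.up_eqI) auto
qed (simp add: theta_monom_one)

lemma diff_monom_one_mult:
  "q \<in> carrier (UP R) \<Longrightarrow> monom (UP R) \<one> n \<otimes>\<^bsub>diff_op_ring R \<delta>\<^esub> q = (T ^^ n) q"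
  using diff_theta_pow_mult[of "\<one>\<^bsub>UP R\<^esub>" q n] by (simp add: theta_pow_one diff_l_one)

lemma diff_r_one:
  assumes p: "p \<in> carrier (UP R)"
  shows "p \<otimes>\<^bsub>diff_op_ring R \<delta>\<^esub> \<one>\<^bsub>UP R\<^esub> = p"
proof -
  have "p \<otimes>\<^bsub>diff_op_ring R \<delta>\<^esub> \<one>\<^bsub>UP R\<^esub> =
      (\<Oplus>\<^bsub>UP R\<^esub>i\<in>{..deg R p}. monom (UP R) (coeff (UP R) p i) i)"
    using p by (simp add: diff_mult_deg[OF _ _ order_refl] theta_pow_one UP.monom_mult_smult[symmetric])
  then show ?thesis using UP.up_repr[OF p] by simp
qed

theorem diff_op_ring_is_ring: "ring (diff_op_ring R \<delta>)"
  by (auto intro!: ringI abelian_groupI monoidI UP.P.a_assoc UP.P.a_comm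
      simp: diff_l_one diff_r_one diff_l_distr diff_r_distr diff_mult_closed diff_assoc)

theorem diff_op_ring_theta:
  assumes "a \<in> carrier R"
  shows "monom (UP R) \<one> 1 \<otimes>\<^bsub>diff_op_ring R \<delta>\<^esub> monom (UP R) a 0 =
    monom (UP R) a 0 \<otimes>\<^bsub>diff_op_ring R \<delta>\<^esub> monom (UP R) \<one> 1 \<oplus>\<^bsub>diff_op_ring R \<delta>\<^esub> monom (UP R) (\<delta> a) 0"
proof -
  have "monom (UP R) \<one> 1 \<otimes>\<^bsub>diff_op_ring R \<delta>\<^esub> monom (UP R) a 0 = T (monom (UP R) a 0)"
    using assms by (simp add: diff_monom_one_mult)
  moreover have "monom (UP R) a 0 \<otimes>\<^bsub>diff_op_ring R \<delta>\<^esub> monom (UP R) \<one> 1 = monom (UP R) a 1"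
    using assms by (subst diff_mult_eq[where N = 0]) (auto simp: UP.monom_mult_smult[symmetric])
  moreover have "T (monom (UP R) a 0) = monom (UP R) a 1 \<oplus>\<^bsub>UP R\<^esub> monom (UP R) (\<delta> a) 0"
    using assms by (intro UP.up_eqI) (auto simp: coeff_theta theta_closed deriv_closed deriv_zero)
  ultimately show ?thesis by simp
qed

theorem diff_op_ring_smult:
  assumes "a \<in> carrier R" "q \<in> carrier (UP R)"
  shows "monom (UP R) a 0 \<otimes>\<^bsub>diff_op_ring R \<delta>\<^esub> q = a \<odot>\<^bsub>UP R\<^esub> q"
  using assms by (subst diff_mult_eq[where N = 0]) auto

theorem diff_op_ring_theta_pow:
  "monom (UP R) \<one> 1 [^]\<^bsub>diff_op_ring R \<delta>\<^esub> (n::nat) = monom (UP R) \<one> n"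
proof (induction n)
  case 0
  show ?case by (simp add: nat_pow_def)
next
  case (Suc n)
  have "monom (UP R) \<one> n \<otimes>\<^bsub>diff_op_ring R \<delta>\<^esub> monom (UP R) \<one> 1 = (T ^^ n) ((T ^^ 1) \<one>\<^bsub>UP R\<^esub>)"
    by (simp only: theta_pow_one diff_monom_one_mult UP.monom_closed one_closed)
  also have "\<dots> = (T ^^ Suc n) \<one>\<^bsub>UP R\<^esub>"
    by (simp add: funpow_swap1)
  finally have "monom (UP R) \<one> n \<otimes>\<^bsub>diff_op_ring R \<delta>\<^esub> monom (UP R) \<one> 1 = monom (UP R) \<one> (Suc n)"
    by (simp only: theta_pow_one)
  with Suc show ?case by (simp add: nat_pow_def)
qed

end


section \<open>Modules over a noncommutative ring\<close>

text \<open>The library's \<open>module\<close> locale assumes a commutative base ring; the axioms are the same.\<close>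

locale left_module = S?: ring S + M?: abelian_group M
  for S :: "('s, 'm) ring_scheme" and M :: "('s, 'e, 'n) module_scheme" (structure) +
  assumes smult_closed [simp, intro]:
      "\<lbrakk>a \<in> carrier S; x \<in> carrier M\<rbrakk> \<Longrightarrow> a \<odot>\<^bsub>M\<^esub> x \<in> carrier M"
    and smult_l_distr:
      "\<lbrakk>a \<in> carrier S; b \<in> carrier S; x \<in> carrier M\<rbrakk> \<Longrightarrow>
        (a \<oplus>\<^bsub>S\<^esub> b) \<odot>\<^bsub>M\<^esub> x = a \<odot>\<^bsub>M\<^esub> x \<oplus>\<^bsub>M\<^esub> b \<odot>\<^bsub>M\<^esub> x"
    and smult_r_distr:
      "\<lbrakk>a \<in> carrier S; x \<in> carrier M; y \<in> carrier M\<rbrakk> \<Longrightarrow>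
        a \<odot>\<^bsub>M\<^esub> (x \<oplus>\<^bsub>M\<^esub> y) = a \<odot>\<^bsub>M\<^esub> x \<oplus>\<^bsub>M\<^esub> a \<odot>\<^bsub>M\<^esub> y"
    and smult_assoc:
      "\<lbrakk>a \<in> carrier S; b \<in> carrier S; x \<in> carrier M\<rbrakk> \<Longrightarrow>
        (a \<otimes>\<^bsub>S\<^esub> b) \<odot>\<^bsub>M\<^esub> x = a \<odot>\<^bsub>M\<^esub> (b \<odot>\<^bsub>M\<^esub> x)"
    and smult_one [simp]:
      "x \<in> carrier M \<Longrightarrow> \<one>\<^bsub>S\<^esub> \<odot>\<^bsub>M\<^esub> x = x"

definition simple_module ::
    "('s, 'm) ring_scheme \<Rightarrow> ('s, 'e, 'n) module_scheme \<Rightarrow> bool" where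
  "simple_module S M \<longleftrightarrow> left_module S M \<and> carrier M \<noteq> {\<zero>\<^bsub>M\<^esub>} \<and>
     (\<forall>N. submodule N S M \<longrightarrow> N = {\<zero>\<^bsub>M\<^esub>} \<or> N = carrier M)"

definition cyclic_module ::
    "('s, 'm) ring_scheme \<Rightarrow> ('s, 'e, 'n) module_scheme \<Rightarrow> bool" where
  "cyclic_module S M \<longleftrightarrow> left_module S M \<and>
     (\<exists>x \<in> carrier M. carrier M = (\<lambda>s. s \<odot>\<^bsub>M\<^esub> x) ` carrier S)"

definition artinian_module ::
    "('s, 'm) ring_scheme \<Rightarrow> ('s, 'e, 'n) module_scheme \<Rightarrow> bool" where
  "artinian_module S M \<longleftrightarrow> left_module S M \<and>
     (\<forall>F :: nat \<Rightarrow> 'e set.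
        (\<forall>i. submodule (F i) S M) \<and> (\<forall>i. F (Suc i) \<subseteq> F i) \<longrightarrow> (\<exists>n. \<forall>m\<ge>n. F m = F n))"

definition essential_submodule ::
    "('s, 'm) ring_scheme \<Rightarrow> ('s, 'e, 'n) module_scheme \<Rightarrow> 'e set \<Rightarrow> bool" where
  "essential_submodule S M N \<longleftrightarrow> submodule N S M \<and>
     (\<forall>L. submodule L S M \<and> L \<noteq> {\<zero>\<^bsub>M\<^esub>} \<longrightarrow> L \<inter> N \<noteq> {\<zero>\<^bsub>M\<^esub>})"

definition essential_ext_of_simple ::
    "('s, 'm) ring_scheme \<Rightarrow> ('s, 'e, 'n) module_scheme \<Rightarrow> bool" where
  "essential_ext_of_simple S M \<longleftrightarrow>
     (\<exists>N. essential_submodule S M N \<and> simple_module S (M\<lparr>carrier := N\<rparr>))"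

text \<open>A definition cannot quantify over types, so the modules here have elements of type
  \<open>'s set\<close>. This is no restriction: a cyclic module \<open>S x\<close> is isomorphic to the module of cosets
  of the annihilator of \<open>x\<close>. Lemma \<open>diamond_any_type\<close> below records this.\<close>

definition diamond :: "('s, 'm) ring_scheme \<Rightarrow> bool" where
  "diamond S \<longleftrightarrow>
     (\<forall>M :: ('s, 's set) module.
        cyclic_module S M \<and> essential_ext_of_simple S M \<longrightarrow> artinian_module S M)"

context left_module
begin

lemma smult_zero_left: "x \<in> carrier M \<Longrightarrow> \<zero>\<^bsub>S\<^esub> \<odot>\<^bsub>M\<^esub> x = \<zero>\<^bsub>M\<^esub>"
  using smult_l_distr[of "\<zero>\<^bsub>S\<^esub>" "\<zero>\<^bsub>S\<^esub>" x] by (metis M.add.l_cancel_one' S.l_zero S.zero_closed smult_closed)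

lemma smult_minus_one:
  assumes "x \<in> carrier M"
  shows "\<ominus>\<^bsub>M\<^esub> x = (\<ominus>\<^bsub>S\<^esub> \<one>\<^bsub>S\<^esub>) \<odot>\<^bsub>M\<^esub> x"
proof -
  have "(\<ominus>\<^bsub>S\<^esub> \<one>\<^bsub>S\<^esub>) \<odot>\<^bsub>M\<^esub> x \<oplus>\<^bsub>M\<^esub> x = \<zero>\<^bsub>M\<^esub>"
    using assms smult_l_distr[of "\<ominus>\<^bsub>S\<^esub> \<one>\<^bsub>S\<^esub>" "\<one>\<^bsub>S\<^esub>" x] by (simp add: S.l_neg smult_zero_left)
  then show ?thesis using assms by (simp add: M.minus_equality)
qed

lemma submodule_iff:
  "submodule L S M \<longleftrightarrow> L \<subseteq> carrier M \<and> \<zero>\<^bsub>M\<^esub> \<in> L \<and> (\<forall>x\<in>L. \<forall>y\<in>L. x \<oplus>\<^bsub>M\<^esub> y \<in> L) \<and>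
     (\<forall>s\<in>carrier S. \<forall>x\<in>L. s \<odot>\<^bsub>M\<^esub> x \<in> L)"
proof -
  have "inv\<^bsub>add_monoid M\<^esub> x \<in> L"
    if "L \<subseteq> carrier M" "\<forall>s\<in>carrier S. \<forall>x\<in>L. s \<odot>\<^bsub>M\<^esub> x \<in> L" "x \<in> L" for x
    using that smult_minus_one[of x] by (auto simp: a_inv_def[symmetric])
  then show ?thesis
    by (auto simp: submodule_def subgroup_def submodule_axioms_def)
qed

lemma restrict_left_module:
  assumes "submodule N S M"
  shows "left_module S (M\<lparr>carrier := N\<rparr>)"
proof -
  have N: "N \<subseteq> carrier M" "\<zero>\<^bsub>M\<^esub> \<in> N" "\<And>x y. x \<in> N \<Longrightarrow> y \<in> N \<Longrightarrow> x \<oplus>\<^bsub>M\<^esub> y \<in> N"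
    "\<And>s x. s \<in> carrier S \<Longrightarrow> x \<in> N \<Longrightarrow> s \<odot>\<^bsub>M\<^esub> x \<in> N"
    using assms by (auto simp: submodule_iff)
  have neg: "\<exists>y\<in>N. y \<oplus>\<^bsub>M\<^esub> x = \<zero>\<^bsub>M\<^esub>" if "x \<in> N" for x
    using that N(1) N(4)[of "\<ominus>\<^bsub>S\<^esub> \<one>\<^bsub>S\<^esub>" x] smult_minus_one[of x] M.l_neg[of x]
    by (metis S.a_inv_closed S.one_closed subsetD)
  have "abelian_group (M\<lparr>carrier := N\<rparr>)"
    by (rule abelian_groupI) (use N neg in \<open>auto simp: M.a_ac subset_iff\<close>)
  moreover have "left_module_axioms S (M\<lparr>carrier := N\<rparr>)"
    using N by (auto simp: left_module_axioms_def smult_l_distr smult_r_distr smult_assoc subset_iff)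
  ultimately show ?thesis
    by (simp add: left_module_def S.ring_axioms)
qed

lemma simple_restrict_iff:
  assumes N: "submodule N S M"
  shows "simple_module S (M\<lparr>carrier := N\<rparr>) \<longleftrightarrow>
    N \<noteq> {\<zero>\<^bsub>M\<^esub>} \<and> (\<forall>L. submodule L S M \<and> L \<subseteq> N \<longrightarrow> L = {\<zero>\<^bsub>M\<^esub>} \<or> L = N)"
proof -
  interpret N: left_module S "M\<lparr>carrier := N\<rparr>"
    by (rule restrict_left_module[OF N])
  have "submodule L S (M\<lparr>carrier := N\<rparr>) \<longleftrightarrow> submodule L S M \<and> L \<subseteq> N" for L
    unfolding N.submodule_iff submodule_iff using N by (auto simp: submodule_iff)
  then show ?thesis
    by (simp add: simple_module_def N.left_module_axioms)
qed

text \<open>Transport of structure along an injection \<open>f\<close>.\<close>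

lemma
  fixes M' :: "('s, 'f, 'r) module_scheme"
  assumes inj: "inj_on f (carrier M)"
    and carr: "carrier M' = f ` carrier M"
    and zero: "\<zero>\<^bsub>M'\<^esub> = f \<zero>\<^bsub>M\<^esub>"
    and add: "\<And>x y. x \<in> carrier M \<Longrightarrow> y \<in> carrier M \<Longrightarrow> f x \<oplus>\<^bsub>M'\<^esub> f y = f (x \<oplus>\<^bsub>M\<^esub> y)"
    and smult: "\<And>s x. s \<in> carrier S \<Longrightarrow> x \<in> carrier M \<Longrightarrow> s \<odot>\<^bsub>M'\<^esub> f x = f (s \<odot>\<^bsub>M\<^esub> x)"
  shows transport_left_module: "left_module S M'"
    and transport_submodule:
      "L \<subseteq> carrier M \<Longrightarrow> submodule (f ` L) S M' \<longleftrightarrow> submodule L S M"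
proof -
  have neg: "\<exists>y\<in>carrier M. f (y \<oplus>\<^bsub>M\<^esub> x) = f \<zero>\<^bsub>M\<^esub>" if "x \<in> carrier M" for x
    using that M.l_neg[of x] M.a_inv_closed[of x] by metis
  have "abelian_group M'"
    by (rule abelian_groupI) (use neg in \<open>auto simp: carr zero add M.a_ac\<close>)
  moreover have "left_module_axioms S M'"
    by (auto simp: left_module_axioms_def carr add smult smult_l_distr smult_r_distr smult_assoc)
  ultimately show M': "left_module S M'"
    by (simp add: left_module_def S.ring_axioms)
  interpret M': left_module S M' by (rule M')
  assume L: "L \<subseteq> carrier M"
  have mem: "f x \<in> f ` L \<longleftrightarrow> x \<in> L" if "x \<in> carrier M" for x
    using that L inj by (auto simp: inj_on_def subset_iff)
  show "submodule (f ` L) S M' \<longleftrightarrow> submodule L S M"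
    unfolding M'.submodule_iff submodule_iff using L
    by (auto simp: carr zero add smult mem subset_iff)
qed

end

theorem diamond_any_type:
  fixes S :: "('s, 'm) ring_scheme" and M :: "('s, 'e, 'n) module_scheme"
  assumes S: "diamond S" and M: "cyclic_module S M" "essential_ext_of_simple S M"
  shows "artinian_module S M"
proof -
  interpret left_module S M using M(1) by (simp add: cyclic_module_def)
  obtain g where g: "g \<in> carrier M" "carrier M = (\<lambda>s. s \<odot>\<^bsub>M\<^esub> g) ` carrier S"
    using M(1) by (auto simp: cyclic_module_def)
  define f where "f x = {s \<in> carrier S. s \<odot>\<^bsub>M\<^esub> g = x}" for x
  define h where "h = inv_into (carrier M) f"
  have inj: "inj_on f (carrier M)"
  proof (rule inj_onI)
    fix x y assume xy: "x \<in> carrier M" "y \<in> carrier M" "f x = f y"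
    then obtain s where "s \<in> carrier S" "x = s \<odot>\<^bsub>M\<^esub> g" using g by auto
    with xy(3) show "x = y" by (auto simp: f_def)
  qed
  have h: "h (f x) = x" if "x \<in> carrier M" for x
    using that inj by (simp add: h_def)
  define M' :: "('s, 's set) module" where
    "M' = \<lparr>carrier = f ` carrier M, mult = undefined, one = undefined, zero = f \<zero>\<^bsub>M\<^esub>,
           add = (\<lambda>A B. f (h A \<oplus>\<^bsub>M\<^esub> h B)), smult = (\<lambda>s A. f (s \<odot>\<^bsub>M\<^esub> h A))\<rparr>"
  have M'_simps: "carrier M' = f ` carrier M" "\<zero>\<^bsub>M'\<^esub> = f \<zero>\<^bsub>M\<^esub>"
    "\<And>x y. x \<in> carrier M \<Longrightarrow> y \<in> carrier M \<Longrightarrow> f x \<oplus>\<^bsub>M'\<^esub> f y = f (x \<oplus>\<^bsub>M\<^esub> y)"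
    "\<And>s x. s \<in> carrier S \<Longrightarrow> x \<in> carrier M \<Longrightarrow> s \<odot>\<^bsub>M'\<^esub> f x = f (s \<odot>\<^bsub>M\<^esub> x)"
    by (simp_all add: M'_def h)
  interpret M': left_module S M'
    by (rule transport_left_module[OF inj M'_simps])
  note sub = transport_submodule[OF inj M'_simps]
  have sub': "\<exists>L. L' = f ` L \<and> submodule L S M" if L': "submodule L' S M'" for L'
  proof -
    have "L' \<subseteq> f ` carrier M" using L' by (simp add: M'.submodule_iff M'_simps)
    then obtain L where "L \<subseteq> carrier M" "L' = f ` L" by (auto simp: subset_image_iff)
    with L' sub show ?thesis by blast
  qed
  have sub_carrier: "L \<subseteq> carrier M" if "submodule L S M" for L
    using that by (simp add: submodule_iff)
  have img_eq: "f ` A = f ` B \<longleftrightarrow> A = B" if "A \<subseteq> carrier M" "B \<subseteq> carrier M" for A B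
    using that inj by (simp add: inj_on_image_eq_iff)
  have zero_img: "{\<zero>\<^bsub>M'\<^esub>} = f ` {\<zero>\<^bsub>M\<^esub>}" by (simp add: M'_simps)
  have zero_sub: "{\<zero>\<^bsub>M\<^esub>} \<subseteq> carrier M" by simp
  have "cyclic_module S M'"
    unfolding cyclic_module_def
  proof (intro conjI M'.left_module_axioms bexI)
    show "carrier M' = (\<lambda>s. s \<odot>\<^bsub>M'\<^esub> f g) ` carrier S"
      using g by (auto simp: M'_simps)
  qed (use g in \<open>simp add: M'_simps\<close>)
  moreover have "essential_ext_of_simple S M'"
  proof -
    obtain N where N: "submodule N S M"
        "\<And>L. submodule L S M \<Longrightarrow> L \<noteq> {\<zero>\<^bsub>M\<^esub>} \<Longrightarrow> L \<inter> N \<noteq> {\<zero>\<^bsub>M\<^esub>}"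
        "simple_module S (M\<lparr>carrier := N\<rparr>)"
      using M(2) by (auto simp: essential_ext_of_simple_def essential_submodule_def)
    have N': "submodule (f ` N) S M'" using N(1) sub sub_carrier by blast
    have Ns: "N \<noteq> {\<zero>\<^bsub>M\<^esub>}" "\<And>L. submodule L S M \<Longrightarrow> L \<subseteq> N \<Longrightarrow> L = {\<zero>\<^bsub>M\<^esub>} \<or> L = N"
      using N(1,3) by (auto simp: simple_restrict_iff)
    have "essential_submodule S M' (f ` N)"
      unfolding essential_submodule_def
    proof (intro conjI N' allI impI)
      fix L' assume L': "submodule L' S M' \<and> L' \<noteq> {\<zero>\<^bsub>M'\<^esub>}"
      then obtain L where L: "L' = f ` L" "submodule L S M"
        using sub'[OF conjunct1[OF L']] by (elim exE conjE)
      have "L \<noteq> {\<zero>\<^bsub>M\<^esub>}" using L' L(1) zero_img by auto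
      then have "L \<inter> N \<noteq> {\<zero>\<^bsub>M\<^esub>}" using N(2) L(2) by blast
      then have "f ` (L \<inter> N) \<noteq> f ` {\<zero>\<^bsub>M\<^esub>}"
        using img_eq[OF le_infI1[OF sub_carrier[OF L(2)]] zero_sub] by simp
      then show "L' \<inter> f ` N \<noteq> {\<zero>\<^bsub>M'\<^esub>}"
        unfolding zero_img L(1)
        by (subst inj_on_image_Int[OF inj sub_carrier[OF L(2)] sub_carrier[OF N(1)], symmetric])
    qed
    moreover have "simple_module S (M'\<lparr>carrier := f ` N\<rparr>)"
      unfolding M'.simple_restrict_iff[OF N']
    proof (intro conjI allI impI)
      show "f ` N \<noteq> {\<zero>\<^bsub>M'\<^esub>}"
        using Ns(1) img_eq[OF sub_carrier[OF N(1)] zero_sub] zero_img by simp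
      fix L' assume L': "submodule L' S M' \<and> L' \<subseteq> f ` N"
      then obtain L where L: "L' = f ` L" "submodule L S M"
        using sub'[OF conjunct1[OF L']] by (elim exE conjE)
      have "L \<subseteq> N"
      proof
        fix x assume "x \<in> L"
        moreover from this obtain y where "y \<in> N" "f x = f y" using L' L(1) by auto
        ultimately show "x \<in> N"
          using inj_onD[OF inj] sub_carrier[OF L(2)] sub_carrier[OF N(1)] by (metis subsetD)
      qed
      then show "L' = {\<zero>\<^bsub>M'\<^esub>} \<or> L' = f ` N"
        using Ns(2)[OF L(2)] L(1) zero_img by auto
    qed
    ultimately show ?thesis by (auto simp: essential_ext_of_simple_def)
  qed
  ultimately have art: "artinian_module S M'"
    using S by (simp add: diamond_def)
  show ?thesis
    unfolding artinian_module_def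
  proof (intro conjI left_module_axioms allI impI)
    fix F :: "nat \<Rightarrow> 'e set"
    assume F: "(\<forall>i. submodule (F i) S M) \<and> (\<forall>i. F (Suc i) \<subseteq> F i)"
    have "(\<forall>i. submodule (f ` F i) S M') \<and> (\<forall>i. f ` F (Suc i) \<subseteq> f ` F i)"
      using F sub sub_carrier by blast
    with art have "\<exists>n. \<forall>m\<ge>n. f ` F m = f ` F n"
      unfolding artinian_module_def by (elim conjE allE[where x = "\<lambda>i. f ` F i"]) simp
    moreover have "f ` F m = f ` F n \<longleftrightarrow> F m = F n" for m n
      using F by (intro img_eq sub_carrier) auto
    ultimately show "\<exists>n. \<forall>m\<ge>n. F m = F n" by simp
  qed
qed

end

(* Write S = R[\<theta>;\<delta>]. In the affine case R is Noetherian by Hilbert's basis theorem, so in both cases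
   it is a domain with the ascending chain condition on ideals.

   If dim R \<le> 1, let L \<subseteq> I be nonzero left ideals of S with the same minimal degree and the same
   ideal of leading coefficients. Then some nonzero element of R multiplies I into L; all such
   elements form a \<delta>-ideal, so 1 does it too and I = L. In a descending chain of left ideals
   containing a fixed nonzero element both invariants stabilise, because R/aR is Artinian for
   a \<noteq> 0. Hence S/I is Artinian for every nonzero I.

   If P1 \<subset> P2 are nonzero primes, let P \<subseteq> P1 be a prime of the form (cR : b) with c \<noteq> 0, and put
   v = b/c in the fraction field Q, on which \<theta> acts by the quotient rule. The S-module R \<subseteq> Q is
   simple by \<delta>-simplicity and meets every nonzero submodule of Q, so S v is a cyclic essential
   extension of it. Modulo the localisation A of R at P, the elements \<theta>^i v are independent over
   R/P, again by \<delta>-simplicity. Therefore, for t in P2 but not in P1, the submodules S t^k v form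
   a strictly descending chain. *)

theory Submission
  imports Defs
begin

section \<open>Chain conditions in commutative rings\<close>

text \<open>Two obstacles shape the argument. For the Artinian direction, degree and leading
  coefficients control a chain of left ideals only when all its members share a nonzero element, so
  a cyclic module whose generator has zero annihilator needs its own argument. Such a module is a
  copy of S, which is a domain; a simple submodule then forces some nonzero x in S to have a left
  inverse, and the whole module turns out to be simple.

  For the other direction, a generator v is wanted whose annihilator modulo A is a prime. If P1 =
  cR, then v = 1/c serves. In general P1 need not be of the form (cR : b): a prime of height two in
  a polynomial ring over a field never is, for c nonzero. A prime P of this form inside P1 suffices,
  because t remains outside P while P + tR remains inside the proper ideal P2.

  Localising at P allows factors outside P to be cancelled modulo A. This is the point of the
  independence argument: a dependence among the \<theta>^i v whose leading coefficient lies outside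
  P would make a saturated module stable under \<theta>, against \<delta>-simplicity.\<close>

definition acc_ideals :: "('a, 'm) ring_scheme \<Rightarrow> bool" where
  "acc_ideals R \<longleftrightarrow> (\<forall>F. (\<forall>i::nat. ideal (F i) R) \<and> (\<forall>i. F i \<subseteq> F (Suc i)) \<longrightarrow> (\<exists>n. \<forall>m\<ge>n. F m = F n))"

text \<open>The range of an ascending sequence is a chain of ideals, and in a Noetherian ring the
  union of a nonempty chain is one of its members.\<close>

lemma noetherian_ring_imp_acc_ideals:
  assumes "noetherian_ring R"
  shows "acc_ideals R"
  unfolding acc_ideals_def
proof (intro allI impI)
  fix F :: "nat \<Rightarrow> 'a set"
  assume F: "(\<forall>i. ideal (F i) R) \<and> (\<forall>i. F i \<subseteq> F (Suc i))"
  have mono: "F i \<subseteq> F j" if "i \<le> j" for i j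
    by (rule lift_Suc_mono_le[of F]) (use F that in auto)
  have lin: "F i \<subseteq> F j \<or> F j \<subseteq> F i" for i j
    using mono[of i j] mono[of j i] nat_le_linear[of i j] by (elim disjE) simp_all
  have "subset.chain {I. ideal I R} (range F)"
    unfolding subset_chain_def by (intro conjI ballI; (elim rangeE)?; use F lin in auto)
  then have "\<Union>(range F) \<in> range F"
    by (intro noetherian_ring.ideal_chain_is_trivial[OF assms]) auto
  then obtain n where "F n = \<Union>(range F)" by auto
  then have "F m = F n" if "m \<ge> n" for m
    using mono[OF that] by auto
  then show "\<exists>n. \<forall>m\<ge>n. F m = F n" by blast
qed

text \<open>Dependent choice turns a family without maximal member into a strictly ascending
  sequence. This is the form of Noetherian induction used below.\<close>

lemma acc_ideals_maximal:
  assumes acc: "acc_ideals R" and X: "X \<noteq> {}" "\<And>I. I \<in> X \<Longrightarrow> ideal I R"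
  shows "\<exists>I\<in>X. \<forall>J\<in>X. I \<subseteq> J \<longrightarrow> J = I"
proof (rule ccontr)
  assume "\<not> ?thesis"
  then have *: "\<exists>J. J \<in> X \<and> I \<subset> J" if "I \<in> X" for I
    using that by blast
  have "\<exists>F. \<forall>n::nat. F n \<in> X \<and> F n \<subset> F (Suc n)"
    by (rule dependent_nat_choice) (use X(1) * in auto)
  then obtain F where F: "\<And>n::nat. F n \<in> X" "\<And>n. F n \<subset> F (Suc n)" by blast
  have "(\<forall>i. ideal (F i) R) \<and> (\<forall>i. F i \<subseteq> F (Suc i))"
    using F X(2) by blast
  with acc obtain n where "\<forall>m\<ge>n. F m = F n"
    unfolding acc_ideals_def by blast
  then have "F (Suc n) = F n" using le_SucI[OF order_refl] by blast
  then show False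
    using F(2)[of n] by blast
qed

context cring
begin

lemma ideal_iff:
  "ideal I R \<longleftrightarrow> I \<subseteq> carrier R \<and> \<zero> \<in> I \<and> (\<forall>a\<in>I. \<forall>b\<in>I. a \<oplus> b \<in> I) \<and>
     (\<forall>a\<in>I. \<forall>x\<in>carrier R. x \<otimes> a \<in> I)" (is "_ \<longleftrightarrow> ?rhs")
proof
  assume "ideal I R"
  then interpret ideal I R .
  show ?rhs using a_subset I_l_closed by auto
next
  assume I: ?rhs
  then have "\<ominus> a \<in> I" if "a \<in> I" for a
    using that l_minus[of \<one> a] by (metis a_inv_closed l_one one_closed subsetD)
  with I show "ideal I R"
    by (intro idealI subgroup.intro) (auto simp: a_inv_def[symmetric] m_comm subset_iff ring_axioms)
qed

lemma ideal_minus_closed: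
  assumes "ideal I R" "a \<in> I" "b \<in> I"
  shows "a \<ominus> b \<in> I"
  using assms by (simp add: a_minus_def additive_subgroup.a_closed additive_subgroup.a_inv_closed ideal_def)

lemma ideal_colon:
  assumes "ideal I R" "a \<in> carrier R"
  shows "ideal {r \<in> carrier R. r \<otimes> a \<in> I} R"
  using assms by (auto simp: ideal_iff l_distr m_assoc)

lemma ideal_add_principal:
  assumes "ideal I R" "a \<in> carrier R"
  shows "ideal {x \<oplus> r \<otimes> a | x r. x \<in> I \<and> r \<in> carrier R} R"
proof -
  have "I <+>\<^bsub>R\<^esub> PIdl a = {x \<oplus> r \<otimes> a | x r. x \<in> I \<and> r \<in> carrier R}"
    by (auto simp: set_add_def' cgenideal_def)
  then show ?thesis
    using add_ideals[OF assms(1) cgenideal_ideal[OF assms(2)]] by simp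
qed

lemma acc_ideals_ex_maximal:
  assumes acc: "acc_ideals R" and I: "ideal I R" "I \<noteq> carrier R"
  obtains M where "maximalideal M R" "I \<subseteq> M"
proof -
  let ?X = "{J. ideal J R \<and> J \<noteq> carrier R \<and> I \<subseteq> J}"
  have "?X \<noteq> {}" using I by auto
  then have "\<exists>M\<in>?X. \<forall>J\<in>?X. M \<subseteq> J \<longrightarrow> J = M"
    by (rule acc_ideals_maximal[OF acc]) simp
  then obtain M where M: "M \<in> ?X" and max: "\<forall>J\<in>?X. M \<subseteq> J \<longrightarrow> J = M" ..
  have "maximalideal M R"
  proof (rule maximalidealI)
    fix J assume "ideal J R" "M \<subseteq> J"
    with M max show "J = M \<or> J = carrier R" by auto
  qed (use M in auto)
  with M that show thesis by auto
qed

text \<open>\<open>R/I\<close> is Artinian for nonzero \<open>I\<close>. A maximal counterexample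
  \<open>I\<close> is not prime, so \<open>a \<otimes> b \<in> I\<close> with both factors outside.
  Then \<open>I + aR\<close> and \<open>(I : a)\<close> are strictly larger and satisfy the claim,
  and \<open>R/I\<close> is an extension of \<open>R/(I + aR)\<close> by a copy of
  \<open>R/(I : a)\<close>.\<close>

lemma dcc_ideals_above:
  assumes acc: "acc_ideals R"
    and max: "\<And>P. primeideal P R \<Longrightarrow> P \<noteq> {\<zero>} \<Longrightarrow> maximalideal P R"
    and I: "ideal I R" "I \<noteq> {\<zero>}"
    and F: "\<And>i::nat. ideal (F i) R" "\<And>i. F (Suc i) \<subseteq> F i" "\<And>i. I \<subseteq> F i"
  shows "\<exists>n. \<forall>m\<ge>n. F m = F n"
proof -
  define dcc where "dcc I \<longleftrightarrow> (\<forall>F. (\<forall>i::nat. ideal (F i) R \<and> F (Suc i) \<subseteq> F i \<and> I \<subseteq> F i) \<longrightarrow>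
    (\<exists>n. \<forall>m\<ge>n. F m = F n))" for I
  have "dcc I"
  proof (rule ccontr)
    assume "\<not> dcc I"
    then have "{I. ideal I R \<and> I \<noteq> {\<zero>} \<and> \<not> dcc I} \<noteq> {}" (is "?X \<noteq> {}")
      using assms(3,4) by auto
    then have "\<exists>I\<in>?X. \<forall>J\<in>?X. I \<subseteq> J \<longrightarrow> J = I"
      by (rule acc_ideals_maximal[OF acc]) simp
    then obtain I where "I \<in> ?X" "\<forall>J\<in>?X. I \<subseteq> J \<longrightarrow> J = I" ..
    then have I: "ideal I R" "I \<noteq> {\<zero>}" "\<not> dcc I"
      and Imax: "\<And>J. ideal J R \<Longrightarrow> J \<noteq> {\<zero>} \<Longrightarrow> I \<subset> J \<Longrightarrow> dcc J"
      by auto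
    have I_sub: "I \<subseteq> carrier R" and I0: "\<zero> \<in> I" using I(1) by (auto simp: ideal_iff)
    obtain F where F: "\<And>i. ideal (F i) R" "\<And>i. F (Suc i) \<subseteq> F i" "\<And>i. I \<subseteq> F i"
      and nF: "\<not> (\<exists>n::nat. \<forall>m\<ge>n. F m = F n)"
      using I(3) unfolding dcc_def by blast
    have Fmono: "F m \<subseteq> F n" if "n \<le> m" for n m
      using that F(2) by (rule lift_Suc_antimono_le[of F, rotated])
    have F_sub: "F i \<subseteq> carrier R" for i using F(1)[of i] by (simp add: ideal_iff)
    have not_max: "\<not> maximalideal I R"
    proof
      assume "maximalideal I R"
      then have cases: "F i = I \<or> F i = carrier R" for i
        using maximalideal.I_maximal F F_sub by metis
      show False
      proof (cases "\<exists>n. F n = I")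
        case True
        then obtain n where "F n = I" ..
        then have "\<forall>m\<ge>n. F m = F n" using Fmono F(3) by blast
        with nF show False by blast
      qed (use cases nF in auto)
    qed
    then have "\<not> primeideal I R" using max I by blast
    moreover have "carrier R \<noteq> I"
      using nF F(3) F_sub by blast
    ultimately obtain a b where ab: "a \<in> carrier R" "b \<in> carrier R" "a \<otimes> b \<in> I" "a \<notin> I" "b \<notin> I"
      using primeidealI[OF I(1) is_cring] by blast
    define add where "add J = {x \<oplus> r \<otimes> a | x r. x \<in> J \<and> r \<in> carrier R}" for J
    define colon where "colon J = {r \<in> carrier R. r \<otimes> a \<in> J}" for J
    have id_add: "ideal (add J) R" and id_colon: "ideal (colon J) R" if "ideal J R" for J
      using ideal_add_principal[OF that ab(1)] ideal_colon[OF that ab(1)]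
      by (simp_all add: add_def colon_def)
    have I_add: "I \<subseteq> add I"
    proof
      fix x assume "x \<in> I"
      then have "x = x \<oplus> \<zero> \<otimes> a" using I_sub ab(1) by auto
      then show "x \<in> add I" unfolding add_def using \<open>x \<in> I\<close> by blast
    qed
    have "a = \<zero> \<oplus> \<one> \<otimes> a" using ab(1) by simp
    then have "a \<in> add I"
      unfolding add_def using I0 by blast
    then have "I \<subset> add I" using I_add ab(4) by blast
    moreover from this have "add I \<noteq> {\<zero>}" using I(2) I0 by blast
    ultimately have dcc1: "dcc (add I)" by (intro Imax id_add I(1))
    have "I \<subseteq> colon I"
      using ideal.I_r_closed[OF I(1)] I_sub ab(1) by (auto simp: colon_def)
    moreover have "b \<in> colon I" using ab m_comm by (simp add: colon_def)
    ultimately have "I \<subset> colon I" using ab(5) by blast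
    moreover from this have "colon I \<noteq> {\<zero>}" using I(2) I0 by blast
    ultimately have dcc2: "dcc (colon I)" by (intro Imax id_colon I(1))
    have "add (F (Suc i)) \<subseteq> add (F i)" "add I \<subseteq> add (F i)" for i
      using F(2,3)[of i] unfolding add_def by blast+
    then have "\<exists>n. \<forall>m\<ge>n. add (F m) = add (F n)"
      by (intro dcc1[unfolded dcc_def, rule_format]) (simp add: id_add F(1))
    then obtain n1 where n1: "\<And>m. m \<ge> n1 \<Longrightarrow> add (F m) = add (F n1)" by blast
    have "colon (F (Suc i)) \<subseteq> colon (F i)" "colon I \<subseteq> colon (F i)" for i
      using F(2,3)[of i] unfolding colon_def by blast+
    then have "\<exists>n. \<forall>m\<ge>n. colon (F m) = colon (F n)"
      by (intro dcc2[unfolded dcc_def, rule_format]) (simp add: id_colon F(1))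
    then obtain n2 where n2: "\<And>m. m \<ge> n2 \<Longrightarrow> colon (F m) = colon (F n2)" by blast
    define n where "n = max n1 n2"
    \<comment> \<open>Nested ideals with the same sum with \<open>aR\<close> and the same colon by
      \<open>a\<close> coincide: an element of the larger one differs from an element of the smaller
      one by some \<open>r \<otimes> a\<close>, and \<open>r\<close> lies in the common
      colon.\<close>
    have "F n \<subseteq> F m" if "m \<ge> n" for m
    proof
      fix x assume x: "x \<in> F n"
      have eq: "add (F m) = add (F n)" "colon (F m) = colon (F n)"
        using n1[of m] n1[of n] n2[of m] n2[of n] that by (auto simp: n_def)
      have xR: "x \<in> carrier R" using x F_sub by blast
      then have "x = x \<oplus> \<zero> \<otimes> a" using ab(1) by simp
      then have "x \<in> add (F n)"
        unfolding add_def using x by blast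
      then have "x \<in> add (F m)" using eq(1) by simp
      then obtain y r where y: "y \<in> F m" "r \<in> carrier R" "x = y \<oplus> r \<otimes> a"
        unfolding add_def by blast
      have "y \<in> carrier R" using y(1) F_sub by blast
      then have "r \<otimes> a = x \<ominus> y" using y(2,3) ab(1) by algebra
      then have "r \<in> colon (F n)"
        using ideal_minus_closed[OF F(1) x, of y] y(1,2) Fmono[OF that] by (auto simp: colon_def)
      then have "r \<otimes> a \<in> F m" using eq(2) by (auto simp: colon_def)
      then show "x \<in> F m" using y F(1)[of m] by (auto simp: ideal_iff)
    qed
    then have "\<forall>m\<ge>n. F m = F n" using Fmono by blast
    with nF show False by blast
  qed
  then show ?thesis using F unfolding dcc_def by blast
qed

end

text \<open>A maximal ideal \<open>M\<close> properly above \<open>P\<close> would give the chain of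
  primes \<open>0\<close>, \<open>P\<close>, \<open>M\<close> of length two; \<open>0\<close> is
  prime because \<open>R\<close> is a domain.\<close>

lemma krull_dim_le_1_maximal:
  fixes R :: "('a, 'm) ring_scheme" (structure)
  assumes R: "domain R" and acc: "acc_ideals R" and dim: "krull_dim R \<le> 1"
    and P: "primeideal P R" "P \<noteq> {\<zero>\<^bsub>R\<^esub>}"
  shows "maximalideal P R"
proof -
  interpret domain R by (rule R)
  interpret P: primeideal P R by (rule P)
  obtain M where M: "maximalideal M R" "P \<subseteq> M"
    using acc_ideals_ex_maximal[OF acc P.is_ideal P.I_notcarr[symmetric]] .
  have "M = P"
  proof (rule ccontr)
    assume "M \<noteq> P"
    define Q where "Q i = (if i = 0 then {\<zero>} else if i = 1 then P else M)" for i :: nat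
    have "\<forall>i\<le>2. primeideal (Q i) R"
      using P(1) maximalideal_prime[OF M(1)] zeroprimeideal by (simp add: Q_def)
    moreover have "{\<zero>} \<subset> P" using P.zero_closed P(2) by blast
    moreover have "P \<subset> M" using M(2) \<open>M \<noteq> P\<close> by blast
    ultimately have "(\<forall>i\<le>2. primeideal (Q i) R) \<and> (\<forall>i<2. Q i \<subset> Q (Suc i))"
      by (simp add: Q_def)
    then have "2 \<in> {n. \<exists>P :: nat \<Rightarrow> 'a set. (\<forall>i\<le>n. primeideal (P i) R) \<and> (\<forall>i<n. P i \<subset> P (Suc i))}"
      by blast
    then have "enat 2 \<le> krull_dim R"
      unfolding krull_dim_def by (rule SUP_upper)
    also note dim
    finally show False by (simp add: one_enat_def)
  qed
  with M(1) show ?thesis by simp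
qed

text \<open>Among the annihilators of elements of \<open>R/cR\<close> that are contained in
  \<open>P\<close>, a maximal one is prime. Requiring containment in \<open>P\<close>, instead of
  mere properness, has the effect of passing to the localisation at \<open>P\<close> before choosing
  an associated prime.\<close>

lemma (in cring) ex_associated_prime:
  assumes acc: "acc_ideals R" and P: "primeideal P R" and c: "c \<in> P"
  shows "\<exists>b\<in>carrier R. primeideal {r \<in> carrier R. r \<otimes> b \<in> PIdl c} R \<and>
    {r \<in> carrier R. r \<otimes> b \<in> PIdl c} \<subseteq> P"
proof -
  interpret P: primeideal P R by (rule P)
  have cR: "c \<in> carrier R" using c P.a_subset by blast
  have PIdl: "ideal (PIdl c) R" by (rule cgenideal_ideal[OF cR])
  define ann where "ann b = {r \<in> carrier R. r \<otimes> b \<in> PIdl c}" for b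
  have ann_ideal: "ideal (ann b) R" if "b \<in> carrier R" for b
    unfolding ann_def by (rule ideal_colon[OF PIdl that])
  have ann_mult: "ann (x \<otimes> b) = {r \<in> carrier R. r \<otimes> x \<in> ann b}"
    if "x \<in> carrier R" "b \<in> carrier R" for x b
    using that by (auto simp: ann_def m_assoc)
  define X where "X = ann ` {b \<in> carrier R. ann b \<subseteq> P}"
  have "PIdl c \<subseteq> P" by (rule cgenideal_minimal[OF P.is_ideal c])
  then have "ann \<one> \<subseteq> P" by (auto simp: ann_def)
  then have "X \<noteq> {}" by (auto simp: X_def)
  then have "\<exists>I\<in>X. \<forall>J\<in>X. I \<subseteq> J \<longrightarrow> J = I"
    by (rule acc_ideals_maximal[OF acc]) (auto simp: X_def ann_ideal)
  then obtain b where b: "b \<in> carrier R" "ann b \<subseteq> P"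
    and max: "\<And>d. d \<in> carrier R \<Longrightarrow> ann d \<subseteq> P \<Longrightarrow> ann b \<subseteq> ann d \<Longrightarrow> ann d = ann b"
    by (auto simp: X_def)
  have mono: "ann b \<subseteq> ann (x \<otimes> b)" if "x \<in> carrier R" for x
    unfolding ann_mult[OF that b(1)]
    using that ideal.I_r_closed[OF ann_ideal[OF b(1)]] by (auto simp: ann_def)
  have "primeideal (ann b) R"
  proof (rule primeidealI[OF ann_ideal[OF b(1)] is_cring])
    show "carrier R \<noteq> ann b" using b(2) P.I_notcarr P.a_subset by blast
    fix x y assume x: "x \<in> carrier R" and y: "y \<in> carrier R" and xy: "x \<otimes> y \<in> ann b"
    show "x \<in> ann b \<or> y \<in> ann b"
    proof (rule ccontr)
      assume neg: "\<not> (x \<in> ann b \<or> y \<in> ann b)"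
      have "y \<in> ann (x \<otimes> b)" using xy x y by (simp add: ann_mult[OF x b(1)] m_comm)
      then have "ann (x \<otimes> b) \<noteq> ann b" using neg by blast
      then have "\<not> ann (x \<otimes> b) \<subseteq> P" using max[of "x \<otimes> b"] mono[OF x] x b(1) by blast
      then obtain s where s: "s \<in> carrier R" "s \<otimes> x \<in> ann b" "s \<notin> P"
        using x b(1) by (auto simp: ann_mult)
      \<comment> \<open>Multiplying \<open>b\<close> by \<open>s \<notin> P\<close> keeps the
        annihilator inside \<open>P\<close>, so maximality forces
        \<open>ann (s \<otimes> b) = ann b\<close>. But \<open>x\<close> annihilates
        \<open>s \<otimes> b\<close> modulo \<open>cR\<close> and not \<open>b\<close>.\<close>
      have "ann (s \<otimes> b) \<subseteq> P"
      proof
        fix r assume "r \<in> ann (s \<otimes> b)"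
        then have r: "r \<in> carrier R" "r \<otimes> s \<in> ann b" using s(1) b(1) by (auto simp: ann_mult)
        then have "r \<otimes> s \<in> P" using b(2) by blast
        then show "r \<in> P" using P.I_prime[OF r(1) s(1)] s(3) by blast
      qed
      then have "ann (s \<otimes> b) = ann b" using max[of "s \<otimes> b"] mono[OF s(1)] s(1) b(1) by blast
      moreover have "x \<in> ann (s \<otimes> b)" using s x by (simp add: ann_mult[OF s(1) b(1)] m_comm)
      ultimately show False using neg by blast
    qed
  qed
  with b show ?thesis unfolding ann_def by blast
qed

section \<open>Hilbert's basis theorem\<close>

text \<open>The elements of \<open>A[x]\<close> that have some expression of degree strictly below
  the index. The recursion peels off the top coefficient, as the degree inductions do.\<close>

primrec power_span :: "('a, 'm) ring_scheme \<Rightarrow> 'a set \<Rightarrow> 'a \<Rightarrow> nat \<Rightarrow> 'a set" where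
  "power_span R A x 0 = {\<zero>\<^bsub>R\<^esub>}"
| "power_span R A x (Suc n) = {a \<otimes>\<^bsub>R\<^esub> x [^]\<^bsub>R\<^esub> n \<oplus>\<^bsub>R\<^esub> y | a y. a \<in> A \<and> y \<in> power_span R A x n}"

text \<open>The basis theorem is proved for the subring \<open>A[x]\<close> of \<open>R\<close>
  itself, so that generators of an algebra can be adjoined one after another inside a fixed
  ring.\<close>

locale adjoin_element = cring R for R (structure) +
  fixes A x
  assumes subring: "subring A R" and x_closed [simp]: "x \<in> carrier R"
begin

abbreviation V :: "nat \<Rightarrow> 'a set" where "V \<equiv> power_span R A x"

lemma A_sub: "A \<subseteq> carrier R"
  and A_zero: "\<zero> \<in> A" and A_one: "\<one> \<in> A"
  and A_add: "a \<in> A \<Longrightarrow> b \<in> A \<Longrightarrow> a \<oplus> b \<in> A"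
  and A_mult: "a \<in> A \<Longrightarrow> b \<in> A \<Longrightarrow> a \<otimes> b \<in> A"
  and A_neg: "a \<in> A \<Longrightarrow> \<ominus> a \<in> A"
  using subring by (auto simp: subringE)

lemma A_carrier: "a \<in> A \<Longrightarrow> a \<in> carrier R"
  using A_sub by blast

lemma V_carrier: "y \<in> V n \<Longrightarrow> y \<in> carrier R"
  by (induction n arbitrary: y) (auto simp: A_carrier)

lemma V_SucI: "a \<in> A \<Longrightarrow> y \<in> V n \<Longrightarrow> a \<otimes> x [^] n \<oplus> y \<in> V (Suc n)"
  by auto

lemma V_SucE:
  assumes "y \<in> V (Suc n)"
  obtains a z where "a \<in> A" "z \<in> V n" "y = a \<otimes> x [^] n \<oplus> z"
  using assms by auto

declare power_span.simps(2) [simp del]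

lemma V_zero: "\<zero> \<in> V n"
proof (induction n)
  case (Suc n)
  then show ?case using V_SucI[OF A_zero Suc] by simp
qed simp

lemma V_Suc: "y \<in> V n \<Longrightarrow> y \<in> V (Suc n)"
  using V_SucI[OF A_zero, of y n] V_carrier[of y n] by simp

lemma V_mono: "y \<in> V n \<Longrightarrow> n \<le> m \<Longrightarrow> y \<in> V m"
  by (induction m) (auto simp: le_Suc_eq V_Suc)

lemma V_add: "y \<in> V n \<Longrightarrow> z \<in> V n \<Longrightarrow> y \<oplus> z \<in> V n"
proof (induction n arbitrary: y z)
  case (Suc n)
  obtain a y' where y: "a \<in> A" "y' \<in> V n" "y = a \<otimes> x [^] n \<oplus> y'" by (rule V_SucE[OF Suc.prems(1)])
  obtain b z' where z: "b \<in> A" "z' \<in> V n" "z = b \<otimes> x [^] n \<oplus> z'" by (rule V_SucE[OF Suc.prems(2)])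
  have "a \<in> carrier R" "b \<in> carrier R" "y' \<in> carrier R" "z' \<in> carrier R" "x [^] n \<in> carrier R"
    using y z by (auto simp: A_carrier V_carrier)
  then have "y \<oplus> z = (a \<oplus> b) \<otimes> x [^] n \<oplus> (y' \<oplus> z')"
    unfolding y z by algebra
  then show ?case
    using V_SucI[OF A_add[OF y(1) z(1)] Suc.IH[OF y(2) z(2)]] by simp
qed simp

lemma V_scale: "b \<in> A \<Longrightarrow> y \<in> V n \<Longrightarrow> b \<otimes> y \<in> V n"
proof (induction n arbitrary: y)
  case (Suc n)
  obtain a y' where y: "a \<in> A" "y' \<in> V n" "y = a \<otimes> x [^] n \<oplus> y'" by (rule V_SucE[OF Suc.prems(2)])
  have "a \<in> carrier R" "b \<in> carrier R" "y' \<in> carrier R" "x [^] n \<in> carrier R"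
    using y Suc.prems by (auto simp: A_carrier V_carrier)
  then have "b \<otimes> y = (b \<otimes> a) \<otimes> x [^] n \<oplus> b \<otimes> y'"
    unfolding y by algebra
  then show ?case
    using V_SucI[OF A_mult[OF Suc.prems(1) y(1)] Suc.IH[OF Suc.prems(1) y(2)]] by simp
qed (simp add: A_carrier)

lemma V_shift: "y \<in> V n \<Longrightarrow> x \<otimes> y \<in> V (Suc n)"
proof (induction n arbitrary: y)
  case (Suc n)
  obtain a y' where y: "a \<in> A" "y' \<in> V n" "y = a \<otimes> x [^] n \<oplus> y'" by (rule V_SucE[OF Suc.prems])
  have "a \<in> carrier R" "y' \<in> carrier R" "x [^] n \<in> carrier R" "x \<in> carrier R"
    using y by (auto simp: A_carrier V_carrier)
  then have "x \<otimes> y = a \<otimes> (x [^] n \<otimes> x) \<oplus> x \<otimes> y'"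
    unfolding y by algebra
  then show ?case
    using V_SucI[OF y(1) Suc.IH[OF y(2)]] by simp
qed (simp add: V_zero)

lemma V_neg: "y \<in> V n \<Longrightarrow> \<ominus> y \<in> V n"
  using V_scale[OF A_neg[OF A_one], of y n] V_carrier[of y n] by (simp add: l_minus)

lemma V_shift_pow: "y \<in> V m \<Longrightarrow> x [^] n \<otimes> y \<in> V (m + n)"
proof (induction n)
  case (Suc n)
  have "x [^] Suc n \<otimes> y = x \<otimes> (x [^] n \<otimes> y)"
    using V_carrier[OF Suc.prems] by (simp add: m_ac)
  then show ?case using V_shift[OF Suc.IH[OF Suc.prems]] by simp
qed (simp add: V_carrier)

lemma V_mult: "y \<in> V n \<Longrightarrow> z \<in> V m \<Longrightarrow> y \<otimes> z \<in> V (m + n)"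
proof (induction n arbitrary: y)
  case (Suc n)
  obtain a y' where y: "a \<in> A" "y' \<in> V n" "y = a \<otimes> x [^] n \<oplus> y'" by (rule V_SucE[OF Suc.prems(1)])
  have "a \<in> carrier R" "y' \<in> carrier R" "z \<in> carrier R" "x [^] n \<in> carrier R"
    using y Suc.prems by (auto simp: A_carrier V_carrier)
  then have "y \<otimes> z = a \<otimes> (x [^] n \<otimes> z) \<oplus> y' \<otimes> z"
    unfolding y by algebra
  moreover have "a \<otimes> (x [^] n \<otimes> z) \<in> V (m + n)"
    by (intro V_scale y(1) V_shift_pow Suc.prems)
  ultimately have "y \<otimes> z \<in> V (m + n)"
    using V_add Suc.IH[OF y(2) Suc.prems(2)] by simp
  then show ?case by (simp add: V_Suc)
qed (simp add: V_carrier V_zero)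

definition adjoin :: "'a set" where "adjoin = (\<Union>n. V n)"

lemma adjoin_subring: "subring adjoin R"
proof (rule subringI)
  show "adjoin \<subseteq> carrier R" by (auto simp: adjoin_def V_carrier)
  show "\<one> \<in> adjoin"
    using V_SucI[OF A_one V_zero, of 0] by (auto simp: adjoin_def)
  show "\<ominus> y \<in> adjoin" if "y \<in> adjoin" for y
    using that V_neg by (auto simp: adjoin_def)
  show "y \<otimes> z \<in> adjoin" if "y \<in> adjoin" "z \<in> adjoin" for y z
    using that V_mult unfolding adjoin_def by blast
  show "y \<oplus> z \<in> adjoin" if yz: "y \<in> adjoin" "z \<in> adjoin" for y z
  proof -
    obtain m n where "y \<in> V m" "z \<in> V n" using yz by (auto simp: adjoin_def)
    then have "y \<oplus> z \<in> V (max m n)" by (intro V_add) (auto elim: V_mono)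
    then show ?thesis by (auto simp: adjoin_def)
  qed
qed

lemma A_adjoin: "A \<subseteq> adjoin"
  using V_SucI[OF _ V_zero, of _ 0] A_carrier by (force simp: adjoin_def)

lemma x_adjoin: "x \<in> adjoin"
proof -
  have "x \<in> V (Suc 1)" using V_SucI[OF A_one V_zero, of 1] by simp
  then show ?thesis unfolding adjoin_def by blast
qed

lemma adjoin_minimal:
  assumes B: "subring B R" and "A \<subseteq> B" "x \<in> B"
  shows "adjoin \<subseteq> B"
proof -
  have pow: "x [^] n \<in> B" for n :: nat
    by (induction n) (auto simp: assms subringE[OF B])
  have "V n \<subseteq> B" for n
  proof (induction n)
    case (Suc n)
    show ?case
    proof
      fix y assume "y \<in> V (Suc n)"
      then obtain a z where "a \<in> A" "z \<in> V n" "y = a \<otimes> x [^] n \<oplus> z" by (rule V_SucE)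
      then show "y \<in> B" using Suc \<open>A \<subseteq> B\<close> pow[of n] by (auto intro!: subringE[OF B])
    qed
  qed (simp add: subringE[OF B])
  then show ?thesis by (auto simp: adjoin_def)
qed

text \<open>Since \<open>x\<close> may be algebraic over \<open>A\<close>, an element can have several leading coefficients of degree \<open>n\<close>.\<close>

definition lead :: "'a set \<Rightarrow> nat \<Rightarrow> 'a set" where
  "lead I n = {a \<in> A. \<exists>y\<in>V n. a \<otimes> x [^] n \<oplus> y \<in> I}"

lemma sub_ideal_iff:
  assumes "subring B R"
  shows "ideal I (R\<lparr>carrier := B\<rparr>) \<longleftrightarrow> I \<subseteq> B \<and> \<zero> \<in> I \<and> (\<forall>a\<in>I. \<forall>b\<in>I. a \<oplus> b \<in> I) \<and>
     (\<forall>a\<in>I. \<forall>x\<in>B. x \<otimes> a \<in> I)"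
proof -
  interpret B: cring "R\<lparr>carrier := B\<rparr>"
    using assms by (metis subcring_iff subcringI' subringE(1))
  show ?thesis using B.ideal_iff by simp
qed

lemma lead_ideal:
  assumes "ideal I (R\<lparr>carrier := adjoin\<rparr>)"
  shows "ideal (lead I n) (R\<lparr>carrier := A\<rparr>)"
proof -
  have I: "I \<subseteq> adjoin" "\<zero> \<in> I" "\<And>a b. a \<in> I \<Longrightarrow> b \<in> I \<Longrightarrow> a \<oplus> b \<in> I"
    "\<And>a b. a \<in> I \<Longrightarrow> b \<in> adjoin \<Longrightarrow> b \<otimes> a \<in> I"
    using assms unfolding sub_ideal_iff[OF adjoin_subring] by auto
  show ?thesis
    unfolding sub_ideal_iff[OF subring]
  proof (intro conjI ballI)
    show "lead I n \<subseteq> A" by (auto simp: lead_def)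
    have "\<zero> \<otimes> x [^] n \<oplus> \<zero> \<in> I" using I(2) by simp
    then show "\<zero> \<in> lead I n" using V_zero A_zero unfolding lead_def by blast
  next
    fix a b assume "a \<in> lead I n" "b \<in> lead I n"
    then obtain y z where y: "a \<in> A" "b \<in> A" "y \<in> V n" "z \<in> V n"
      and "a \<otimes> x [^] n \<oplus> y \<in> I" "b \<otimes> x [^] n \<oplus> z \<in> I" by (auto simp: lead_def)
    then have "(a \<otimes> x [^] n \<oplus> y) \<oplus> (b \<otimes> x [^] n \<oplus> z) \<in> I" using I(3) by blast
    moreover have "a \<in> carrier R" "b \<in> carrier R" "y \<in> carrier R" "z \<in> carrier R" "x [^] n \<in> carrier R"
      using y by (auto simp: A_carrier V_carrier)
    then have "(a \<otimes> x [^] n \<oplus> y) \<oplus> (b \<otimes> x [^] n \<oplus> z) = (a \<oplus> b) \<otimes> x [^] n \<oplus> (y \<oplus> z)"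
      by algebra
    ultimately show "a \<oplus> b \<in> lead I n"
      using y V_add A_add unfolding lead_def by auto
  next
    fix a b assume "a \<in> lead I n" and b: "b \<in> A"
    then obtain y where y: "a \<in> A" "y \<in> V n" "a \<otimes> x [^] n \<oplus> y \<in> I" by (auto simp: lead_def)
    then have "b \<otimes> (a \<otimes> x [^] n \<oplus> y) \<in> I" using I(4) b A_adjoin by blast
    moreover have "a \<in> carrier R" "b \<in> carrier R" "y \<in> carrier R" "x [^] n \<in> carrier R"
      using y b by (auto simp: A_carrier V_carrier)
    then have "b \<otimes> (a \<otimes> x [^] n \<oplus> y) = (b \<otimes> a) \<otimes> x [^] n \<oplus> b \<otimes> y"
      by algebra
    ultimately show "b \<otimes> a \<in> lead I n"
      using y b V_scale A_mult unfolding lead_def by auto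
  qed
qed

lemma lead_mono: "I \<subseteq> J \<Longrightarrow> lead I n \<subseteq> lead J n"
  by (auto simp: lead_def)

lemma lead_Suc:
  assumes "ideal I (R\<lparr>carrier := adjoin\<rparr>)"
  shows "lead I n \<subseteq> lead I (Suc n)"
proof
  fix a assume "a \<in> lead I n"
  then obtain y where y: "a \<in> A" "y \<in> V n" "a \<otimes> x [^] n \<oplus> y \<in> I" by (auto simp: lead_def)
  then have "x \<otimes> (a \<otimes> x [^] n \<oplus> y) \<in> I"
    using assms x_adjoin unfolding sub_ideal_iff[OF adjoin_subring] by blast
  moreover have "a \<in> carrier R" "y \<in> carrier R" "x [^] n \<in> carrier R" "x \<in> carrier R"
    using y by (auto simp: A_carrier V_carrier)
  then have "x \<otimes> (a \<otimes> x [^] n \<oplus> y) = a \<otimes> (x [^] n \<otimes> x) \<oplus> x \<otimes> y"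
    by algebra
  ultimately show "a \<in> lead I (Suc n)"
    using y V_shift unfolding lead_def by auto
qed

text \<open>Induction on the degree bound: an element of \<open>J\<close> has a leading coefficient
  that also occurs in \<open>I\<close> in the same degree, and subtracting that element of
  \<open>I\<close> leaves an element of \<open>J\<close> of smaller degree.\<close>

lemma lead_eq_imp_eq:
  assumes I: "ideal I (R\<lparr>carrier := adjoin\<rparr>)" and J: "ideal J (R\<lparr>carrier := adjoin\<rparr>)"
    and "I \<subseteq> J" and lead: "\<And>n. lead J n \<subseteq> lead I n"
  shows "J = I"
proof -
  note I' = I[unfolded sub_ideal_iff[OF adjoin_subring]]
  note J' = J[unfolded sub_ideal_iff[OF adjoin_subring]]
  have "p \<in> I" if "p \<in> J" "p \<in> V n" for p n
    using that
  proof (induction n arbitrary: p)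
    case 0
    then show ?case using I' by simp
  next
    case (Suc n)
    obtain a y where p: "a \<in> A" "y \<in> V n" "p = a \<otimes> x [^] n \<oplus> y" by (rule V_SucE[OF Suc.prems(2)])
    then have "a \<in> lead J n" using Suc.prems(1) by (auto simp: lead_def)
    then have "a \<in> lead I n" using lead by blast
    then obtain z where z: "z \<in> V n" "a \<otimes> x [^] n \<oplus> z \<in> I" by (auto simp: lead_def)
    have c: "a \<in> carrier R" "y \<in> carrier R" "z \<in> carrier R" "x [^] n \<in> carrier R"
      using p z by (auto simp: A_carrier V_carrier)
    have "\<ominus> (a \<otimes> x [^] n \<oplus> z) = (\<ominus> \<one>) \<otimes> (a \<otimes> x [^] n \<oplus> z)"
      using c by algebra
    then have "\<ominus> (a \<otimes> x [^] n \<oplus> z) \<in> J"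
      using z(2) J' \<open>I \<subseteq> J\<close> A_neg[OF A_one] A_adjoin by (metis subsetD)
    then have "p \<oplus> \<ominus> (a \<otimes> x [^] n \<oplus> z) \<in> J"
      using J' Suc.prems(1) by blast
    moreover have eq: "p \<oplus> \<ominus> (a \<otimes> x [^] n \<oplus> z) = y \<oplus> \<ominus> z"
      unfolding p using c by algebra
    ultimately have "y \<oplus> \<ominus> z \<in> I"
      using Suc.IH[of "y \<oplus> \<ominus> z"] V_add[OF p(2) V_neg[OF z(1)]] by simp
    then have "(y \<oplus> \<ominus> z) \<oplus> (a \<otimes> x [^] n \<oplus> z) \<in> I" using I' z(2) by blast
    moreover have "(y \<oplus> \<ominus> z) \<oplus> (a \<otimes> x [^] n \<oplus> z) = p"
      unfolding p using c by algebra
    ultimately show ?case by simp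
  qed
  then have "J \<subseteq> I" using J' by (auto simp: adjoin_def)
  with \<open>I \<subseteq> J\<close> show ?thesis by blast
qed

text \<open>\<open>lead (F i) n\<close> grows in both arguments, so the diagonal
  \<open>lead (F i) i\<close> stabilises at some \<open>N\<close>. For \<open>n \<ge> N\<close> it
  squeezes \<open>lead (F m) n\<close> between equal bounds; only the finitely many degrees below
  \<open>N\<close> have to be stabilised one by one.\<close>

theorem hilbert_basis:
  assumes acc: "acc_ideals (R\<lparr>carrier := A\<rparr>)"
  shows "acc_ideals (R\<lparr>carrier := adjoin\<rparr>)"
  unfolding acc_ideals_def
proof (intro allI impI)
  fix F :: "nat \<Rightarrow> 'a set"
  assume "(\<forall>i. ideal (F i) (R\<lparr>carrier := adjoin\<rparr>)) \<and> (\<forall>i. F i \<subseteq> F (Suc i))"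
  then have F: "\<And>i. ideal (F i) (R\<lparr>carrier := adjoin\<rparr>)" "\<And>i. F i \<subseteq> F (Suc i)" by auto
  have stab: "\<exists>n. \<forall>m\<ge>n. G m = G n"
    if "\<And>i. ideal (G i) (R\<lparr>carrier := A\<rparr>)" "\<And>i. G i \<subseteq> G (Suc i)" for G :: "nat \<Rightarrow> 'a set"
    using acc that unfolding acc_ideals_def by blast
  have mono1: "lead (F i) n \<subseteq> lead (F j) n" if "i \<le> j" for i j n
    by (rule lead_mono, rule lift_Suc_mono_le[of F]) (use F(2) that in auto)
  have mono2: "lead (F i) m \<subseteq> lead (F i) n" if "m \<le> n" for i m n
    by (rule lift_Suc_mono_le[of "lead (F i)"]) (use lead_Suc[OF F(1)] that in auto)
  have "lead (F i) i \<subseteq> lead (F (Suc i)) (Suc i)" for i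
    using mono1[of i "Suc i"] mono2[of i "Suc i"] by (meson order_trans le_SucI order_refl)
  then obtain N where N: "\<And>m. m \<ge> N \<Longrightarrow> lead (F m) m = lead (F N) N"
    using stab[of "\<lambda>i. lead (F i) i"] lead_ideal[OF F(1)] by blast
  have "\<exists>M. \<forall>m\<ge>M. lead (F m) n = lead (F M) n" for n
    using stab[of "\<lambda>i. lead (F i) n"] lead_ideal[OF F(1)] mono1 by (meson le_SucI order_refl)
  then obtain M where M: "\<And>n m. m \<ge> M n \<Longrightarrow> lead (F m) n = lead (F (M n)) n" by metis
  \<comment> \<open>Past \<open>k\<close> the diagonal and each of the leading ideals in degree
    below \<open>N\<close> are constant.\<close>
  define k where "k = Max (insert N (M ` {..<N}))"
  have kN: "N \<le> k" and kM: "\<And>n. n < N \<Longrightarrow> M n \<le> k" by (auto simp: k_def)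
  have "F m = F k" if "m \<ge> k" for m
  proof (rule lead_eq_imp_eq[OF F(1) F(1)])
    show "F k \<subseteq> F m" by (rule lift_Suc_mono_le[of F]) (use F(2) that in auto)
    show "lead (F m) n \<subseteq> lead (F k) n" for n
    proof (cases "n < N")
      case True
      then show ?thesis using M[of n m] M[of n k] kM[of n] that by simp
    next
      case False
      let ?l = "max m n"
      have "lead (F m) n \<subseteq> lead (F ?l) ?l"
        by (rule order_trans[OF mono1[of m ?l] mono2]) auto
      also have "\<dots> = lead (F N) N" using N[of ?l] False by simp
      also have "\<dots> \<subseteq> lead (F k) n"
        by (rule order_trans[OF mono1[OF kN] mono2]) (use False in auto)
      finally show ?thesis .
    qed
  qed
  then show "\<exists>n. \<forall>m\<ge>n. F m = F n" by blast
qed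

end

text \<open>The image \<open>A\<close> of \<open>K\<close> has only the trivial ideals, because
  every nonzero \<open>\<iota> k\<close> has the inverse \<open>\<iota> (inv k)\<close>. From there
  the chain condition climbs through the generators by \<open>hilbert_basis\<close>.\<close>

lemma finitely_generated_algebra_acc_ideals:
  fixes K :: "('k, 'm) ring_scheme" and R :: "('k, 'a, 'n) module_scheme"
  assumes K: "field K" and alg: "algebra K R" and aff: "finitely_generated_algebra K R"
  shows "acc_ideals R"
proof -
  interpret K: field K by (rule K)
  interpret R: cring R using alg by (simp add: algebra_def)
  interpret alg: algebra K R by (rule alg)
  define \<iota> where "\<iota> k = k \<odot>\<^bsub>R\<^esub> \<one>\<^bsub>R\<^esub>" for k
  define A where "A = \<iota> ` carrier K"
  have \<iota>_closed: "\<iota> k \<in> carrier R" if "k \<in> carrier K" for k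
    using that by (simp add: \<iota>_def)
  have \<iota>_mult: "\<iota> k \<otimes>\<^bsub>R\<^esub> \<iota> l = \<iota> (k \<otimes>\<^bsub>K\<^esub> l)" if "k \<in> carrier K" "l \<in> carrier K" for k l
    using that by (simp add: \<iota>_def alg.smult_assoc2 alg.smult_assoc1)
  have A_sub: "A \<subseteq> carrier R" using \<iota>_closed by (auto simp: A_def)
  have A: "subring A R"
  proof (rule R.subringI)
    show "\<one>\<^bsub>R\<^esub> \<in> A"
      unfolding A_def \<iota>_def by (rule image_eqI[of _ _ "\<one>\<^bsub>K\<^esub>"]) auto
    show "\<ominus>\<^bsub>R\<^esub> a \<in> A" if a: "a \<in> A" for a
    proof -
      obtain k where k: "k \<in> carrier K" "a = \<iota> k" using a by (auto simp: A_def)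
      then have "\<ominus>\<^bsub>R\<^esub> a = \<iota> (\<ominus>\<^bsub>K\<^esub> k)" by (simp add: \<iota>_def alg.smult_l_minus)
      then show ?thesis using k by (simp add: A_def)
    qed
    show "a \<otimes>\<^bsub>R\<^esub> b \<in> A" if "a \<in> A" "b \<in> A" for a b
      using that \<iota>_mult by (auto simp: A_def)
    show "a \<oplus>\<^bsub>R\<^esub> b \<in> A" if ab: "a \<in> A" "b \<in> A" for a b
    proof -
      obtain k l where "k \<in> carrier K" "l \<in> carrier K" "a = \<iota> k" "b = \<iota> l"
        using ab by (auto simp: A_def)
      then have "k \<oplus>\<^bsub>K\<^esub> l \<in> carrier K" "a \<oplus>\<^bsub>R\<^esub> b = \<iota> (k \<oplus>\<^bsub>K\<^esub> l)"
        by (simp_all add: \<iota>_def alg.smult_l_distr)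
      then show ?thesis by (simp add: A_def)
    qed
  qed (rule A_sub)
  \<comment> \<open>Adjoining zero is a dummy choice: the interpretation serves to make
    \<open>sub_ideal_iff\<close> and \<open>A_zero\<close> available for \<open>A\<close>.\<close>
  interpret A: adjoin_element R A "\<zero>\<^bsub>R\<^esub>"
    by (intro adjoin_element.intro adjoin_element_axioms.intro R.is_cring A R.zero_closed)
  have trivial: "I = {\<zero>\<^bsub>R\<^esub>} \<or> I = A" if I: "ideal I (R\<lparr>carrier := A\<rparr>)" for I
  proof (cases "I = {\<zero>\<^bsub>R\<^esub>}")
    case False
    note I' = I[unfolded A.sub_ideal_iff[OF A]]
    obtain a where "a \<in> I" "a \<noteq> \<zero>\<^bsub>R\<^esub>" using False I' by blast
    then obtain k where k: "k \<in> carrier K" "\<iota> k \<in> I" "\<iota> k \<noteq> \<zero>\<^bsub>R\<^esub>"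
      using I' by (auto simp: A_def)
    then have "k \<noteq> \<zero>\<^bsub>K\<^esub>" by (auto simp: \<iota>_def alg.smult_l_null)
    then have unit: "k \<in> Units K" using k by (simp add: K.field_Units)
    then have "\<iota> (inv\<^bsub>K\<^esub> k) \<otimes>\<^bsub>R\<^esub> \<iota> k \<in> I" using I' k by (auto simp: A_def)
    then have "\<one>\<^bsub>R\<^esub> \<in> I" using unit k by (simp add: \<iota>_mult) (simp add: \<iota>_def)
    have "A \<subseteq> I"
    proof
      fix a assume "a \<in> A"
      then have "a \<otimes>\<^bsub>R\<^esub> \<one>\<^bsub>R\<^esub> \<in> I" using I' \<open>\<one>\<^bsub>R\<^esub> \<in> I\<close> by blast
      then show "a \<in> I" using \<open>a \<in> A\<close> A_sub by auto
    qed
    then show ?thesis using I' by blast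
  qed simp
  have acc: "acc_ideals (R\<lparr>carrier := A\<rparr>)"
    unfolding acc_ideals_def
  proof (intro allI impI)
    fix F :: "nat \<Rightarrow> 'a set"
    assume "(\<forall>i. ideal (F i) (R\<lparr>carrier := A\<rparr>)) \<and> (\<forall>i. F i \<subseteq> F (Suc i))"
    then have F: "\<And>i. F i = {\<zero>\<^bsub>R\<^esub>} \<or> F i = A" "\<And>i. F i \<subseteq> F (Suc i)" using trivial by auto
    have mono: "F i \<subseteq> F j" if "i \<le> j" for i j
      by (rule lift_Suc_mono_le[of F]) (use F(2) that in auto)
    show "\<exists>n. \<forall>m\<ge>n. F m = F n"
    proof (cases "\<exists>n. F n = A")
      case True
      then obtain n where n: "F n = A" ..
      have "F m = F n" if "m \<ge> n" for m
        using mono[OF that] F(1)[of m] n A.A_zero by auto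
      then show ?thesis by blast
    next
      case False
      then have "\<forall>m. F m = {\<zero>\<^bsub>R\<^esub>}" using F(1) by blast
      then show ?thesis by auto
    qed
  qed
  have gen: "acc_ideals (R\<lparr>carrier := generate_ring R (A \<union> X)\<rparr>)" if "finite X" "X \<subseteq> carrier R" for X
    using that
  proof (induction X)
    case empty
    have "h \<in> A" if "h \<in> generate_ring R A" for h
      using that by induction (auto intro: subringE[OF A])
    then have "generate_ring R A = A" by (auto intro: generate_ring.incl)
    then show ?case using acc by simp
  next
    case (insert x X)
    let ?B = "generate_ring R (A \<union> X)" and ?C = "generate_ring R (A \<union> insert x X)"
    have sub: "A \<union> X \<subseteq> carrier R" "A \<union> insert x X \<subseteq> carrier R" using A_sub insert.prems by auto
    have B: "subring ?B R" and C: "subring ?C R"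
      using sub by (auto intro: R.generate_ring_is_subring)
    interpret B: adjoin_element R ?B x
      by (intro adjoin_element.intro adjoin_element_axioms.intro R.is_cring B) (use insert.prems in auto)
    have "h \<in> B.adjoin" if "h \<in> ?C" for h
      using that
    proof induction
      case (incl h)
      then have "h = x \<or> h \<in> ?B" by (auto intro: generate_ring.incl)
      then show ?case using B.x_adjoin B.A_adjoin by blast
    qed (auto intro: subringE[OF B.adjoin_subring])
    moreover have "h \<in> ?C" if "h \<in> ?B" for h
      using that by induction (auto intro: generate_ring.intros)
    then have "B.adjoin \<subseteq> ?C"
      by (intro B.adjoin_minimal[OF C]) (auto intro: generate_ring.incl)
    ultimately have "?C = B.adjoin" by blast
    then show ?case using B.hilbert_basis insert by simp
  qed
  obtain X where X: "finite X" "X \<subseteq> carrier R" "generate_ring R (A \<union> X) = carrier R"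
    using aff by (auto simp: finitely_generated_algebra_def A_def \<iota>_def)
  show ?thesis using gen[OF X(1,2)] X(3) by simp
qed

section \<open>Modules over differential operator rings\<close>

context left_module
begin

lemma cyclic_submodule:
  assumes x: "x \<in> carrier M"
  shows "submodule ((\<lambda>s. s \<odot>\<^bsub>M\<^esub> x) ` carrier S) S M" (is "submodule ?Z S M")
    and "x \<in> (\<lambda>s. s \<odot>\<^bsub>M\<^esub> x) ` carrier S"
proof -
  show "submodule ?Z S M"
    unfolding submodule_iff
  proof (intro conjI ballI)
    show "?Z \<subseteq> carrier M" using x by auto
    show "\<zero>\<^bsub>M\<^esub> \<in> ?Z"
      by (rule image_eqI[of _ _ "\<zero>\<^bsub>S\<^esub>"]) (use smult_zero_left[OF x] in auto)
  next
    fix u w assume "u \<in> ?Z" "w \<in> ?Z"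
    then obtain s t where "s \<in> carrier S" "t \<in> carrier S" "u = s \<odot>\<^bsub>M\<^esub> x" "w = t \<odot>\<^bsub>M\<^esub> x" by auto
    then show "u \<oplus>\<^bsub>M\<^esub> w \<in> ?Z"
      using x smult_l_distr[of s t x] S.add.m_closed[of s t] by (intro image_eqI[of _ _ "s \<oplus>\<^bsub>S\<^esub> t"]) auto
  next
    fix s u assume "s \<in> carrier S" "u \<in> ?Z"
    then obtain t where "s \<in> carrier S" "t \<in> carrier S" "u = t \<odot>\<^bsub>M\<^esub> x" by auto
    then show "s \<odot>\<^bsub>M\<^esub> u \<in> ?Z"
      using x smult_assoc[of s t x] by (intro image_eqI[of _ _ "s \<otimes>\<^bsub>S\<^esub> t"]) auto
  qed
  show "x \<in> ?Z"
    by (rule image_eqI[of _ _ "\<one>\<^bsub>S\<^esub>"]) (use x in auto)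
qed

lemma cyclic_submodule_minimal:
  assumes "submodule L S M" "x \<in> L"
  shows "(\<lambda>s. s \<odot>\<^bsub>M\<^esub> x) ` carrier S \<subseteq> L"
  using assms by (auto simp: submodule_iff)

lemma submodule_restrict_iff:
  assumes N: "submodule N S M"
  shows "submodule L S (M\<lparr>carrier := N\<rparr>) \<longleftrightarrow> submodule L S M \<and> L \<subseteq> N"
proof -
  interpret N: left_module S "M\<lparr>carrier := N\<rparr>"
    by (rule restrict_left_module[OF N])
  show ?thesis
    unfolding N.submodule_iff submodule_iff using N by (auto simp: submodule_iff)
qed

end

text \<open>An \<open>R\<close>-module with such an operator \<open>D\<close> is a left module over
  the differential operator ring in which \<theta> acts as \<open>D\<close>; \<open>D_smult\<close>
  is the relation \<open>\<theta> a = a \<theta> + \<delta> a\<close> read on module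
  elements.\<close>

locale diff_module = derivation R \<delta> + module R Q for R (structure) and \<delta> and Q +
  fixes D
  assumes D_closed [simp, intro]: "x \<in> carrier Q \<Longrightarrow> D x \<in> carrier Q"
    and D_add: "\<lbrakk>x \<in> carrier Q; y \<in> carrier Q\<rbrakk> \<Longrightarrow> D (x \<oplus>\<^bsub>Q\<^esub> y) = D x \<oplus>\<^bsub>Q\<^esub> D y"
    and D_smult: "\<lbrakk>a \<in> carrier R; x \<in> carrier Q\<rbrakk> \<Longrightarrow>
      D (a \<odot>\<^bsub>Q\<^esub> x) = a \<odot>\<^bsub>Q\<^esub> D x \<oplus>\<^bsub>Q\<^esub> \<delta> a \<odot>\<^bsub>Q\<^esub> x"
begin

interpretation UP: UP_cring R "UP R"
  by unfold_locales auto

interpretation S: ring "diff_op_ring R \<delta>"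
  by (rule diff_op_ring_is_ring)

lemma D_zero: "D \<zero>\<^bsub>Q\<^esub> = \<zero>\<^bsub>Q\<^esub>"
  using D_add[of "\<zero>\<^bsub>Q\<^esub>" "\<zero>\<^bsub>Q\<^esub>"] D_closed[of "\<zero>\<^bsub>Q\<^esub>"]
  by (metis M.add.l_cancel_one' M.l_zero M.zero_closed)

lemma D_pow_closed [simp, intro]: "x \<in> carrier Q \<Longrightarrow> (D ^^ n) x \<in> carrier Q"
  by (induction n) auto

lemma D_pow_add:
  "\<lbrakk>x \<in> carrier Q; y \<in> carrier Q\<rbrakk> \<Longrightarrow> (D ^^ n) (x \<oplus>\<^bsub>Q\<^esub> y) = (D ^^ n) x \<oplus>\<^bsub>Q\<^esub> (D ^^ n) y"
  by (induction n) (simp_all add: D_add)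

lemma D_finsum: "f \<in> UNIV \<rightarrow> carrier Q \<Longrightarrow>
    D (\<Oplus>\<^bsub>Q\<^esub>i\<in>{..n::nat}. f i) = (\<Oplus>\<^bsub>Q\<^esub>i\<in>{..n}. D (f i))"
  by (induction n) (auto simp: Pi_def D_add)

lemma smult_finsum: "\<lbrakk>a \<in> carrier R; f \<in> UNIV \<rightarrow> carrier Q\<rbrakk> \<Longrightarrow>
    a \<odot>\<^bsub>Q\<^esub> (\<Oplus>\<^bsub>Q\<^esub>i\<in>{..n::nat}. f i) = (\<Oplus>\<^bsub>Q\<^esub>i\<in>{..n}. a \<odot>\<^bsub>Q\<^esub> f i)"
  by (induction n) (auto simp: Pi_def smult_r_distr)

definition act :: "(nat \<Rightarrow> 'a) \<Rightarrow> 'c \<Rightarrow> 'c" where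
  "act s x = (\<Oplus>\<^bsub>Q\<^esub>i\<in>{..deg R s}. coeff (UP R) s i \<odot>\<^bsub>Q\<^esub> (D ^^ i) x)"

definition diff_op_module :: "(nat \<Rightarrow> 'a, 'c) module" where
  "diff_op_module = \<lparr>carrier = carrier Q, mult = undefined, one = undefined, zero = \<zero>\<^bsub>Q\<^esub>,
     add = (\<oplus>\<^bsub>Q\<^esub>), smult = act\<rparr>"

lemma act_eq:
  assumes s: "s \<in> carrier (UP R)" and x: "x \<in> carrier Q"
    and N: "\<And>i. N < i \<Longrightarrow> coeff (UP R) s i = \<zero>"
  shows "act s x = (\<Oplus>\<^bsub>Q\<^esub>i\<in>{..N}. coeff (UP R) s i \<odot>\<^bsub>Q\<^esub> (D ^^ i) x)"
  unfolding act_def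
  by (rule M.add.finprod_mono_neutral_cong_left)
     (use s x N in \<open>auto intro!: UP.deg_aboveI simp: UP.deg_aboveD not_le smult_l_null\<close>)

lemma act_deg:
  assumes "s \<in> carrier (UP R)" "x \<in> carrier Q" "deg R s \<le> N"
  shows "act s x = (\<Oplus>\<^bsub>Q\<^esub>i\<in>{..N}. coeff (UP R) s i \<odot>\<^bsub>Q\<^esub> (D ^^ i) x)"
  using assms by (intro act_eq) (auto intro: UP.deg_aboveD)

lemma act_closed [simp]: "\<lbrakk>s \<in> carrier (UP R); x \<in> carrier Q\<rbrakk> \<Longrightarrow> act s x \<in> carrier Q"
  unfolding act_def by (auto intro!: M.finsum_closed)

lemma act_l_distr:
  assumes "p \<in> carrier (UP R)" "q \<in> carrier (UP R)" "x \<in> carrier Q"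
  shows "act (p \<oplus>\<^bsub>UP R\<^esub> q) x = act p x \<oplus>\<^bsub>Q\<^esub> act q x"
proof -
  define N where "N = Max {deg R p, deg R q, deg R (p \<oplus>\<^bsub>UP R\<^esub> q)}"
  have N: "deg R p \<le> N" "deg R q \<le> N" "deg R (p \<oplus>\<^bsub>UP R\<^esub> q) \<le> N"
    by (auto simp: N_def)
  show ?thesis
    using assms
    by (simp add: act_deg[OF _ _ N(1)] act_deg[OF _ _ N(2)] act_deg[OF _ _ N(3)]
        smult_l_distr M.finsum_addf Pi_def)
qed

lemma act_r_distr:
  assumes "p \<in> carrier (UP R)" "x \<in> carrier Q" "y \<in> carrier Q"
  shows "act p (x \<oplus>\<^bsub>Q\<^esub> y) = act p x \<oplus>\<^bsub>Q\<^esub> act p y"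
  using assms by (simp add: act_def D_pow_add smult_r_distr M.finsum_addf Pi_def)

lemma act_monom_0:
  assumes "a \<in> carrier R" "x \<in> carrier Q"
  shows "act (monom (UP R) a 0) x = a \<odot>\<^bsub>Q\<^esub> x"
  using assms by (subst act_eq[where N = 0]) auto

lemma act_smult:
  assumes "a \<in> carrier R" "q \<in> carrier (UP R)" "x \<in> carrier Q"
  shows "act (a \<odot>\<^bsub>UP R\<^esub> q) x = a \<odot>\<^bsub>Q\<^esub> act q x"
proof -
  have "act (a \<odot>\<^bsub>UP R\<^esub> q) x = (\<Oplus>\<^bsub>Q\<^esub>i\<in>{..deg R q}. coeff (UP R) (a \<odot>\<^bsub>UP R\<^esub> q) i \<odot>\<^bsub>Q\<^esub> (D ^^ i) x)"
    by (rule act_eq) (use assms in \<open>auto simp: UP.deg_aboveD\<close>)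
  also have "\<dots> = (\<Oplus>\<^bsub>Q\<^esub>i\<in>{..deg R q}. a \<odot>\<^bsub>Q\<^esub> (coeff (UP R) q i \<odot>\<^bsub>Q\<^esub> (D ^^ i) x))"
    by (rule M.finsum_cong') (use assms in \<open>auto simp: smult_assoc1\<close>)
  also have "\<dots> = a \<odot>\<^bsub>Q\<^esub> act q x"
    unfolding act_def by (rule smult_finsum[symmetric]) (use assms in auto)
  finally show ?thesis .
qed

text \<open>The Leibniz rule splits each \<open>D (c D^i x)\<close> into a term with
  \<open>D^(i + 1) x\<close> and one with \<open>\<delta> c\<close>. Regrouped by powers of
  \<open>D\<close>, these are the coefficients of \<open>T q\<close>. Associativity of the action
  reduces to this case.\<close>

lemma act_theta:
  assumes q: "q \<in> carrier (UP R)" and x: "x \<in> carrier Q"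
  shows "act (T q) x = D (act q x)"
proof -
  let ?N = "deg R q"
  let ?c = "coeff (UP R) q"
  let ?s = "\<lambda>i. if i = 0 then \<zero> else ?c (i - 1)"
  have above: "?c i = \<zero>" if "?N < i" for i
    using that q by (rule UP.deg_aboveD)
  have cl: "?c i \<in> carrier R" "\<delta> (?c i) \<in> carrier R" "(D ^^ i) x \<in> carrier Q" "D ((D ^^ i) x) \<in> carrier Q" for i
    using q x by (auto simp: deriv_closed)
  have "act (T q) x = (\<Oplus>\<^bsub>Q\<^esub>i\<in>{..Suc ?N}. coeff (UP R) (T q) i \<odot>\<^bsub>Q\<^esub> (D ^^ i) x)"
    by (rule act_eq) (use q x in \<open>auto simp: theta_closed coeff_theta above deriv_zero\<close>)
  also have "\<dots> = (\<Oplus>\<^bsub>Q\<^esub>i\<in>{..Suc ?N}. ?s i \<odot>\<^bsub>Q\<^esub> (D ^^ i) x \<oplus>\<^bsub>Q\<^esub> \<delta> (?c i) \<odot>\<^bsub>Q\<^esub> (D ^^ i) x)"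
    by (rule M.finsum_cong') (use q cl in \<open>auto simp: coeff_theta smult_l_distr\<close>)
  also have "\<dots> = (\<Oplus>\<^bsub>Q\<^esub>i\<in>{..Suc ?N}. ?s i \<odot>\<^bsub>Q\<^esub> (D ^^ i) x) \<oplus>\<^bsub>Q\<^esub>
      (\<Oplus>\<^bsub>Q\<^esub>i\<in>{..Suc ?N}. \<delta> (?c i) \<odot>\<^bsub>Q\<^esub> (D ^^ i) x)"
    by (rule M.finsum_addf) (use cl in auto)
  also have "(\<Oplus>\<^bsub>Q\<^esub>i\<in>{..Suc ?N}. ?s i \<odot>\<^bsub>Q\<^esub> (D ^^ i) x) = (\<Oplus>\<^bsub>Q\<^esub>i\<in>{..?N}. ?c i \<odot>\<^bsub>Q\<^esub> D ((D ^^ i) x))"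
    by (subst M.finsum_Suc2) (use cl x in \<open>auto simp: smult_l_null\<close>)
  also have "(\<Oplus>\<^bsub>Q\<^esub>i\<in>{..Suc ?N}. \<delta> (?c i) \<odot>\<^bsub>Q\<^esub> (D ^^ i) x) = (\<Oplus>\<^bsub>Q\<^esub>i\<in>{..?N}. \<delta> (?c i) \<odot>\<^bsub>Q\<^esub> (D ^^ i) x)"
    by (subst M.finsum_Suc) (use cl x in \<open>auto simp: above deriv_zero smult_l_null\<close>)
  also have "(\<Oplus>\<^bsub>Q\<^esub>i\<in>{..?N}. ?c i \<odot>\<^bsub>Q\<^esub> D ((D ^^ i) x)) \<oplus>\<^bsub>Q\<^esub> (\<Oplus>\<^bsub>Q\<^esub>i\<in>{..?N}. \<delta> (?c i) \<odot>\<^bsub>Q\<^esub> (D ^^ i) x) =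
      (\<Oplus>\<^bsub>Q\<^esub>i\<in>{..?N}. ?c i \<odot>\<^bsub>Q\<^esub> D ((D ^^ i) x) \<oplus>\<^bsub>Q\<^esub> \<delta> (?c i) \<odot>\<^bsub>Q\<^esub> (D ^^ i) x)"
    by (rule M.finsum_addf[symmetric]) (use cl in auto)
  also have "\<dots> = (\<Oplus>\<^bsub>Q\<^esub>i\<in>{..?N}. D (?c i \<odot>\<^bsub>Q\<^esub> (D ^^ i) x))"
    by (rule M.finsum_cong') (use cl in \<open>auto simp: D_smult\<close>)
  also have "\<dots> = D (act q x)"
    unfolding act_def by (rule D_finsum[symmetric]) (use cl in auto)
  finally show ?thesis .
qed

lemma act_theta_pow:
  "\<lbrakk>q \<in> carrier (UP R); x \<in> carrier Q\<rbrakk> \<Longrightarrow> act ((T ^^ n) q) x = (D ^^ n) (act q x)"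
  by (induction n) (simp_all add: act_theta theta_pow_closed)

lemma act_finsum:
  assumes "f \<in> UNIV \<rightarrow> carrier (UP R)" "x \<in> carrier Q"
  shows "act (\<Oplus>\<^bsub>UP R\<^esub>i\<in>{..n::nat}. f i) x = (\<Oplus>\<^bsub>Q\<^esub>i\<in>{..n}. act (f i) x)"
  using assms by (induction n) (auto simp: Pi_def act_l_distr)

lemma act_assoc:
  assumes p: "p \<in> carrier (UP R)" and q: "q \<in> carrier (UP R)" and x: "x \<in> carrier Q"
  shows "act (p \<otimes>\<^bsub>diff_op_ring R \<delta>\<^esub> q) x = act p (act q x)"
proof -
  have "act (p \<otimes>\<^bsub>diff_op_ring R \<delta>\<^esub> q) x =
      (\<Oplus>\<^bsub>Q\<^esub>i\<in>{..deg R p}. act (coeff (UP R) p i \<odot>\<^bsub>UP R\<^esub> (T ^^ i) q) x)"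
    using p q x by (simp add: diff_mult_deg[OF p q order_refl] act_finsum theta_pow_closed Pi_def)
  also have "\<dots> = act p (act q x)"
    unfolding act_def[of p]
    by (rule M.finsum_cong') (use p q x in \<open>auto simp: act_smult act_theta_pow theta_pow_closed\<close>)
  finally show ?thesis .
qed

sublocale diff_op_module: left_module "diff_op_ring R \<delta>" diff_op_module
proof -
  have "abelian_group diff_op_module"
    by (rule abelian_groupI)
       (auto simp: diff_op_module_def M.a_ac intro!: bexI[of _ "\<ominus>\<^bsub>Q\<^esub> _"] M.l_neg)
  moreover have "act \<one>\<^bsub>UP R\<^esub> x = x" if "x \<in> carrier Q" for x
    using act_monom_0[OF one_closed that] that by simp
  ultimately show "left_module (diff_op_ring R \<delta>) diff_op_module"
    by (auto simp: left_module_def left_module_axioms_def S.ring_axioms diff_op_module_def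
        act_l_distr act_r_distr act_assoc)
qed

text \<open>\<open>R\<close> and \<theta> generate the differential operator ring, so closure under
  scalars and \<open>D\<close> is enough. Later submodules are handled through this criterion,
  without reference to \<open>act\<close>.\<close>

lemma diff_op_submodule_iff:
  "submodule L (diff_op_ring R \<delta>) diff_op_module \<longleftrightarrow>
     L \<subseteq> carrier Q \<and> \<zero>\<^bsub>Q\<^esub> \<in> L \<and> (\<forall>x\<in>L. \<forall>y\<in>L. x \<oplus>\<^bsub>Q\<^esub> y \<in> L) \<and>
     (\<forall>a\<in>carrier R. \<forall>x\<in>L. a \<odot>\<^bsub>Q\<^esub> x \<in> L) \<and> (\<forall>x\<in>L. D x \<in> L)" (is "?l \<longleftrightarrow> ?r")
proof
  assume ?l
  then have L: "L \<subseteq> carrier Q" "\<zero>\<^bsub>Q\<^esub> \<in> L" "\<And>x y. x \<in> L \<Longrightarrow> y \<in> L \<Longrightarrow> x \<oplus>\<^bsub>Q\<^esub> y \<in> L"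
    "\<And>s x. s \<in> carrier (UP R) \<Longrightarrow> x \<in> L \<Longrightarrow> act s x \<in> L"
    by (auto simp: diff_op_module.submodule_iff) (auto simp: diff_op_module_def)
  have "a \<odot>\<^bsub>Q\<^esub> x \<in> L" if "a \<in> carrier R" "x \<in> L" for a x
    using L(4)[of "monom (UP R) a 0" x] that L(1) act_monom_0[of a x] by auto
  moreover have "D x \<in> L" if x: "x \<in> L" for x
  proof -
    have "x \<in> carrier Q" using x L(1) by blast
    then have "act (T \<one>\<^bsub>UP R\<^esub>) x = D x"
      using act_theta[of "\<one>\<^bsub>UP R\<^esub>" x] act_monom_0[OF one_closed, of x] by simp
    then show ?thesis using L(4)[of "T \<one>\<^bsub>UP R\<^esub>" x] x by (simp add: theta_closed)
  qed
  ultimately show ?r using L by auto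
next
  assume r: ?r
  have D: "(D ^^ n) x \<in> L" if "x \<in> L" for n x
    using that r by (induction n) auto
  have sum: "(\<Oplus>\<^bsub>Q\<^esub>i\<in>{..n::nat}. f i) \<in> L" if "\<And>i. f i \<in> L" for f n
  proof -
    have "f \<in> UNIV \<rightarrow> carrier Q" using that r by auto
    then show ?thesis by (induction n) (use that r in \<open>auto simp: Pi_def\<close>)
  qed
  have "act s x \<in> L" if "s \<in> carrier (UP R)" "x \<in> L" for s x
    unfolding act_def by (rule sum) (use that r D in auto)
  then show ?l using r by (auto simp: diff_op_module.submodule_iff) (auto simp: diff_op_module_def)
qed

end

section \<open>Fractions\<close>

context domain
begin

text \<open>The equivalence class of \<open>(a, b)\<close> under cross multiplication, so that
  equality of fractions is equality of sets.\<close>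

definition frac :: "'a \<Rightarrow> 'a \<Rightarrow> ('a \<times> 'a) set" where
  "frac a b = {(x, y). x \<in> carrier R \<and> y \<in> carrier R \<and> y \<noteq> \<zero> \<and> x \<otimes> b = a \<otimes> y}"

definition fractions :: "('a \<times> 'a) set set" where
  "fractions = {frac a b | a b. a \<in> carrier R \<and> b \<in> carrier R \<and> b \<noteq> \<zero>}"

lemma frac_eq_iff:
  assumes "a \<in> carrier R" "b \<in> carrier R" "b \<noteq> \<zero>" "c \<in> carrier R" "d \<in> carrier R" "d \<noteq> \<zero>"
  shows "frac a b = frac c d \<longleftrightarrow> a \<otimes> d = c \<otimes> b"
proof
  assume "frac a b = frac c d"
  moreover have "(a, b) \<in> frac a b" using assms by (simp add: frac_def)
  ultimately show "a \<otimes> d = c \<otimes> b" by (auto simp: frac_def)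
next
  have *: "x \<otimes> d = c \<otimes> y"
    if eq: "x \<otimes> b = a \<otimes> y" "a \<otimes> d = c \<otimes> b" and x: "x \<in> carrier R" "y \<in> carrier R"
      and cl: "a \<in> carrier R" "b \<in> carrier R" "b \<noteq> \<zero>" "c \<in> carrier R" "d \<in> carrier R" for a b c d x y
  proof -
    have "(x \<otimes> d) \<otimes> b = (x \<otimes> b) \<otimes> d" using x cl by algebra
    also have "\<dots> = (a \<otimes> d) \<otimes> y" unfolding eq(1) using x cl by algebra
    also have "\<dots> = (c \<otimes> y) \<otimes> b" unfolding eq(2) using x cl by algebra
    finally show ?thesis using m_rcancel[of b "x \<otimes> d" "c \<otimes> y"] x cl by simp
  qed
  assume eq: "a \<otimes> d = c \<otimes> b"
  have "x \<otimes> b = a \<otimes> y \<longleftrightarrow> x \<otimes> d = c \<otimes> y" if "x \<in> carrier R" "y \<in> carrier R" for x y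
    using *[OF _ eq that assms(1-5)] *[OF _ eq[symmetric] that assms(4-6) assms(1,2)] by blast
  then show "frac a b = frac c d"
    unfolding frac_def by blast
qed

lemma fracI: "\<lbrakk>a \<in> carrier R; b \<in> carrier R; b \<noteq> \<zero>\<rbrakk> \<Longrightarrow> frac a b \<in> fractions"
  by (auto simp: fractions_def)

lemma fracE:
  assumes "X \<in> fractions"
  obtains a b where "a \<in> carrier R" "b \<in> carrier R" "b \<noteq> \<zero>" "X = frac a b"
  using assms by (auto simp: fractions_def)

definition frac_num :: "('a \<times> 'a) set \<Rightarrow> 'a" where "frac_num X = fst (SOME p. p \<in> X)"
definition frac_den :: "('a \<times> 'a) set \<Rightarrow> 'a" where "frac_den X = snd (SOME p. p \<in> X)"

lemma num_den_frac:
  assumes "a \<in> carrier R" "b \<in> carrier R" "b \<noteq> \<zero>"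
  shows "frac_num (frac a b) \<in> carrier R" "frac_den (frac a b) \<in> carrier R"
    "frac_den (frac a b) \<noteq> \<zero>" "frac_num (frac a b) \<otimes> b = a \<otimes> frac_den (frac a b)"
proof -
  have "(a, b) \<in> frac a b" using assms by (simp add: frac_def)
  then have "(SOME p. p \<in> frac a b) \<in> frac a b" by (rule someI)
  then have "(frac_num (frac a b), frac_den (frac a b)) \<in> frac a b"
    by (simp add: frac_num_def frac_den_def)
  then show "frac_num (frac a b) \<in> carrier R" "frac_den (frac a b) \<in> carrier R"
    "frac_den (frac a b) \<noteq> \<zero>" "frac_num (frac a b) \<otimes> b = a \<otimes> frac_den (frac a b)"
    by (auto simp: frac_def)
qed

text \<open>Only the \<open>R\<close>-module structure of the fraction field enters, hence the
  undefined \<open>mult\<close> and \<open>one\<close>. The operations use chosen representatives;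
  \<open>frac_add\<close> and \<open>frac_smult\<close> show that the choice does not
  matter.\<close>

definition frac_module :: "('a, ('a \<times> 'a) set) module" where
  "frac_module = \<lparr>carrier = fractions, mult = undefined, one = undefined, zero = frac \<zero> \<one>,
     add = (\<lambda>X Y. frac (frac_num X \<otimes> frac_den Y \<oplus> frac_num Y \<otimes> frac_den X) (frac_den X \<otimes> frac_den Y)),
     smult = (\<lambda>r X. frac (r \<otimes> frac_num X) (frac_den X))\<rparr>"

lemma frac_module_simps:
  "carrier frac_module = fractions" "\<zero>\<^bsub>frac_module\<^esub> = frac \<zero> \<one>"
  by (simp_all add: frac_module_def)

lemma m_nonzero: "\<lbrakk>a \<in> carrier R; b \<in> carrier R; a \<noteq> \<zero>; b \<noteq> \<zero>\<rbrakk> \<Longrightarrow> a \<otimes> b \<noteq> \<zero>"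
  using integral by blast

lemma frac_add:
  assumes "a \<in> carrier R" "b \<in> carrier R" "b \<noteq> \<zero>" "c \<in> carrier R" "d \<in> carrier R" "d \<noteq> \<zero>"
  shows "frac a b \<oplus>\<^bsub>frac_module\<^esub> frac c d = frac (a \<otimes> d \<oplus> c \<otimes> b) (b \<otimes> d)"
proof -
  obtain x y where x: "x = frac_num (frac a b)" "y = frac_den (frac a b)" by simp
  obtain z w where z: "z = frac_num (frac c d)" "w = frac_den (frac c d)" by simp
  note x' = num_den_frac[OF assms(1-3), folded x] and z' = num_den_frac[OF assms(4-6), folded z]
  have "(x \<otimes> w \<oplus> z \<otimes> y) \<otimes> (b \<otimes> d) = (x \<otimes> b) \<otimes> (w \<otimes> d) \<oplus> (z \<otimes> d) \<otimes> (y \<otimes> b)"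
    using x'(1,2) z'(1,2) assms by algebra
  also have "\<dots> = (a \<otimes> d \<oplus> c \<otimes> b) \<otimes> (y \<otimes> w)"
    unfolding x'(4) z'(4) using x'(1,2) z'(1,2) assms by algebra
  finally have "frac (x \<otimes> w \<oplus> z \<otimes> y) (y \<otimes> w) = frac (a \<otimes> d \<oplus> c \<otimes> b) (b \<otimes> d)"
    by (subst frac_eq_iff) (use x' z' assms m_nonzero in auto)
  then show ?thesis by (simp add: frac_module_def x z)
qed

lemma frac_smult:
  assumes "r \<in> carrier R" "a \<in> carrier R" "b \<in> carrier R" "b \<noteq> \<zero>"
  shows "r \<odot>\<^bsub>frac_module\<^esub> frac a b = frac (r \<otimes> a) b"
proof -
  obtain x y where x: "x = frac_num (frac a b)" "y = frac_den (frac a b)" by simp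
  note x' = num_den_frac[OF assms(2-4), folded x]
  have "(r \<otimes> x) \<otimes> b = r \<otimes> (x \<otimes> b)" using x'(1,2) assms by algebra
  also have "\<dots> = (r \<otimes> a) \<otimes> y" unfolding x'(4) using x'(1,2) assms by algebra
  finally have "frac (r \<otimes> x) y = frac (r \<otimes> a) b"
    by (subst frac_eq_iff) (use x' assms in auto)
  then show ?thesis by (simp add: frac_module_def x)
qed

lemma frac_zero: "\<lbrakk>a \<in> carrier R; b \<in> carrier R; b \<noteq> \<zero>\<rbrakk> \<Longrightarrow> frac a b = \<zero>\<^bsub>frac_module\<^esub> \<longleftrightarrow> a = \<zero>"
  by (auto simp: frac_module_simps frac_eq_iff)

lemma frac_module_abelian_group: "abelian_group frac_module"
proof (rule abelian_groupI)
  show "X \<oplus>\<^bsub>frac_module\<^esub> Y \<in> carrier frac_module"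
    if X: "X \<in> carrier frac_module" and Y: "Y \<in> carrier frac_module" for X Y
  proof -
    obtain a b where "a \<in> carrier R" "b \<in> carrier R" "b \<noteq> \<zero>" "X = frac a b"
      using X unfolding frac_module_simps by (rule fracE)
    moreover obtain c d where "c \<in> carrier R" "d \<in> carrier R" "d \<noteq> \<zero>" "Y = frac c d"
      using Y unfolding frac_module_simps by (rule fracE)
    ultimately show ?thesis by (auto simp: frac_add frac_module_simps intro!: fracI m_nonzero dest: m_nonzero)
  qed
  show "\<zero>\<^bsub>frac_module\<^esub> \<in> carrier frac_module"
    by (simp add: frac_module_simps fracI)
  show "X \<oplus>\<^bsub>frac_module\<^esub> Y \<oplus>\<^bsub>frac_module\<^esub> Z = X \<oplus>\<^bsub>frac_module\<^esub> (Y \<oplus>\<^bsub>frac_module\<^esub> Z)"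
    if X: "X \<in> carrier frac_module" and Y: "Y \<in> carrier frac_module" and Z: "Z \<in> carrier frac_module" for X Y Z
  proof -
    obtain a b where ab: "a \<in> carrier R" "b \<in> carrier R" "b \<noteq> \<zero>" "X = frac a b"
      using X unfolding frac_module_simps by (rule fracE)
    obtain c d where cd: "c \<in> carrier R" "d \<in> carrier R" "d \<noteq> \<zero>" "Y = frac c d"
      using Y unfolding frac_module_simps by (rule fracE)
    obtain e f where ef: "e \<in> carrier R" "f \<in> carrier R" "f \<noteq> \<zero>" "Z = frac e f"
      using Z unfolding frac_module_simps by (rule fracE)
    have "(a \<otimes> d \<oplus> c \<otimes> b) \<otimes> f \<oplus> e \<otimes> (b \<otimes> d) = a \<otimes> (d \<otimes> f) \<oplus> (c \<otimes> f \<oplus> e \<otimes> d) \<otimes> b"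
      "b \<otimes> d \<otimes> f = b \<otimes> (d \<otimes> f)"
      using ab(1,2) cd(1,2) ef(1,2) by algebra+
    then show ?thesis
      using ab cd ef m_nonzero by (simp add: frac_add)
  qed
  show "X \<oplus>\<^bsub>frac_module\<^esub> Y = Y \<oplus>\<^bsub>frac_module\<^esub> X"
    if X: "X \<in> carrier frac_module" and Y: "Y \<in> carrier frac_module" for X Y
  proof -
    obtain a b where "a \<in> carrier R" "b \<in> carrier R" "b \<noteq> \<zero>" "X = frac a b"
      using X unfolding frac_module_simps by (rule fracE)
    moreover obtain c d where "c \<in> carrier R" "d \<in> carrier R" "d \<noteq> \<zero>" "Y = frac c d"
      using Y unfolding frac_module_simps by (rule fracE)
    ultimately show ?thesis by (simp add: frac_add a_comm m_comm)
  qed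
  show "\<zero>\<^bsub>frac_module\<^esub> \<oplus>\<^bsub>frac_module\<^esub> X = X" if X: "X \<in> carrier frac_module" for X
  proof -
    obtain a b where "a \<in> carrier R" "b \<in> carrier R" "b \<noteq> \<zero>" "X = frac a b"
      using X unfolding frac_module_simps by (rule fracE)
    then show ?thesis by (simp add: frac_add frac_module_simps)
  qed
  show "\<exists>Y\<in>carrier frac_module. Y \<oplus>\<^bsub>frac_module\<^esub> X = \<zero>\<^bsub>frac_module\<^esub>"
    if X: "X \<in> carrier frac_module" for X
  proof -
    obtain a b where ab: "a \<in> carrier R" "b \<in> carrier R" "b \<noteq> \<zero>" "X = frac a b"
      using X unfolding frac_module_simps by (rule fracE)
    have "\<ominus> a \<otimes> b \<oplus> a \<otimes> b = \<zero>" using ab by algebra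
    then have "frac (\<ominus> a) b \<oplus>\<^bsub>frac_module\<^esub> X = \<zero>\<^bsub>frac_module\<^esub>"
      using ab by (simp add: frac_add frac_zero m_nonzero)
    then show ?thesis using ab by (auto simp: frac_module_simps intro!: bexI[of _ "frac (\<ominus> a) b"] fracI)
  qed
qed

lemma frac_module_module: "module R frac_module"
proof (rule moduleI[OF is_cring frac_module_abelian_group])
  show "r \<odot>\<^bsub>frac_module\<^esub> X \<in> carrier frac_module"
    if r: "r \<in> carrier R" and X: "X \<in> carrier frac_module" for r X
  proof -
    obtain a b where "a \<in> carrier R" "b \<in> carrier R" "b \<noteq> \<zero>" "X = frac a b"
      using X unfolding frac_module_simps by (rule fracE)
    then show ?thesis using r by (simp add: frac_smult frac_module_simps fracI)
  qed
  show "(r \<oplus> s) \<odot>\<^bsub>frac_module\<^esub> X = r \<odot>\<^bsub>frac_module\<^esub> X \<oplus>\<^bsub>frac_module\<^esub> s \<odot>\<^bsub>frac_module\<^esub> X"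
    if r: "r \<in> carrier R" "s \<in> carrier R" and X: "X \<in> carrier frac_module" for r s X
  proof -
    obtain a b where ab: "a \<in> carrier R" "b \<in> carrier R" "b \<noteq> \<zero>" "X = frac a b"
      using X unfolding frac_module_simps by (rule fracE)
    have "(r \<oplus> s) \<otimes> a \<otimes> (b \<otimes> b) = (r \<otimes> a \<otimes> b \<oplus> s \<otimes> a \<otimes> b) \<otimes> b" using r ab by algebra
    then show ?thesis using r ab by (simp add: frac_smult frac_add frac_eq_iff m_nonzero)
  qed
  show "r \<odot>\<^bsub>frac_module\<^esub> (X \<oplus>\<^bsub>frac_module\<^esub> Y) = r \<odot>\<^bsub>frac_module\<^esub> X \<oplus>\<^bsub>frac_module\<^esub> r \<odot>\<^bsub>frac_module\<^esub> Y"
    if r: "r \<in> carrier R" and X: "X \<in> carrier frac_module" and Y: "Y \<in> carrier frac_module" for r X Y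
  proof -
    obtain a b where ab: "a \<in> carrier R" "b \<in> carrier R" "b \<noteq> \<zero>" "X = frac a b"
      using X unfolding frac_module_simps by (rule fracE)
    obtain c d where cd: "c \<in> carrier R" "d \<in> carrier R" "d \<noteq> \<zero>" "Y = frac c d"
      using Y unfolding frac_module_simps by (rule fracE)
    have "r \<otimes> (a \<otimes> d \<oplus> c \<otimes> b) = r \<otimes> a \<otimes> d \<oplus> r \<otimes> c \<otimes> b" using r ab(1,2) cd(1,2) by algebra
    then show ?thesis using r ab cd by (simp add: frac_smult frac_add m_nonzero)
  qed
  show "(r \<otimes> s) \<odot>\<^bsub>frac_module\<^esub> X = r \<odot>\<^bsub>frac_module\<^esub> (s \<odot>\<^bsub>frac_module\<^esub> X)"
    if r: "r \<in> carrier R" "s \<in> carrier R" and X: "X \<in> carrier frac_module" for r s X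
  proof -
    obtain a b where "a \<in> carrier R" "b \<in> carrier R" "b \<noteq> \<zero>" "X = frac a b"
      using X unfolding frac_module_simps by (rule fracE)
    then show ?thesis using r by (simp add: frac_smult m_assoc)
  qed
  show "\<one> \<odot>\<^bsub>frac_module\<^esub> X = X" if X: "X \<in> carrier frac_module" for X
  proof -
    obtain a b where "a \<in> carrier R" "b \<in> carrier R" "b \<noteq> \<zero>" "X = frac a b"
      using X unfolding frac_module_simps by (rule fracE)
    then show ?thesis by (simp add: frac_smult)
  qed
qed

end

locale derivation_domain = derivation R \<delta> + domain R for R (structure) and \<delta>
begin

definition frac_deriv :: "('a \<times> 'a) set \<Rightarrow> ('a \<times> 'a) set" where
  "frac_deriv X = frac (\<delta> (frac_num X) \<otimes> frac_den X \<ominus> frac_num X \<otimes> \<delta> (frac_den X))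
     (frac_den X \<otimes> frac_den X)"

text \<open>The quotient rule is independent of the representative: differentiating
  \<open>x \<otimes> b = a \<otimes> y\<close> gives the identity \<open>d\<close>, and substituting
  it together with the original equation turns one numerator into the other.\<close>

lemma frac_deriv_frac:
  assumes "a \<in> carrier R" "b \<in> carrier R" "b \<noteq> \<zero>"
  shows "frac_deriv (frac a b) = frac (\<delta> a \<otimes> b \<ominus> a \<otimes> \<delta> b) (b \<otimes> b)"
proof -
  obtain x y where x: "x = frac_num (frac a b)" "y = frac_den (frac a b)" by simp
  note x' = num_den_frac[OF assms, folded x]
  have cl: "\<delta> x \<in> carrier R" "\<delta> y \<in> carrier R" "\<delta> a \<in> carrier R" "\<delta> b \<in> carrier R"
    using x' assms by (auto simp: deriv_closed)
  have d: "\<delta> x \<otimes> b \<oplus> x \<otimes> \<delta> b = \<delta> a \<otimes> y \<oplus> a \<otimes> \<delta> y"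
    using deriv_mult[of x b] deriv_mult[of a y] x' assms by simp
  have "(\<delta> x \<otimes> y \<ominus> x \<otimes> \<delta> y) \<otimes> (b \<otimes> b) =
      (\<delta> x \<otimes> b \<oplus> x \<otimes> \<delta> b) \<otimes> (y \<otimes> b) \<ominus> (x \<otimes> b) \<otimes> (y \<otimes> \<delta> b \<oplus> b \<otimes> \<delta> y)"
    using x'(1,2) assms(1,2) cl by algebra
  also have "\<dots> = (\<delta> a \<otimes> b \<ominus> a \<otimes> \<delta> b) \<otimes> (y \<otimes> y)"
    unfolding d x'(4) using x'(1,2) assms(1,2) cl by algebra
  finally have "frac (\<delta> x \<otimes> y \<ominus> x \<otimes> \<delta> y) (y \<otimes> y) = frac (\<delta> a \<otimes> b \<ominus> a \<otimes> \<delta> b) (b \<otimes> b)"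
    by (subst frac_eq_iff) (use x' assms cl m_nonzero in auto)
  then show ?thesis by (simp add: frac_deriv_def x)
qed

lemma frac_diff_module: "diff_module R \<delta> frac_module frac_deriv"
proof -
  have "diff_module_axioms R \<delta> frac_module frac_deriv"
  proof
    show "frac_deriv X \<in> carrier frac_module" if X: "X \<in> carrier frac_module" for X
    proof -
      obtain a b where "a \<in> carrier R" "b \<in> carrier R" "b \<noteq> \<zero>" "X = frac a b"
        using X unfolding frac_module_simps by (rule fracE)
      then show ?thesis
        by (simp add: frac_deriv_frac frac_module_simps fracI m_nonzero deriv_closed)
    qed
    show "frac_deriv (X \<oplus>\<^bsub>frac_module\<^esub> Y) = frac_deriv X \<oplus>\<^bsub>frac_module\<^esub> frac_deriv Y"
      if X: "X \<in> carrier frac_module" and Y: "Y \<in> carrier frac_module" for X Y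
    proof -
      obtain a b where ab: "a \<in> carrier R" "b \<in> carrier R" "b \<noteq> \<zero>" "X = frac a b"
        using X unfolding frac_module_simps by (rule fracE)
      obtain c d where cd: "c \<in> carrier R" "d \<in> carrier R" "d \<noteq> \<zero>" "Y = frac c d"
        using Y unfolding frac_module_simps by (rule fracE)
      have cl: "\<delta> a \<in> carrier R" "\<delta> b \<in> carrier R" "\<delta> c \<in> carrier R" "\<delta> d \<in> carrier R"
        using ab cd by (auto simp: deriv_closed)
      have "((\<delta> a \<otimes> d \<oplus> a \<otimes> \<delta> d \<oplus> (\<delta> c \<otimes> b \<oplus> c \<otimes> \<delta> b)) \<otimes> (b \<otimes> d) \<ominus>
            (a \<otimes> d \<oplus> c \<otimes> b) \<otimes> (\<delta> b \<otimes> d \<oplus> b \<otimes> \<delta> d)) \<otimes> (b \<otimes> b \<otimes> (d \<otimes> d)) =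
          ((\<delta> a \<otimes> b \<ominus> a \<otimes> \<delta> b) \<otimes> (d \<otimes> d) \<oplus> (\<delta> c \<otimes> d \<ominus> c \<otimes> \<delta> d) \<otimes> (b \<otimes> b)) \<otimes> (b \<otimes> d \<otimes> (b \<otimes> d))"
        using ab(1,2) cd(1,2) cl by algebra
      then show ?thesis
        using ab cd cl
        by (simp add: frac_add frac_deriv_frac frac_eq_iff m_nonzero deriv_add deriv_mult)
    qed
    show "frac_deriv (r \<odot>\<^bsub>frac_module\<^esub> X) =
        r \<odot>\<^bsub>frac_module\<^esub> frac_deriv X \<oplus>\<^bsub>frac_module\<^esub> \<delta> r \<odot>\<^bsub>frac_module\<^esub> X"
      if r: "r \<in> carrier R" and X: "X \<in> carrier frac_module" for r X
    proof -
      obtain a b where ab: "a \<in> carrier R" "b \<in> carrier R" "b \<noteq> \<zero>" "X = frac a b"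
        using X unfolding frac_module_simps by (rule fracE)
      have cl: "\<delta> a \<in> carrier R" "\<delta> b \<in> carrier R" "\<delta> r \<in> carrier R"
        using ab r by (auto simp: deriv_closed)
      have "((\<delta> r \<otimes> a \<oplus> r \<otimes> \<delta> a) \<otimes> b \<ominus> r \<otimes> a \<otimes> \<delta> b) \<otimes> (b \<otimes> b \<otimes> b) =
          (r \<otimes> (\<delta> a \<otimes> b \<ominus> a \<otimes> \<delta> b) \<otimes> b \<oplus> \<delta> r \<otimes> a \<otimes> (b \<otimes> b)) \<otimes> (b \<otimes> b)"
        using ab(1,2) r cl by algebra
      then show ?thesis
        using ab r cl by (simp add: frac_smult frac_add frac_deriv_frac frac_eq_iff m_nonzero deriv_mult)
    qed
  qed
  then show "diff_module R \<delta> frac_module frac_deriv"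
    by (intro diff_module.intro derivation_axioms frac_module_module)
qed

end

section \<open>Left ideals and leading coefficients\<close>

text \<open>The common setting to which both alternatives of the theorem are reduced.\<close>

locale simple_derivation = derivation_domain R \<delta> for R (structure) and \<delta> +
  assumes delta_simple: "delta_simple R \<delta>" and acc: "acc_ideals R"
begin

interpretation UP: UP_cring R "UP R"
  by unfold_locales auto

abbreviation cf :: "(nat \<Rightarrow> 'a) \<Rightarrow> nat \<Rightarrow> 'a" where "cf \<equiv> coeff (UP R)"

lemma delta_ideal_eq_carrier:
  assumes "ideal I R" "\<And>a. a \<in> I \<Longrightarrow> \<delta> a \<in> I" "a \<in> I" "a \<noteq> \<zero>"
  shows "\<one> \<in> I"
proof -
  have "I = {\<zero>} \<or> I = carrier R"
    using delta_simple assms(1,2) by (auto simp: delta_simple_def delta_ideal_def)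
  then show ?thesis using assms(3,4) by auto
qed

text \<open>Left ideals of the differential operator ring, described without its multiplication:
  \<open>T\<close> is left multiplication by \<theta>, and scalars together with \<theta> generate
  the ring.\<close>

definition left_ideal :: "(nat \<Rightarrow> 'a) set \<Rightarrow> bool" where
  "left_ideal L \<longleftrightarrow> L \<subseteq> carrier (UP R) \<and> \<zero>\<^bsub>UP R\<^esub> \<in> L \<and> (\<forall>p\<in>L. \<forall>q\<in>L. p \<oplus>\<^bsub>UP R\<^esub> q \<in> L) \<and>
     (\<forall>a\<in>carrier R. \<forall>p\<in>L. a \<odot>\<^bsub>UP R\<^esub> p \<in> L) \<and> (\<forall>p\<in>L. T p \<in> L)"

lemma left_idealD:
  assumes "left_ideal L"
  shows "p \<in> L \<Longrightarrow> p \<in> carrier (UP R)" "\<zero>\<^bsub>UP R\<^esub> \<in> L" "p \<in> L \<Longrightarrow> q \<in> L \<Longrightarrow> p \<oplus>\<^bsub>UP R\<^esub> q \<in> L"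
    "a \<in> carrier R \<Longrightarrow> p \<in> L \<Longrightarrow> a \<odot>\<^bsub>UP R\<^esub> p \<in> L" "p \<in> L \<Longrightarrow> T p \<in> L" "p \<in> L \<Longrightarrow> (T ^^ k) p \<in> L"
proof -
  show T: "T p \<in> L" if "p \<in> L" for p using assms that by (simp add: left_ideal_def)
  show "p \<in> L \<Longrightarrow> (T ^^ k) p \<in> L" by (induction k) (auto intro: T)
qed (use assms in \<open>auto simp: left_ideal_def\<close>)

text \<open>A strict bound separates zero from the nonzero constants, both of which have
  \<open>deg\<close> zero, and lets degree inductions start at the zero element.\<close>

definition deg_less :: "(nat \<Rightarrow> 'a) \<Rightarrow> nat \<Rightarrow> bool" where
  "deg_less p n \<longleftrightarrow> (\<forall>i\<ge>n. cf p i = \<zero>)"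

lemma deg_less_mono: "deg_less p n \<Longrightarrow> n \<le> m \<Longrightarrow> deg_less p m"
  by (auto simp: deg_less_def)

lemma deg_less_Suc_deg: "p \<in> carrier (UP R) \<Longrightarrow> deg_less p (Suc (deg R p))"
  by (auto simp: deg_less_def intro: UP.deg_aboveD)

lemma deg_less_0: "p \<in> carrier (UP R) \<Longrightarrow> deg_less p 0 \<Longrightarrow> p = \<zero>\<^bsub>UP R\<^esub>"
  by (rule UP.up_eqI) (auto simp: deg_less_def)

text \<open>Multiplication by \<theta> shifts the leading coefficient up unchanged, since \<delta>
  contributes only to lower degrees.\<close>

lemma deg_less_theta_pow:
  assumes "p \<in> carrier (UP R)" "deg_less p (Suc n)"
  shows "deg_less ((T ^^ k) p) (Suc (n + k)) \<and> cf ((T ^^ k) p) (n + k) = cf p n"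
proof (induction k)
  case (Suc k)
  then show ?case
    using assms(1) by (auto simp: deg_less_def coeff_theta theta_pow_closed deriv_zero)
qed (use assms in simp)

lemma nonzero_lead:
  assumes "p \<in> carrier (UP R)" "p \<noteq> \<zero>\<^bsub>UP R\<^esub>"
  obtains n where "deg_less p (Suc n)" "cf p n \<noteq> \<zero>"
  using deg_less_Suc_deg[OF assms(1)] UP.lcoeff_nonzero[OF assms(2,1)] by blast

text \<open>In degree \<open>n + m\<close> only the summand with \<open>i = m\<close> survives, and
  it contributes the product of the leading coefficients, nonzero in a domain.\<close>

lemma diff_op_ring_no_zero_divisors:
  assumes p: "p \<in> carrier (UP R)" "p \<noteq> \<zero>\<^bsub>UP R\<^esub>" and q: "q \<in> carrier (UP R)" "q \<noteq> \<zero>\<^bsub>UP R\<^esub>"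
  shows "p \<otimes>\<^bsub>diff_op_ring R \<delta>\<^esub> q \<noteq> \<zero>\<^bsub>UP R\<^esub>"
proof -
  obtain m where m: "deg_less p (Suc m)" "cf p m \<noteq> \<zero>" using nonzero_lead[OF p] .
  obtain n where n: "deg_less q (Suc n)" "cf q n \<noteq> \<zero>" using nonzero_lead[OF q] .
  have cl: "(T ^^ i) q \<in> carrier (UP R)" "cf p i \<in> carrier R" for i
    using p q by (auto simp: theta_pow_closed)
  have "cf (p \<otimes>\<^bsub>diff_op_ring R \<delta>\<^esub> q) (n + m) =
      cf (\<Oplus>\<^bsub>UP R\<^esub>i\<in>{..m}. cf p i \<odot>\<^bsub>UP R\<^esub> (T ^^ i) q) (n + m)"
    using m(1) by (subst diff_mult_eq[OF p(1) q(1), of m]) (auto simp: deg_less_def)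
  also have "\<dots> = (\<Oplus>i\<in>{..m}. cf (cf p i \<odot>\<^bsub>UP R\<^esub> (T ^^ i) q) (n + m))"
    by (rule UP.coeff_finsum) (use cl in auto)
  also have "\<dots> = (\<Oplus>i\<in>{..m}. if m = i then cf p m \<otimes> cf q n else \<zero>)"
  proof (rule finsum_cong')
    fix i assume i: "i \<in> {..m}"
    show "cf (cf p i \<odot>\<^bsub>UP R\<^esub> (T ^^ i) q) (n + m) = (if m = i then cf p m \<otimes> cf q n else \<zero>)"
      using deg_less_theta_pow[OF q(1) n(1), of i] i cl by (auto simp: deg_less_def)
  qed (use p q in auto)
  also have "\<dots> = cf p m \<otimes> cf q n"
    using p q by (subst add.finprod_singleton) auto
  finally have "cf (p \<otimes>\<^bsub>diff_op_ring R \<delta>\<^esub> q) (n + m) \<noteq> \<zero>"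
    using m(2) n(2) p(1) q(1) integral_iff by simp
  then show ?thesis by auto
qed

text \<open>Pseudo-division by \<open>f\<close>, whose degree \<open>n\<close> is minimal in \<open>I\<close>.\<close>

lemma scale_into_left_ideal:
  assumes L: "left_ideal L" and I: "left_ideal I"
    and f: "f \<in> L" "deg_less f (Suc n)"
    and min: "\<And>p. p \<in> I \<Longrightarrow> deg_less p n \<Longrightarrow> p = \<zero>\<^bsub>UP R\<^esub>" and "L \<subseteq> I"
    and p: "p \<in> I" "deg_less p m"
  shows "(cf f n [^] m) \<odot>\<^bsub>UP R\<^esub> p \<in> L"
  using p
proof (induction m arbitrary: p)
  case 0
  then show ?case using deg_less_0 left_idealD(1)[OF I] left_idealD(2)[OF L] by auto
next
  case (Suc m)
  have f_closed: "f \<in> carrier (UP R)" and p_closed: "p \<in> carrier (UP R)"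
    using f Suc.prems left_idealD(1)[OF L] left_idealD(1)[OF I] by auto
  let ?a = "cf f n" and ?b = "cf p m" and ?g = "(T ^^ (m - n)) f"
  have cl: "?a \<in> carrier R" "?b \<in> carrier R" "?a [^] m \<in> carrier R" "?g \<in> carrier (UP R)"
    using f_closed p_closed by (auto simp: theta_pow_closed)
  show ?case
  proof (cases "m < n")
    case True
    then have "p = \<zero>\<^bsub>UP R\<^esub>" using min Suc.prems deg_less_mono by simp
    then show ?thesis using left_idealD(2)[OF L] cl by simp
  next
    case False
    \<comment> \<open>\<open>?g\<close> has degree \<open>m\<close> with the leading coefficient
      \<open>?a\<close> of \<open>f\<close>, and coefficients in \<open>R\<close> commute, so the
      terms of degree \<open>m\<close> cancel. One factor \<open>?a\<close> is spent for each degree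
      removed.\<close>
    define q where "q = ?a \<odot>\<^bsub>UP R\<^esub> p \<oplus>\<^bsub>UP R\<^esub> (\<ominus> ?b) \<odot>\<^bsub>UP R\<^esub> ?g"
    have g: "?g \<in> L" by (rule left_idealD(6)[OF L f(1)])
    then have "?g \<in> I" using \<open>L \<subseteq> I\<close> by blast
    then have "q \<in> I"
      unfolding q_def by (rule left_idealD(3)[OF I left_idealD(4)[OF I cl(1) Suc.prems(1)]
            left_idealD(4)[OF I a_inv_closed[OF cl(2)]]])
    have g_deg: "deg_less ?g (Suc m)" "cf ?g m = ?a"
      using deg_less_theta_pow[OF f_closed f(2), of "m - n"] False by auto
    have "deg_less q m" unfolding deg_less_def
    proof (intro allI impI)
      fix i assume "m \<le> i"
      then consider "i = m" | "Suc m \<le> i" by linarith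
      then show "cf q i = \<zero>"
      proof cases
        case 1
        have "cf q i = ?a \<otimes> ?b \<oplus> \<ominus> ?b \<otimes> ?a" using p_closed cl g_deg 1 by (simp add: q_def)
        also have "\<dots> = \<zero>" using cl(1,2) by algebra
        finally show ?thesis .
      qed (use g_deg(1) Suc.prems(2) p_closed cl in \<open>auto simp: q_def deg_less_def\<close>)
    qed
    with Suc.IH \<open>q \<in> I\<close> have "(?a [^] m) \<odot>\<^bsub>UP R\<^esub> q \<in> L" by blast
    then have "(?a [^] m) \<odot>\<^bsub>UP R\<^esub> q \<oplus>\<^bsub>UP R\<^esub> (?a [^] m \<otimes> ?b) \<odot>\<^bsub>UP R\<^esub> ?g \<in> L"
      by (rule left_idealD(3)[OF L _ left_idealD(4)[OF L m_closed[OF cl(3,2)] g]])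
    moreover have "(?a [^] m) \<odot>\<^bsub>UP R\<^esub> q \<oplus>\<^bsub>UP R\<^esub> (?a [^] m \<otimes> ?b) \<odot>\<^bsub>UP R\<^esub> ?g = (?a [^] Suc m) \<odot>\<^bsub>UP R\<^esub> p"
    proof (rule UP.up_eqI)
      fix i
      have "cf p i \<in> carrier R" "cf ?g i \<in> carrier R" using p_closed cl by auto
      with cl have "?a [^] m \<otimes> (?a \<otimes> cf p i \<oplus> \<ominus> ?b \<otimes> cf ?g i) \<oplus> ?a [^] m \<otimes> ?b \<otimes> cf ?g i =
          ?a [^] m \<otimes> ?a \<otimes> cf p i"
        by algebra
      then show "cf ((?a [^] m) \<odot>\<^bsub>UP R\<^esub> q \<oplus>\<^bsub>UP R\<^esub> (?a [^] m \<otimes> ?b) \<odot>\<^bsub>UP R\<^esub> ?g) i = cf ((?a [^] Suc m) \<odot>\<^bsub>UP R\<^esub> p) i"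
        using p_closed cl by (simp add: q_def)
    qed (use p_closed cl in \<open>auto simp: q_def\<close>)
    ultimately show ?thesis by simp
  qed
qed

text \<open>The coefficient \<open>cf p n\<close> may vanish, so lower degree elements contribute
  zero and the set is an ideal.\<close>

definition lead_coeffs :: "(nat \<Rightarrow> 'a) set \<Rightarrow> nat \<Rightarrow> 'a set" where
  "lead_coeffs L n = {cf p n | p. p \<in> L \<and> deg_less p (Suc n)}"

definition lead_ideal :: "(nat \<Rightarrow> 'a) set \<Rightarrow> 'a set" where
  "lead_ideal L = (\<Union>n. lead_coeffs L n)"

lemma lead_coeffs_ideal:
  assumes L: "left_ideal L"
  shows "ideal (lead_coeffs L n) R"
  unfolding ideal_iff
proof (intro conjI ballI)
  show "lead_coeffs L n \<subseteq> carrier R"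
    using left_idealD(1)[OF L] by (auto simp: lead_coeffs_def)
  show "\<zero> \<in> lead_coeffs L n"
    unfolding lead_coeffs_def using left_idealD(2)[OF L]
    by (auto simp: deg_less_def intro!: exI[of _ "\<zero>\<^bsub>UP R\<^esub>"])
next
  fix a b assume "a \<in> lead_coeffs L n" "b \<in> lead_coeffs L n"
  then obtain p q where pq: "p \<in> L" "deg_less p (Suc n)" "q \<in> L" "deg_less q (Suc n)"
    "a = cf p n" "b = cf q n" by (auto simp: lead_coeffs_def)
  then have "p \<in> carrier (UP R)" "q \<in> carrier (UP R)" using left_idealD(1)[OF L] by auto
  then show "a \<oplus> b \<in> lead_coeffs L n"
    unfolding lead_coeffs_def using pq left_idealD(3)[OF L pq(1,3)]
    by (auto simp: deg_less_def intro!: exI[of _ "p \<oplus>\<^bsub>UP R\<^esub> q"])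
next
  fix a r assume "a \<in> lead_coeffs L n" and r: "r \<in> carrier R"
  then obtain p where p: "p \<in> L" "deg_less p (Suc n)" "a = cf p n" by (auto simp: lead_coeffs_def)
  then have "p \<in> carrier (UP R)" using left_idealD(1)[OF L] by auto
  then show "r \<otimes> a \<in> lead_coeffs L n"
    unfolding lead_coeffs_def using p r left_idealD(4)[OF L r p(1)]
    by (auto simp: deg_less_def intro!: exI[of _ "r \<odot>\<^bsub>UP R\<^esub> p"])
qed

lemma lead_coeffs_mono:
  assumes L: "left_ideal L" and "n \<le> m"
  shows "lead_coeffs L n \<subseteq> lead_coeffs L m"
proof
  fix a assume "a \<in> lead_coeffs L n"
  then obtain p where p: "p \<in> L" "deg_less p (Suc n)" "a = cf p n" by (auto simp: lead_coeffs_def)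
  then have "p \<in> carrier (UP R)" using left_idealD(1)[OF L] by auto
  then have "deg_less ((T ^^ (m - n)) p) (Suc m) \<and> cf ((T ^^ (m - n)) p) m = a"
    using deg_less_theta_pow[of p n "m - n"] p \<open>n \<le> m\<close> by simp
  then show "a \<in> lead_coeffs L m"
    unfolding lead_coeffs_def using left_idealD(6)[OF L p(1)] by blast
qed

text \<open>Multiplication by \<theta> makes the ideals \<open>lead_coeffs L n\<close> ascend with
  \<open>n\<close>. By the chain condition every leading coefficient of \<open>L\<close> therefore
  occurs in each sufficiently large degree.\<close>

lemma lead_ideal_eq_lead_coeffs:
  assumes L: "left_ideal L"
  shows "\<exists>n. \<forall>m\<ge>n. lead_coeffs L m = lead_ideal L"
proof -
  have mono: "lead_coeffs L n \<subseteq> lead_coeffs L m" if "n \<le> m" for n m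
    by (rule lead_coeffs_mono[OF L that])
  have "(\<forall>i. ideal (lead_coeffs L i) R) \<and> (\<forall>i. lead_coeffs L i \<subseteq> lead_coeffs L (Suc i))"
    using lead_coeffs_ideal[OF L] mono by simp
  then obtain n where n: "\<forall>m\<ge>n. lead_coeffs L m = lead_coeffs L n"
    using acc unfolding acc_ideals_def by blast
  have "lead_coeffs L m \<subseteq> lead_coeffs L n" for m
  proof -
    have "lead_coeffs L m \<subseteq> lead_coeffs L (max m n)" by (rule mono) simp
    also have "\<dots> = lead_coeffs L n" using n max.cobounded2 by blast
    finally show ?thesis .
  qed
  then have "lead_ideal L = lead_coeffs L n" unfolding lead_ideal_def by blast
  with n show ?thesis by blast
qed

lemma lead_ideal_ideal:
  assumes L: "left_ideal L"
  shows "ideal (lead_ideal L) R"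
proof -
  obtain n where "lead_coeffs L n = lead_ideal L"
    using lead_ideal_eq_lead_coeffs[OF L] by blast
  with lead_coeffs_ideal[OF L, of n] show ?thesis by simp
qed

text \<open>The elements of \<open>R\<close> that multiply \<open>I\<close> into \<open>L\<close> form a \<open>\<delta>\<close>-ideal.\<close>

lemma left_ideal_eqI:
  assumes L: "left_ideal L" and I: "left_ideal I" and "L \<subseteq> I"
    and f: "f \<in> L" "deg_less f (Suc n)" "cf f n \<noteq> \<zero>"
    and min: "\<And>p. p \<in> I \<Longrightarrow> deg_less p n \<Longrightarrow> p = \<zero>\<^bsub>UP R\<^esub>"
    and lead: "lead_ideal I \<subseteq> lead_ideal L"
  shows "I = L"
proof -
  obtain N where N: "\<And>m. N \<le> m \<Longrightarrow> lead_coeffs L m = lead_ideal L"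
    using lead_ideal_eq_lead_coeffs[OF L] by blast
  let ?a = "cf f n"
  have f_closed: "f \<in> carrier (UP R)" using f left_idealD(1)[OF L] by blast
  then have a: "?a [^] k \<in> carrier R" for k :: nat by simp
  \<comment> \<open>The exponent must not depend on \<open>p\<close>. Up to degree \<open>N\<close>,
    pseudo-division costs at most \<open>N\<close> factors. Above it, the leading coefficient of
    \<open>p\<close> already occurs in \<open>L\<close> in the same degree, so an element of
    \<open>L\<close> can be subtracted without any scaling.\<close>
  have scale: "(?a [^] N) \<odot>\<^bsub>UP R\<^esub> p \<in> L" if "p \<in> I" "deg_less p m" for p m
    using that
  proof (induction m arbitrary: p)
    case 0
    then show ?case
      using scale_into_left_ideal[OF L I f(1,2) min \<open>L \<subseteq> I\<close>] deg_less_mono by blast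
  next
    case (Suc m)
    show ?case
    proof (cases "Suc m \<le> N")
      case True
      then show ?thesis
        using scale_into_left_ideal[OF L I f(1,2) min \<open>L \<subseteq> I\<close>] Suc.prems deg_less_mono by blast
    next
      case False
      have p_closed: "p \<in> carrier (UP R)" using Suc.prems left_idealD(1)[OF I] by blast
      have "cf p m \<in> lead_ideal I"
        using Suc.prems by (auto simp: lead_ideal_def lead_coeffs_def)
      then have "cf p m \<in> lead_coeffs L m" using lead N[of m] False by auto
      then obtain q where q: "q \<in> L" "deg_less q (Suc m)" "cf q m = cf p m"
        by (auto simp: lead_coeffs_def)
      have q_closed: "q \<in> carrier (UP R)" using q left_idealD(1)[OF L] by blast
      define d where "d = p \<oplus>\<^bsub>UP R\<^esub> (\<ominus> \<one>) \<odot>\<^bsub>UP R\<^esub> q"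
      have "q \<in> I" using q(1) \<open>L \<subseteq> I\<close> by blast
      then have "d \<in> I"
        unfolding d_def by (rule left_idealD(3)[OF I Suc.prems(1)
              left_idealD(4)[OF I a_inv_closed[OF one_closed]]])
      moreover have "deg_less d m" unfolding deg_less_def
      proof (intro allI impI)
        fix i assume "m \<le> i"
        then consider "i = m" | "Suc m \<le> i" by linarith
        then show "cf d i = \<zero>"
          by cases (use p_closed q_closed q(2,3) Suc.prems(2) in
            \<open>auto simp: d_def deg_less_def l_minus r_neg\<close>)
      qed
      ultimately have "(?a [^] N) \<odot>\<^bsub>UP R\<^esub> d \<in> L" by (rule Suc.IH)
      then have "(?a [^] N) \<odot>\<^bsub>UP R\<^esub> d \<oplus>\<^bsub>UP R\<^esub> (?a [^] N) \<odot>\<^bsub>UP R\<^esub> q \<in> L"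
        by (rule left_idealD(3)[OF L _ left_idealD(4)[OF L a q(1)]])
      moreover have "(?a [^] N) \<odot>\<^bsub>UP R\<^esub> d \<oplus>\<^bsub>UP R\<^esub> (?a [^] N) \<odot>\<^bsub>UP R\<^esub> q = (?a [^] N) \<odot>\<^bsub>UP R\<^esub> p"
      proof (rule UP.up_eqI)
        fix i
        have "cf p i \<in> carrier R" "cf q i \<in> carrier R" "?a [^] N \<in> carrier R"
          using p_closed q_closed a by auto
        then have "?a [^] N \<otimes> (cf p i \<oplus> \<ominus> \<one> \<otimes> cf q i) \<oplus> ?a [^] N \<otimes> cf q i = ?a [^] N \<otimes> cf p i"
          by algebra
        then show "cf ((?a [^] N) \<odot>\<^bsub>UP R\<^esub> d \<oplus>\<^bsub>UP R\<^esub> (?a [^] N) \<odot>\<^bsub>UP R\<^esub> q) i = cf ((?a [^] N) \<odot>\<^bsub>UP R\<^esub> p) i"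
          using p_closed q_closed a by (simp add: d_def)
      qed (use p_closed q_closed a in \<open>auto simp: d_def\<close>)
      ultimately show ?thesis by simp
    qed
  qed
  define C where "C = {r \<in> carrier R. \<forall>p\<in>I. r \<odot>\<^bsub>UP R\<^esub> p \<in> L}"
  have "ideal C R"
    unfolding ideal_iff C_def using left_idealD(2-4)[OF L] left_idealD(1)[OF I]
    by (auto simp: UP.smult_l_distr UP.smult_assoc1)
  moreover have "\<delta> r \<in> C" if r: "r \<in> C" for r
  proof -
    have rR: "r \<in> carrier R" using r by (simp add: C_def)
    have "\<delta> r \<odot>\<^bsub>UP R\<^esub> p \<in> L" if p: "p \<in> I" for p
    proof -
      have pc: "p \<in> carrier (UP R)" using p left_idealD(1)[OF I] by blast
      have "T p \<in> I" using left_idealD(5)[OF I p] .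
      \<comment> \<open>This is the commutator identity
        \<open>\<theta> r - r \<theta> = \<delta> r\<close> applied to \<open>p\<close>: both
        products on the left lie in \<open>L\<close>, because \<open>p\<close> and
        \<open>T p\<close> lie in \<open>I\<close>.\<close>
      then have "T (r \<odot>\<^bsub>UP R\<^esub> p) \<oplus>\<^bsub>UP R\<^esub> (\<ominus> \<one>) \<odot>\<^bsub>UP R\<^esub> (r \<odot>\<^bsub>UP R\<^esub> T p) \<in> L"
        using r p by (intro left_idealD(3)[OF L] left_idealD(5)[OF L]
            left_idealD(4)[OF L a_inv_closed[OF one_closed]]) (auto simp: C_def)
      moreover have "T (r \<odot>\<^bsub>UP R\<^esub> p) \<oplus>\<^bsub>UP R\<^esub> (\<ominus> \<one>) \<odot>\<^bsub>UP R\<^esub> (r \<odot>\<^bsub>UP R\<^esub> T p) = \<delta> r \<odot>\<^bsub>UP R\<^esub> p"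
      proof (rule UP.up_eqI)
        fix i
        have "cf p i \<in> carrier R" "cf (T p) i \<in> carrier R" "r \<in> carrier R" "\<delta> r \<in> carrier R"
          using rR pc by (auto simp: deriv_closed theta_closed)
        then have "r \<otimes> cf (T p) i \<oplus> \<delta> r \<otimes> cf p i \<oplus> \<ominus> \<one> \<otimes> (r \<otimes> cf (T p) i) = \<delta> r \<otimes> cf p i"
          by algebra
        then show "cf (T (r \<odot>\<^bsub>UP R\<^esub> p) \<oplus>\<^bsub>UP R\<^esub> (\<ominus> \<one>) \<odot>\<^bsub>UP R\<^esub> (r \<odot>\<^bsub>UP R\<^esub> T p)) i = cf (\<delta> r \<odot>\<^bsub>UP R\<^esub> p) i"
          using rR pc by (simp add: theta_smult deriv_closed theta_closed)
      qed (use rR pc in \<open>auto simp: deriv_closed theta_closed\<close>)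
      ultimately show ?thesis by simp
    qed
    then show ?thesis using rR by (simp add: C_def deriv_closed)
  qed
  moreover have "?a [^] N \<in> C"
    using scale left_idealD(1)[OF I] deg_less_Suc_deg a by (auto simp: C_def)
  moreover have "?a [^] N \<noteq> \<zero>"
  proof (induction N)
    case (Suc N)
    then show ?case using f(3) f_closed a integral_iff by simp
  qed simp
  ultimately have "\<one> \<in> C" using delta_ideal_eq_carrier by blast
  then have "I \<subseteq> L" using left_idealD(1)[OF I] by (auto simp: C_def)
  with \<open>L \<subseteq> I\<close> show ?thesis by blast
qed

end

section \<open>Descending chains of left ideals and Artinian cyclic modules\<close>

lemma bounded_incseq_stabilises:
  fixes f :: "nat \<Rightarrow> nat"
  assumes "\<And>i. f i \<le> f (Suc i)" "\<And>i. f i \<le> b"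
  shows "\<exists>n. \<forall>m\<ge>n. f m = f n"
proof -
  have "finite (range f)" by (rule finite_subset[of _ "{..b}"]) (use assms(2) in auto)
  then have "Max (range f) \<in> range f" by (rule Max_in) simp
  then obtain n where n: "f n = Max (range f)" by auto
  have "f m = f n" if "m \<ge> n" for m
  proof (rule antisym)
    show "f m \<le> f n" unfolding n by (rule Max_ge[OF \<open>finite (range f)\<close>]) simp
    show "f n \<le> f m" by (rule lift_Suc_mono_le[of f]) (use assms(1) that in auto)
  qed
  then show ?thesis by blast
qed

context simple_derivation
begin

interpretation UP: UP_cring R "UP R"
  by unfold_locales auto

interpretation S: ring "diff_op_ring R \<delta>"
  by (rule diff_op_ring_is_ring)

lemma left_ideal_chain_stabilises:
  assumes max: "\<And>P. primeideal P R \<Longrightarrow> P \<noteq> {\<zero>} \<Longrightarrow> maximalideal P R"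
    and L: "\<And>i::nat. left_ideal (L i)" "\<And>i. L (Suc i) \<subseteq> L i"
    and f: "\<And>i. f \<in> L i" "f \<noteq> \<zero>\<^bsub>UP R\<^esub>"
  shows "\<exists>n. \<forall>m\<ge>n. L m = L n"
proof -
  have mono: "L j \<subseteq> L i" if "i \<le> j" for i j
    by (rule lift_Suc_antimono_le[of L]) (use L(2) that in auto)
  have f_closed: "f \<in> carrier (UP R)" using left_idealD(1)[OF L(1) f(1)] .
  obtain b where b: "deg_less f (Suc b)" "cf f b \<noteq> \<zero>" using nonzero_lead[OF f_closed f(2)] .
  define Q where "Q i n \<longleftrightarrow> (\<exists>p\<in>L i. deg_less p (Suc n) \<and> cf p n \<noteq> \<zero>)" for i n
  \<comment> \<open>The least degree of a nonzero element of \<open>L i\<close>. It can only grow as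
    the left ideals shrink, and the common element \<open>f\<close> caps it at
    \<open>b\<close>.\<close>
  define d where "d i = (LEAST n. Q i n)" for i
  have Qb: "Q i b" for i using b f(1) by (auto simp: Q_def)
  have Qd: "Q i (d i)" for i unfolding d_def using Qb by (rule LeastI)
  have d_le: "d i \<le> b" for i unfolding d_def using Qb by (rule Least_le)
  have d_Suc: "d i \<le> d (Suc i)" for i
    unfolding d_def[of i] by (rule Least_le) (use Qd[of "Suc i"] L(2) in \<open>auto simp: Q_def\<close>)
  obtain n1 where n1: "\<And>m. m \<ge> n1 \<Longrightarrow> d m = d n1"
    using bounded_incseq_stabilises[of d b] d_Suc d_le by blast
  define A where "A = PIdl (cf f b)"
  have fb: "cf f b \<in> carrier R" using f_closed by simp
  have fb_lead: "cf f b \<in> lead_ideal (L i)" for i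
    using b f(1) by (auto simp: lead_ideal_def lead_coeffs_def)
  have "\<exists>n. \<forall>m\<ge>n. lead_ideal (L m) = lead_ideal (L n)"
  proof (rule dcc_ideals_above[OF acc max])
    show "ideal A R" unfolding A_def by (rule cgenideal_ideal[OF fb])
    show "A \<noteq> {\<zero>}" unfolding A_def using cgenideal_self[OF fb] b(2) by auto
    show "ideal (lead_ideal (L i)) R" for i by (rule lead_ideal_ideal[OF L(1)])
    show "lead_ideal (L (Suc i)) \<subseteq> lead_ideal (L i)" for i
      using L(2)[of i] by (auto simp: lead_ideal_def lead_coeffs_def)
    show "A \<subseteq> lead_ideal (L i)" for i
      unfolding A_def by (rule cgenideal_minimal[OF lead_ideal_ideal[OF L(1)] fb_lead])
  qed
  then obtain n2 where n2: "\<forall>m\<ge>n2. lead_ideal (L m) = lead_ideal (L n2)" by blast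
  define n where "n = max n1 n2"
  have "L n = L m" if "m \<ge> n" for m
  proof -
    obtain g where g: "g \<in> L m" "deg_less g (Suc (d m))" "cf g (d m) \<noteq> \<zero>"
      using Qd[of m] by (auto simp: Q_def)
    have dm: "d m = d n" using n1[of m] n1[of n] that by (simp add: n_def)
    have "lead_ideal (L n) = lead_ideal (L n2)" "lead_ideal (L m) = lead_ideal (L n2)"
      using n2[rule_format, of n] n2[rule_format, of m] that by (simp_all add: n_def)
    then have lead: "lead_ideal (L n) \<subseteq> lead_ideal (L m)" by simp
    show ?thesis
    proof (rule left_ideal_eqI[OF L(1) L(1) mono[OF that] g _ lead])
      fix p assume p: "p \<in> L n" "deg_less p (d m)"
      show "p = \<zero>\<^bsub>UP R\<^esub>"
      proof (rule ccontr)
        assume "p \<noteq> \<zero>\<^bsub>UP R\<^esub>"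
        then obtain k where k: "deg_less p (Suc k)" "cf p k \<noteq> \<zero>"
          using nonzero_lead left_idealD(1)[OF L(1) p(1)] by blast
        have "k < d n"
          using k(2) p(2) dm by (metis deg_less_def not_le)
        moreover have "d n \<le> k" unfolding d_def by (rule Least_le) (use k p in \<open>auto simp: Q_def\<close>)
        ultimately show False by simp
      qed
    qed
  qed
  then show ?thesis by blast
qed

lemma theta_eq_mult: "q \<in> carrier (UP R) \<Longrightarrow> T q = monom (UP R) \<one> 1 \<otimes>\<^bsub>diff_op_ring R \<delta>\<^esub> q"
  using diff_monom_one_mult[of q 1] by simp

text \<open>If some nonzero \<open>f\<close> kills the generator \<open>g\<close>, submodules
  correspond to left ideals containing \<open>f\<close>, whose descending chains stabilise.
  Otherwise \<open>s \<mapsto> s g\<close> is injective, the module is a copy of a domain, and a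
  simple submodule must be everything.\<close>

theorem cyclic_essential_artinian:
  fixes M :: "(nat \<Rightarrow> 'a, 'e, 'n) module_scheme"
  assumes max: "\<And>P. primeideal P R \<Longrightarrow> P \<noteq> {\<zero>} \<Longrightarrow> maximalideal P R"
    and cyc: "cyclic_module (diff_op_ring R \<delta>) M"
    and ess: "essential_ext_of_simple (diff_op_ring R \<delta>) M"
  shows "artinian_module (diff_op_ring R \<delta>) M"
proof -
  let ?S = "diff_op_ring R \<delta>"
  interpret M: left_module ?S M using cyc by (simp add: cyclic_module_def)
  obtain g where g: "g \<in> carrier M" and gen: "carrier M = (\<lambda>s. s \<odot>\<^bsub>M\<^esub> g) ` carrier ?S"
    using cyc by (auto simp: cyclic_module_def)
  show ?thesis
    unfolding artinian_module_def
  proof (intro conjI M.left_module_axioms allI impI)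
    fix F :: "nat \<Rightarrow> 'e set"
    assume "(\<forall>i. submodule (F i) ?S M) \<and> (\<forall>i. F (Suc i) \<subseteq> F i)"
    then have F: "\<And>i. submodule (F i) ?S M" "\<And>i. F (Suc i) \<subseteq> F i" by auto
    have mono: "F j \<subseteq> F i" if "i \<le> j" for i j
      by (rule lift_Suc_antimono_le[of F]) (use F(2) that in auto)
    note F' = F(1)[unfolded M.submodule_iff]
    show "\<exists>n. \<forall>m\<ge>n. F m = F n"
    proof (cases "\<exists>s\<in>carrier ?S. s \<noteq> \<zero>\<^bsub>?S\<^esub> \<and> s \<odot>\<^bsub>M\<^esub> g = \<zero>\<^bsub>M\<^esub>")
      case True
      then obtain f where f: "f \<in> carrier (UP R)" "f \<noteq> \<zero>\<^bsub>UP R\<^esub>" "f \<odot>\<^bsub>M\<^esub> g = \<zero>\<^bsub>M\<^esub>" by auto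
      \<comment> \<open>The preimage of \<open>F i\<close> under \<open>s \<mapsto> s g\<close>. It
        contains \<open>f\<close> because \<open>f g\<close> is zero, and \<open>F i\<close> is
        recovered from it as its image.\<close>
      define L where "L i = {s \<in> carrier (UP R). s \<odot>\<^bsub>M\<^esub> g \<in> F i}" for i
      have L: "left_ideal (L i)" for i
        unfolding left_ideal_def
      proof (intro conjI ballI)
        show "L i \<subseteq> carrier (UP R)" by (auto simp: L_def)
        show "\<zero>\<^bsub>UP R\<^esub> \<in> L i"
          using M.smult_zero_left[OF g] F'[of i] by (simp add: L_def)
      next
        fix p q assume "p \<in> L i" "q \<in> L i"
        then show "p \<oplus>\<^bsub>UP R\<^esub> q \<in> L i"
          using M.smult_l_distr[of p q g] g F'[of i] by (simp add: L_def)
      next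
        fix a p assume a: "a \<in> carrier R" and p: "p \<in> L i"
        have "(monom (UP R) a 0 \<otimes>\<^bsub>?S\<^esub> p) \<odot>\<^bsub>M\<^esub> g \<in> F i"
          using M.smult_assoc[of "monom (UP R) a 0" p g] a p g F'[of i] by (simp add: L_def)
        then show "a \<odot>\<^bsub>UP R\<^esub> p \<in> L i" using a p by (simp add: L_def diff_op_ring_smult)
      next
        fix p assume p: "p \<in> L i"
        have "(monom (UP R) \<one> 1 \<otimes>\<^bsub>?S\<^esub> p) \<odot>\<^bsub>M\<^esub> g \<in> F i"
          using M.smult_assoc[of "monom (UP R) \<one> 1" p g] p g F'[of i] by (simp add: L_def)
        then show "T p \<in> L i" using p theta_closed[of p] theta_eq_mult[of p] by (simp add: L_def)
      qed
      have "\<exists>n. \<forall>m\<ge>n. L m = L n"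
      proof (rule left_ideal_chain_stabilises[OF max L _ _ f(2)])
        show "L (Suc i) \<subseteq> L i" for i using F(2)[of i] by (auto simp: L_def)
        show "f \<in> L i" for i using f F'[of i] by (simp add: L_def)
      qed
      then obtain n where n: "\<forall>m\<ge>n. L m = L n" ..
      have eq: "F i = (\<lambda>s. s \<odot>\<^bsub>M\<^esub> g) ` L i" for i
        using F'[of i] gen by (auto simp: L_def)
      have "F m = F n" if "m \<ge> n" for m
        unfolding eq n[rule_format, OF that] ..
      then show ?thesis by blast
    next
      case False
      then have faithful: "s = \<zero>\<^bsub>UP R\<^esub>" if "s \<in> carrier (UP R)" "s \<odot>\<^bsub>M\<^esub> g = \<zero>\<^bsub>M\<^esub>" for s
        using that by auto
      obtain N where N: "submodule N ?S M" "simple_module ?S (M\<lparr>carrier := N\<rparr>)"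
        using ess by (auto simp: essential_ext_of_simple_def essential_submodule_def)
      note N' = N(1)[unfolded M.submodule_iff]
      have Ns: "N \<noteq> {\<zero>\<^bsub>M\<^esub>}" "\<And>L. submodule L ?S M \<Longrightarrow> L \<subseteq> N \<Longrightarrow> L = {\<zero>\<^bsub>M\<^esub>} \<or> L = N"
        using N by (auto simp: M.simple_restrict_iff)
      obtain y where y: "y \<in> N" "y \<noteq> \<zero>\<^bsub>M\<^esub>" using Ns(1) N' by blast
      then obtain x where x: "x \<in> carrier (UP R)" "y = x \<odot>\<^bsub>M\<^esub> g" using N' gen by auto
      have "x \<noteq> \<zero>\<^bsub>UP R\<^esub>" using y(2) x M.smult_zero_left[OF g] by auto
      then have xx: "x \<otimes>\<^bsub>?S\<^esub> x \<noteq> \<zero>\<^bsub>UP R\<^esub>" "x \<otimes>\<^bsub>?S\<^esub> x \<in> carrier (UP R)"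
        using diff_op_ring_no_zero_divisors x(1) S.m_closed[of x x] by auto
      \<comment> \<open>Applying \<open>x\<close> to \<open>y = x g\<close> again stays in
        \<open>N\<close> and gives a nonzero element, since \<open>x x\<close> is nonzero and acts
        faithfully on \<open>g\<close>. By simplicity \<open>y = s z = s x y\<close>, hence
        \<open>(1 - s x) x g = 0\<close>. Faithfulness and the absence of zero divisors yield
        \<open>s x = 1\<close>, which puts \<open>g = s y\<close> into \<open>N\<close>.\<close>
      define z where "z = x \<odot>\<^bsub>M\<^esub> y"
      have z: "z \<in> N" "z \<in> carrier M" "z = (x \<otimes>\<^bsub>?S\<^esub> x) \<odot>\<^bsub>M\<^esub> g"
        using x y N' g M.smult_assoc[of x x g] by (auto simp: z_def)
      define Z where "Z = (\<lambda>s. s \<odot>\<^bsub>M\<^esub> z) ` carrier ?S"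
      have "submodule Z ?S M" "z \<in> Z"
        unfolding Z_def by (rule M.cyclic_submodule[OF z(2)])+
      moreover have "Z \<subseteq> N"
        unfolding Z_def by (rule M.cyclic_submodule_minimal[OF N(1) z(1)])
      moreover have "z \<noteq> \<zero>\<^bsub>M\<^esub>" using z(3) xx faithful by auto
      ultimately have "Z = N" using Ns(2)[of Z] by blast
      then obtain s where s: "s \<in> carrier (UP R)" "y = s \<odot>\<^bsub>M\<^esub> z" using y(1) by (auto simp: Z_def)
      define e where "e = \<one>\<^bsub>?S\<^esub> \<ominus>\<^bsub>?S\<^esub> s \<otimes>\<^bsub>?S\<^esub> x"
      have sx: "s \<otimes>\<^bsub>?S\<^esub> x \<in> carrier ?S" using s x S.m_closed[of s x] by simp
      then have e: "e \<in> carrier ?S" unfolding e_def by (intro S.minus_closed S.one_closed)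
      have "y = (s \<otimes>\<^bsub>?S\<^esub> x) \<odot>\<^bsub>M\<^esub> y"
        using s x y N' M.smult_assoc[of s x y] by (auto simp: z_def)
      have e_y: "e \<odot>\<^bsub>M\<^esub> y = \<zero>\<^bsub>M\<^esub>"
      proof -
        have y_closed: "y \<in> carrier M" using y N' by blast
        have "e \<oplus>\<^bsub>?S\<^esub> s \<otimes>\<^bsub>?S\<^esub> x = \<one>\<^bsub>?S\<^esub>"
          unfolding e_def a_minus_def using sx by (simp only: S.a_assoc S.l_neg S.r_zero S.one_closed S.a_inv_closed)
        then have "e \<odot>\<^bsub>M\<^esub> y \<oplus>\<^bsub>M\<^esub> (s \<otimes>\<^bsub>?S\<^esub> x) \<odot>\<^bsub>M\<^esub> y = y"
          using M.smult_l_distr[OF e sx y_closed] M.smult_one[OF y_closed] by simp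
        then have "e \<odot>\<^bsub>M\<^esub> y \<oplus>\<^bsub>M\<^esub> y = y" using \<open>y = (s \<otimes>\<^bsub>?S\<^esub> x) \<odot>\<^bsub>M\<^esub> y\<close> by simp
        then show ?thesis
          using M.add.l_cancel_one[of y "e \<odot>\<^bsub>M\<^esub> y"] y_closed e by simp
      qed
      then have "(e \<otimes>\<^bsub>?S\<^esub> x) \<odot>\<^bsub>M\<^esub> g = \<zero>\<^bsub>M\<^esub>"
        using M.smult_assoc[of e x g] e x g by simp
      then have "e \<otimes>\<^bsub>?S\<^esub> x = \<zero>\<^bsub>UP R\<^esub>" using faithful e x S.m_closed[of e x] by simp
      then have "e = \<zero>\<^bsub>UP R\<^esub>"
        using diff_op_ring_no_zero_divisors[of e x] e x \<open>x \<noteq> \<zero>\<^bsub>UP R\<^esub>\<close> by auto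
      then have "\<one>\<^bsub>?S\<^esub> = s \<otimes>\<^bsub>?S\<^esub> x"
        unfolding e_def using sx S.r_right_minus_eq[of "\<one>\<^bsub>?S\<^esub>" "s \<otimes>\<^bsub>?S\<^esub> x"] S.one_closed by simp
      then have "g = (s \<otimes>\<^bsub>?S\<^esub> x) \<odot>\<^bsub>M\<^esub> g" using M.smult_one[OF g] by simp
      also have "\<dots> = s \<odot>\<^bsub>M\<^esub> y" using M.smult_assoc[of s x g] s x g by simp
      finally have "g \<in> N" using N' s y by simp
      then have "carrier M \<subseteq> N" unfolding gen using N' by auto
      then have triv: "F i = {\<zero>\<^bsub>M\<^esub>} \<or> F i = N" for i
        by (intro Ns(2)[OF F(1)]) (use F'[of i] in auto)
      show ?thesis
      proof (cases "\<exists>n. F n = {\<zero>\<^bsub>M\<^esub>}")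
        case True
        then obtain n where n: "F n = {\<zero>\<^bsub>M\<^esub>}" ..
        have "F m = F n" if "m \<ge> n" for m
          using mono[OF that] F'[of m] n by auto
        then show ?thesis by blast
      next
        case False
        then have "F m = N" for m using triv[of m] by auto
        then show ?thesis by simp
      qed
    qed
  qed
qed

end

section \<open>A strictly descending chain\<close>

text \<open>In the application \<open>Q\<close> is the fraction field, \<open>A\<close> is the localisation of \<open>R\<close> at \<open>P\<close>, and
  \<open>v\<close> is a fraction with \<open>P v \<subseteq> A\<close>.\<close>

locale localised_generator = simple_derivation R \<delta> + diff_module R \<delta> Q D
  for R (structure) and \<delta> and Q and D +
  fixes P A v c
  assumes P: "primeideal P R"
    and A_sub: "A \<subseteq> carrier Q" and A_zero: "\<zero>\<^bsub>Q\<^esub> \<in> A"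
    and A_add: "\<lbrakk>x \<in> A; y \<in> A\<rbrakk> \<Longrightarrow> x \<oplus>\<^bsub>Q\<^esub> y \<in> A"
    and A_smult: "\<lbrakk>a \<in> carrier R; x \<in> A\<rbrakk> \<Longrightarrow> a \<odot>\<^bsub>Q\<^esub> x \<in> A"
    and A_D: "x \<in> A \<Longrightarrow> D x \<in> A"
    and A_saturated: "\<lbrakk>s \<in> carrier R; s \<notin> P; x \<in> carrier Q; s \<odot>\<^bsub>Q\<^esub> x \<in> A\<rbrakk> \<Longrightarrow> x \<in> A"
    and v: "v \<in> carrier Q" and v_A: "r \<in> carrier R \<Longrightarrow> r \<odot>\<^bsub>Q\<^esub> v \<in> A \<longleftrightarrow> r \<in> P"
    and c: "c \<in> P" "c \<noteq> \<zero>"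
begin

lemmas R_add_closed = cring.cring_simprules(1)[OF is_cring]
  and R_neg_closed = cring.cring_simprules(3)[OF is_cring]

lemma P_ideal: "ideal P R"
  using P by (simp add: primeideal_def)

lemma P_carrier: "r \<in> P \<Longrightarrow> r \<in> carrier R"
  using P_ideal by (auto simp: ideal_iff)

lemma not_P_mult: "\<lbrakk>r \<in> carrier R; s \<in> carrier R; r \<notin> P; s \<notin> P\<rbrakk> \<Longrightarrow> r \<otimes> s \<notin> P"
  using primeideal.I_prime[OF P] by blast

lemma one_not_P: "\<one> \<notin> P"
  using primeideal.I_notcarr[OF P] ideal.one_imp_carrier[OF P_ideal] by blast

text \<open>\<open>G J n\<close> is \<open>A + (\<Sum>i<n. D\<^sup>i (J v))\<close>.\<close>

primrec G :: "'a set \<Rightarrow> nat \<Rightarrow> 'c set" where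
  "G J 0 = A"
| "G J (Suc n) = {(D ^^ n) (j \<odot>\<^bsub>Q\<^esub> v) \<oplus>\<^bsub>Q\<^esub> g | j g. j \<in> J \<and> g \<in> G J n}"

lemma G_SucI: "\<lbrakk>j \<in> J; g \<in> G J n\<rbrakk> \<Longrightarrow> (D ^^ n) (j \<odot>\<^bsub>Q\<^esub> v) \<oplus>\<^bsub>Q\<^esub> g \<in> G J (Suc n)"
  by auto

lemma G_SucE:
  assumes "x \<in> G J (Suc n)"
  obtains j g where "j \<in> J" "g \<in> G J n" "x = (D ^^ n) (j \<odot>\<^bsub>Q\<^esub> v) \<oplus>\<^bsub>Q\<^esub> g"
  using assms by auto

lemma G_mono_ideal: "I \<subseteq> J \<Longrightarrow> G I n \<subseteq> G J n"
  by (induction n) auto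

declare G.simps(2) [simp del]

context
  fixes J
  assumes J: "ideal J R"
begin

lemma J_D: "j \<in> J \<Longrightarrow> j \<in> carrier R" "\<zero> \<in> J" "j \<in> J \<Longrightarrow> k \<in> J \<Longrightarrow> j \<oplus> k \<in> J"
  "r \<in> carrier R \<Longrightarrow> j \<in> J \<Longrightarrow> r \<otimes> j \<in> J"
  using J by (auto simp: ideal_iff)

lemma term_closed: "j \<in> J \<Longrightarrow> (D ^^ n) (j \<odot>\<^bsub>Q\<^esub> v) \<in> carrier Q"
  using J_D(1) v by auto

lemma D_pow_zero: "(D ^^ n) \<zero>\<^bsub>Q\<^esub> = \<zero>\<^bsub>Q\<^esub>"
  by (induction n) (simp_all add: D_zero)

lemma G_carrier: "x \<in> G J n \<Longrightarrow> x \<in> carrier Q"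
proof (induction n arbitrary: x)
  case (Suc n)
  from Suc.prems show ?case by (rule G_SucE) (use Suc.IH term_closed in auto)
qed (use A_sub in auto)

lemma G_Suc: "x \<in> G J n \<Longrightarrow> x \<in> G J (Suc n)"
  using G_SucI[OF J_D(2), of x n] G_carrier[of x n] v by (simp add: smult_l_null D_pow_zero)

lemma G_mono: "x \<in> G J n \<Longrightarrow> n \<le> m \<Longrightarrow> x \<in> G J m"
  by (induction m) (auto simp: le_Suc_eq G_Suc)

lemma G_zero: "\<zero>\<^bsub>Q\<^esub> \<in> G J n"
  by (rule G_mono[of _ 0]) (simp_all add: A_zero)

lemma G_add: "\<lbrakk>x \<in> G J n; y \<in> G J n\<rbrakk> \<Longrightarrow> x \<oplus>\<^bsub>Q\<^esub> y \<in> G J n"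
proof (induction n arbitrary: x y)
  case (Suc n)
  obtain j g where x: "j \<in> J" "g \<in> G J n" "x = (D ^^ n) (j \<odot>\<^bsub>Q\<^esub> v) \<oplus>\<^bsub>Q\<^esub> g"
    by (rule G_SucE[OF Suc.prems(1)])
  obtain k h where y: "k \<in> J" "h \<in> G J n" "y = (D ^^ n) (k \<odot>\<^bsub>Q\<^esub> v) \<oplus>\<^bsub>Q\<^esub> h"
    by (rule G_SucE[OF Suc.prems(2)])
  have "(D ^^ n) ((j \<oplus> k) \<odot>\<^bsub>Q\<^esub> v) = (D ^^ n) (j \<odot>\<^bsub>Q\<^esub> v) \<oplus>\<^bsub>Q\<^esub> (D ^^ n) (k \<odot>\<^bsub>Q\<^esub> v)"
    using x y v J_D(1) by (simp add: smult_l_distr D_pow_add)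
  then have "x \<oplus>\<^bsub>Q\<^esub> y = (D ^^ n) ((j \<oplus> k) \<odot>\<^bsub>Q\<^esub> v) \<oplus>\<^bsub>Q\<^esub> (g \<oplus>\<^bsub>Q\<^esub> h)"
    unfolding x y using term_closed[OF x(1)] term_closed[OF y(1)] G_carrier[OF x(2)] G_carrier[OF y(2)]
    by (simp add: M.a_ac)
  then show ?case using G_SucI[OF J_D(3)[OF x(1) y(1)] Suc.IH[OF x(2) y(2)]] by simp
qed (simp add: A_add)

lemma G_D: "x \<in> G J n \<Longrightarrow> D x \<in> G J (Suc n)"
proof (induction n arbitrary: x)
  case 0
  then show ?case using G_Suc[of _ 0] by (simp add: A_D)
next
  case (Suc n)
  obtain j g where x: "j \<in> J" "g \<in> G J n" "x = (D ^^ n) (j \<odot>\<^bsub>Q\<^esub> v) \<oplus>\<^bsub>Q\<^esub> g"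
    by (rule G_SucE[OF Suc.prems(1)])
  have "D x = (D ^^ Suc n) (j \<odot>\<^bsub>Q\<^esub> v) \<oplus>\<^bsub>Q\<^esub> D g"
    unfolding x(3) using term_closed[OF x(1)] G_carrier[OF x(2)] by (simp add: D_add)
  then show ?case using G_SucI[OF x(1) Suc.IH[OF x(2)]] by simp
qed

text \<open>Stability under \<open>D\<close> is built into \<open>G\<close>, so scalars are the
  issue: moving \<open>a\<close> past \<open>D^n\<close> leaves a remainder of lower order. The two
  claims need a joint induction. Closure at \<open>Suc n\<close> uses commutation at
  \<open>n\<close>, and commutation at \<open>Suc n\<close> uses closure at \<open>Suc n\<close> for
  the term with \<open>\<delta> a\<close>.\<close>

lemma G_smult_commute:
  "(\<forall>a\<in>carrier R. \<forall>x\<in>G J n. a \<odot>\<^bsub>Q\<^esub> x \<in> G J n) \<and>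
   (\<forall>a\<in>carrier R. \<forall>j\<in>J. \<exists>g\<in>G J n. a \<odot>\<^bsub>Q\<^esub> (D ^^ n) (j \<odot>\<^bsub>Q\<^esub> v) = (D ^^ n) ((a \<otimes> j) \<odot>\<^bsub>Q\<^esub> v) \<oplus>\<^bsub>Q\<^esub> g)"
proof (induction n)
  case 0
  have "\<exists>g\<in>A. a \<odot>\<^bsub>Q\<^esub> (j \<odot>\<^bsub>Q\<^esub> v) = (a \<otimes> j) \<odot>\<^bsub>Q\<^esub> v \<oplus>\<^bsub>Q\<^esub> g" if "a \<in> carrier R" "j \<in> J" for a j
    using that A_zero J_D(1) v by (intro bexI[of _ "\<zero>\<^bsub>Q\<^esub>"]) (auto simp: smult_assoc1)
  then show ?case by (simp add: A_smult)
next
  case (Suc n)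
  have closed: "a \<odot>\<^bsub>Q\<^esub> x \<in> G J (Suc n)" if a: "a \<in> carrier R" and x: "x \<in> G J (Suc n)" for a x
  proof -
    obtain j g where jg: "j \<in> J" "g \<in> G J n" "x = (D ^^ n) (j \<odot>\<^bsub>Q\<^esub> v) \<oplus>\<^bsub>Q\<^esub> g"
      by (rule G_SucE[OF x])
    obtain h where h: "h \<in> G J n" "a \<odot>\<^bsub>Q\<^esub> (D ^^ n) (j \<odot>\<^bsub>Q\<^esub> v) = (D ^^ n) ((a \<otimes> j) \<odot>\<^bsub>Q\<^esub> v) \<oplus>\<^bsub>Q\<^esub> h"
      using Suc a jg(1) by blast
    have ag: "a \<odot>\<^bsub>Q\<^esub> g \<in> G J n" using Suc a jg(2) by blast
    have "a \<odot>\<^bsub>Q\<^esub> x = (D ^^ n) ((a \<otimes> j) \<odot>\<^bsub>Q\<^esub> v) \<oplus>\<^bsub>Q\<^esub> (h \<oplus>\<^bsub>Q\<^esub> a \<odot>\<^bsub>Q\<^esub> g)"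
      unfolding jg(3) using a h term_closed jg J_D(4) G_carrier
      by (simp add: smult_r_distr M.a_assoc)
    then show ?thesis using G_SucI[OF J_D(4)[OF a jg(1)] G_add[OF h(1) ag]] by simp
  qed
  have "\<exists>g\<in>G J (Suc n). a \<odot>\<^bsub>Q\<^esub> (D ^^ Suc n) (j \<odot>\<^bsub>Q\<^esub> v) = (D ^^ Suc n) ((a \<otimes> j) \<odot>\<^bsub>Q\<^esub> v) \<oplus>\<^bsub>Q\<^esub> g"
    if a: "a \<in> carrier R" and j: "j \<in> J" for a j
  proof -
    define y where "y = (D ^^ n) (j \<odot>\<^bsub>Q\<^esub> v)"
    define z where "z = (D ^^ n) ((a \<otimes> j) \<odot>\<^bsub>Q\<^esub> v)"
    have y: "y \<in> carrier Q" "y \<in> G J (Suc n)" and z: "z \<in> carrier Q"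
      using term_closed j J_D(4)[OF a j] G_SucI[OF j G_zero[of n]] by (auto simp: y_def z_def)
    obtain h where h: "h \<in> G J n" "a \<odot>\<^bsub>Q\<^esub> y = z \<oplus>\<^bsub>Q\<^esub> h"
      using Suc a j unfolding y_def z_def by blast
    have hc: "h \<in> carrier Q" using h(1) by (rule G_carrier)
    \<comment> \<open>From \<open>a y = z + h\<close> the Leibniz rule gives
      \<open>a (D y) = D z + D h - (\<delta> a) y\<close>; \<open>w\<close> collects the terms of
      lower order.\<close>
    define w where "w = D h \<oplus>\<^bsub>Q\<^esub> (\<ominus> \<delta> a) \<odot>\<^bsub>Q\<^esub> y"
    have "w \<in> G J (Suc n)"
      unfolding w_def by (intro G_add G_D[OF h(1)] closed y(2) R_neg_closed deriv_closed a)
    moreover have "a \<odot>\<^bsub>Q\<^esub> D y = D z \<oplus>\<^bsub>Q\<^esub> w"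
    proof -
      have da: "\<delta> a \<in> carrier R" using a by (rule deriv_closed)
      have "a \<odot>\<^bsub>Q\<^esub> D y \<oplus>\<^bsub>Q\<^esub> \<delta> a \<odot>\<^bsub>Q\<^esub> y = D z \<oplus>\<^bsub>Q\<^esub> D h"
        using D_smult[OF a y(1)] D_add[OF z hc] h(2) by simp
      then have "a \<odot>\<^bsub>Q\<^esub> D y \<oplus>\<^bsub>Q\<^esub> \<delta> a \<odot>\<^bsub>Q\<^esub> y \<oplus>\<^bsub>Q\<^esub> (\<ominus> \<delta> a) \<odot>\<^bsub>Q\<^esub> y = D z \<oplus>\<^bsub>Q\<^esub> w"
        using z hc y da by (simp add: w_def M.a_assoc)
      then show ?thesis
        using a da y(1) by (simp add: M.a_assoc smult_l_minus M.r_neg)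
    qed
    ultimately show ?thesis by (auto simp: y_def z_def)
  qed
  with closed show ?case by blast
qed

lemma G_smult: "\<lbrakk>a \<in> carrier R; x \<in> G J n\<rbrakk> \<Longrightarrow> a \<odot>\<^bsub>Q\<^esub> x \<in> G J n"
  using G_smult_commute by blast

lemma G_commute:
  assumes "a \<in> carrier R" "j \<in> J"
  obtains g where "g \<in> G J n" "a \<odot>\<^bsub>Q\<^esub> (D ^^ n) (j \<odot>\<^bsub>Q\<^esub> v) = (D ^^ n) ((a \<otimes> j) \<odot>\<^bsub>Q\<^esub> v) \<oplus>\<^bsub>Q\<^esub> g"
  using G_smult_commute assms by blast

lemma G_diff:
  assumes "x \<oplus>\<^bsub>Q\<^esub> y \<in> G J n" "y \<in> G J n" "x \<in> carrier Q"
  shows "x \<in> G J n"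
proof -
  have y: "y \<in> carrier Q" using assms(2) by (rule G_carrier)
  have "x \<oplus>\<^bsub>Q\<^esub> y \<oplus>\<^bsub>Q\<^esub> (\<ominus> \<one>) \<odot>\<^bsub>Q\<^esub> y \<in> G J n"
    by (intro G_add assms G_smult R_neg_closed one_closed)
  then show ?thesis using assms(3) y by (simp add: smult_l_minus M.a_assoc M.r_neg)
qed

lemma G_union_submodule: "submodule (\<Union>n. G J n) (diff_op_ring R \<delta>) diff_op_module"
  unfolding diff_op_submodule_iff
proof (intro conjI ballI)
  fix x y assume "x \<in> (\<Union>n. G J n)" "y \<in> (\<Union>n. G J n)"
  then obtain m n where "x \<in> G J m" "y \<in> G J n" by blast
  then have "x \<oplus>\<^bsub>Q\<^esub> y \<in> G J (max m n)" by (intro G_add) (auto elim: G_mono)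
  then show "x \<oplus>\<^bsub>Q\<^esub> y \<in> (\<Union>n. G J n)" by blast
next
  show "(\<Union>n. G J n) \<subseteq> carrier Q" using G_carrier by auto
  show "\<zero>\<^bsub>Q\<^esub> \<in> (\<Union>n. G J n)" using G_zero[of 0] by (rule UN_I[OF UNIV_I])
  fix x assume "x \<in> (\<Union>n. G J n)"
  then obtain n where n: "x \<in> G J n" by blast
  show "D x \<in> (\<Union>n. G J n)" using G_D[OF n] by (rule UN_I[OF UNIV_I])
  fix a assume "a \<in> carrier R"
  then show "a \<odot>\<^bsub>Q\<^esub> x \<in> (\<Union>n. G J n)" using G_smult[OF _ n] by (intro UN_I[OF UNIV_I])
qed

end

text \<open>Since \<open>c \<in> P\<close>, \<open>c\<close> carries \<open>R v\<close> into
  \<open>A\<close>. If \<open>e\<close> carries \<open>y\<close> into \<open>A\<close>, then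
  \<open>e \<otimes> e\<close> does so for \<open>D y\<close>, because \<open>e D (e y)\<close>
  differs from \<open>(e \<otimes> e) D y\<close> by an element of \<open>A\<close>. The single
  multiplier so obtained later supplies the nonzero element of a \<delta>-ideal.\<close>

lemma G_bounded_denominator:
  shows "\<exists>e\<in>carrier R. e \<noteq> \<zero> \<and> (\<forall>x\<in>G (carrier R) n. e \<odot>\<^bsub>Q\<^esub> x \<in> A)"
proof -
  have "\<exists>e\<in>carrier R. e \<noteq> \<zero> \<and> (\<forall>j\<in>carrier R. e \<odot>\<^bsub>Q\<^esub> (D ^^ n) (j \<odot>\<^bsub>Q\<^esub> v) \<in> A)" for n
  proof (induction n)
    case 0
    have "c \<odot>\<^bsub>Q\<^esub> (j \<odot>\<^bsub>Q\<^esub> v) \<in> A" if "j \<in> carrier R" for j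
    proof -
      have "c \<odot>\<^bsub>Q\<^esub> (j \<odot>\<^bsub>Q\<^esub> v) = j \<odot>\<^bsub>Q\<^esub> (c \<odot>\<^bsub>Q\<^esub> v)"
        using that P_carrier[OF c(1)] v by (simp add: smult_assoc1[symmetric] m_comm)
      then show ?thesis using A_smult[OF that] v_A P_carrier c(1) by simp
    qed
    then show ?case using c P_carrier by (intro bexI[of _ c]) auto
  next
    case (Suc n)
    then obtain e where e: "e \<in> carrier R" "e \<noteq> \<zero>"
      and eA: "\<And>j. j \<in> carrier R \<Longrightarrow> e \<odot>\<^bsub>Q\<^esub> (D ^^ n) (j \<odot>\<^bsub>Q\<^esub> v) \<in> A" by blast
    have "(e \<otimes> e) \<odot>\<^bsub>Q\<^esub> D y \<in> A" if y: "y \<in> carrier Q" "e \<odot>\<^bsub>Q\<^esub> y \<in> A" for y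
    proof -
      have de: "\<delta> e \<in> carrier R" using e(1) by (rule deriv_closed)
      have "e \<odot>\<^bsub>Q\<^esub> D (e \<odot>\<^bsub>Q\<^esub> y) \<oplus>\<^bsub>Q\<^esub> (\<ominus> \<delta> e) \<odot>\<^bsub>Q\<^esub> (e \<odot>\<^bsub>Q\<^esub> y) \<in> A"
        by (intro A_add A_smult A_D y(2) e(1) R_neg_closed de)
      moreover have "e \<odot>\<^bsub>Q\<^esub> D (e \<odot>\<^bsub>Q\<^esub> y) = (e \<otimes> e) \<odot>\<^bsub>Q\<^esub> D y \<oplus>\<^bsub>Q\<^esub> (\<delta> e \<otimes> e) \<odot>\<^bsub>Q\<^esub> y"
        using e(1) de y(1) by (simp add: D_smult smult_r_distr smult_assoc1[symmetric] m_comm)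
      moreover have "(\<ominus> \<delta> e) \<odot>\<^bsub>Q\<^esub> (e \<odot>\<^bsub>Q\<^esub> y) = \<ominus>\<^bsub>Q\<^esub> ((\<delta> e \<otimes> e) \<odot>\<^bsub>Q\<^esub> y)"
        using e(1) de y(1) by (simp add: smult_l_minus smult_assoc1)
      ultimately show ?thesis using e(1) de y(1) by (simp add: M.a_assoc M.r_neg)
    qed
    then have "(e \<otimes> e) \<odot>\<^bsub>Q\<^esub> (D ^^ Suc n) (j \<odot>\<^bsub>Q\<^esub> v) \<in> A" if "j \<in> carrier R" for j
      using eA[OF that] that v by simp
    moreover have "e \<otimes> e \<noteq> \<zero>" using e integral by blast
    ultimately show ?case using e(1) by blast
  qed
  note terms = this
  show ?thesis
  proof (induction n)
    case 0
    then show ?case by (intro bexI[of _ \<one>]) (auto simp: A_smult)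
  next
    case (Suc n)
    then obtain e where e: "e \<in> carrier R" "e \<noteq> \<zero>" "\<And>x. x \<in> G (carrier R) n \<Longrightarrow> e \<odot>\<^bsub>Q\<^esub> x \<in> A"
      by blast
    obtain e' where e': "e' \<in> carrier R" "e' \<noteq> \<zero>"
      "\<And>j. j \<in> carrier R \<Longrightarrow> e' \<odot>\<^bsub>Q\<^esub> (D ^^ n) (j \<odot>\<^bsub>Q\<^esub> v) \<in> A" using terms[of n] by blast
    have "(e \<otimes> e') \<odot>\<^bsub>Q\<^esub> x \<in> A" if x: "x \<in> G (carrier R) (Suc n)" for x
    proof -
      obtain j g where jg: "j \<in> carrier R" "g \<in> G (carrier R) n" "x = (D ^^ n) (j \<odot>\<^bsub>Q\<^esub> v) \<oplus>\<^bsub>Q\<^esub> g"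
        by (rule G_SucE[OF x])
      have g: "g \<in> carrier Q" using jg(2) by (rule G_carrier[OF oneideal])
      have "e \<odot>\<^bsub>Q\<^esub> (e' \<odot>\<^bsub>Q\<^esub> (D ^^ n) (j \<odot>\<^bsub>Q\<^esub> v)) \<oplus>\<^bsub>Q\<^esub> e' \<odot>\<^bsub>Q\<^esub> (e \<odot>\<^bsub>Q\<^esub> g) \<in> A"
        by (intro A_add A_smult e e' jg)
      moreover have "e' \<odot>\<^bsub>Q\<^esub> (e \<odot>\<^bsub>Q\<^esub> g) = e \<odot>\<^bsub>Q\<^esub> (e' \<odot>\<^bsub>Q\<^esub> g)"
        using e e' g by (simp add: smult_assoc1[symmetric] m_comm)
      ultimately show ?thesis
        unfolding jg(3) using e(1) e'(1) jg(1) v g by (simp add: smult_assoc1 smult_r_distr)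
    qed
    moreover have "e \<otimes> e' \<noteq> \<zero>" using e(1,2) e'(1,2) integral by blast
    ultimately show ?case using e(1) e'(1) by blast
  qed
qed

text \<open>Otherwise the saturation of \<open>G R n\<close> would be stable under \<open>D\<close>, and the elements of \<open>R\<close>
  multiplying it into \<open>A\<close> would form a proper nonzero \<open>\<delta>\<close>-ideal.\<close>

lemma leading_term_in_P:
  assumes j: "j \<in> carrier R" and jG: "(D ^^ n) (j \<odot>\<^bsub>Q\<^esub> v) \<in> G (carrier R) n"
  shows "j \<in> P"
proof (cases n)
  case 0
  then show ?thesis using jG j v_A by simp
next
  case (Suc n')
  note [simp] = G_carrier[OF oneideal]
  show ?thesis
  proof (rule ccontr)
    assume jP: "j \<notin> P"
    \<comment> \<open>Modulo \<open>G R n\<close>, both \<open>j D^n (r v)\<close> and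
      \<open>r D^n (j v)\<close> agree with \<open>D^n\<close> applied to the same multiple of
      \<open>v\<close>. The second lies in \<open>G R n\<close>, hence \<open>j\<close> lowers the
      order of every element of \<open>G R (Suc n)\<close>.\<close>
    have j_shift: "j \<odot>\<^bsub>Q\<^esub> x \<in> G (carrier R) n" if x: "x \<in> G (carrier R) (Suc n)" for x
    proof -
      obtain r g where rg: "r \<in> carrier R" "g \<in> G (carrier R) n" "x = (D ^^ n) (r \<odot>\<^bsub>Q\<^esub> v) \<oplus>\<^bsub>Q\<^esub> g"
        by (rule G_SucE[OF x])
      obtain g1 where g1: "g1 \<in> G (carrier R) n"
        "j \<odot>\<^bsub>Q\<^esub> (D ^^ n) (r \<odot>\<^bsub>Q\<^esub> v) = (D ^^ n) ((j \<otimes> r) \<odot>\<^bsub>Q\<^esub> v) \<oplus>\<^bsub>Q\<^esub> g1"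
        by (rule G_commute[OF oneideal j rg(1)])
      obtain g2 where g2: "g2 \<in> G (carrier R) n"
        "r \<odot>\<^bsub>Q\<^esub> (D ^^ n) (j \<odot>\<^bsub>Q\<^esub> v) = (D ^^ n) ((r \<otimes> j) \<odot>\<^bsub>Q\<^esub> v) \<oplus>\<^bsub>Q\<^esub> g2"
        by (rule G_commute[OF oneideal rg(1) j])
      have "r \<odot>\<^bsub>Q\<^esub> (D ^^ n) (j \<odot>\<^bsub>Q\<^esub> v) \<in> G (carrier R) n" by (rule G_smult[OF oneideal rg(1) jG])
      then have "(D ^^ n) ((r \<otimes> j) \<odot>\<^bsub>Q\<^esub> v) \<in> G (carrier R) n"
        using G_diff[OF oneideal _ g2(1)] g2(2) rg(1) j v by simp
      then have "j \<odot>\<^bsub>Q\<^esub> (D ^^ n) (r \<odot>\<^bsub>Q\<^esub> v) \<in> G (carrier R) n"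
        unfolding g1(2) using G_add[OF oneideal _ g1(1)] m_comm[OF j rg(1)] by simp
      moreover have "j \<odot>\<^bsub>Q\<^esub> g \<in> G (carrier R) n" by (rule G_smult[OF oneideal j rg(2)])
      ultimately show ?thesis
        unfolding rg(3) using G_add[OF oneideal] smult_r_distr[OF j] rg v by simp
    qed
    \<comment> \<open>The saturation of \<open>G R n\<close> with respect to the elements outside
      \<open>P\<close>; the factor \<open>j \<notin> P\<close> that lowers the order can be absorbed
      here.\<close>
    define N where "N = {x \<in> carrier Q. \<exists>s\<in>carrier R. s \<notin> P \<and> s \<odot>\<^bsub>Q\<^esub> x \<in> G (carrier R) n}"
    have N_D: "D x \<in> N" if "x \<in> N" for x
    proof -
      obtain s where s: "x \<in> carrier Q" "s \<in> carrier R" "s \<notin> P" "s \<odot>\<^bsub>Q\<^esub> x \<in> G (carrier R) n"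
        using \<open>x \<in> N\<close> by (auto simp: N_def)
      have ds: "\<delta> s \<in> carrier R" using s(2) by (rule deriv_closed)
      have "s \<odot>\<^bsub>Q\<^esub> D (s \<odot>\<^bsub>Q\<^esub> x) \<oplus>\<^bsub>Q\<^esub> (\<ominus> \<delta> s) \<odot>\<^bsub>Q\<^esub> (s \<odot>\<^bsub>Q\<^esub> x) \<in> G (carrier R) (Suc n)"
        by (intro G_add[OF oneideal] G_smult[OF oneideal] G_D[OF oneideal] G_Suc[OF oneideal] s
            R_neg_closed ds)
      moreover have "s \<odot>\<^bsub>Q\<^esub> D (s \<odot>\<^bsub>Q\<^esub> x) = (s \<otimes> s) \<odot>\<^bsub>Q\<^esub> D x \<oplus>\<^bsub>Q\<^esub> (\<delta> s \<otimes> s) \<odot>\<^bsub>Q\<^esub> x"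
        using s ds by (simp add: D_smult smult_r_distr smult_assoc1[symmetric] m_comm)
      moreover have "(\<ominus> \<delta> s) \<odot>\<^bsub>Q\<^esub> (s \<odot>\<^bsub>Q\<^esub> x) = \<ominus>\<^bsub>Q\<^esub> ((\<delta> s \<otimes> s) \<odot>\<^bsub>Q\<^esub> x)"
        using s ds by (simp add: smult_l_minus smult_assoc1)
      ultimately have "(s \<otimes> s) \<odot>\<^bsub>Q\<^esub> D x \<in> G (carrier R) (Suc n)"
        using s ds by (simp add: M.a_assoc M.r_neg)
      \<comment> \<open>\<open>D\<close> raised the order to \<open>Suc n\<close>, and
        multiplication by \<open>j\<close> brings it back to \<open>n\<close>. The total multiplier
        \<open>j \<otimes> (s \<otimes> s)\<close> is still outside \<open>P\<close>, so
        \<open>D x \<in> N\<close>.\<close>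
      then have "(j \<otimes> (s \<otimes> s)) \<odot>\<^bsub>Q\<^esub> D x \<in> G (carrier R) n"
        using j_shift j s smult_assoc1[of j "s \<otimes> s" "D x"] by simp
      moreover have "j \<otimes> (s \<otimes> s) \<notin> P" using not_P_mult s j jP by simp
      ultimately show ?thesis using s j unfolding N_def by blast
    qed
    define I where "I = {a \<in> carrier R. \<forall>x\<in>N. a \<odot>\<^bsub>Q\<^esub> x \<in> A}"
    have "ideal I R"
      unfolding ideal_iff I_def N_def
      using A_zero A_add A_smult by (auto simp: smult_l_distr smult_assoc1 smult_l_null)
    moreover have "\<delta> a \<in> I" if a: "a \<in> I" for a
    proof -
      have aR: "a \<in> carrier R" "\<delta> a \<in> carrier R" using a deriv_closed by (auto simp: I_def)
      have "\<delta> a \<odot>\<^bsub>Q\<^esub> x \<in> A" if x: "x \<in> N" for x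
      proof -
        have xQ: "x \<in> carrier Q" using x by (simp add: N_def)
        have "(\<ominus> \<one>) \<odot>\<^bsub>Q\<^esub> (a \<odot>\<^bsub>Q\<^esub> D x) \<oplus>\<^bsub>Q\<^esub> D (a \<odot>\<^bsub>Q\<^esub> x) \<in> A"
          using a x N_D[OF x]
          by (intro A_add A_D A_smult[OF R_neg_closed[OF one_closed]]) (auto simp: I_def)
        moreover have "(\<ominus> \<one>) \<odot>\<^bsub>Q\<^esub> (a \<odot>\<^bsub>Q\<^esub> D x) \<oplus>\<^bsub>Q\<^esub> D (a \<odot>\<^bsub>Q\<^esub> x) = \<delta> a \<odot>\<^bsub>Q\<^esub> x"
          using aR xQ by (simp add: D_smult smult_l_minus M.r_neg1)
        ultimately show ?thesis by simp
      qed
      then show ?thesis using aR by (simp add: I_def)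
    qed
    moreover obtain e where e: "e \<in> carrier R" "e \<noteq> \<zero>" "\<And>x. x \<in> G (carrier R) n \<Longrightarrow> e \<odot>\<^bsub>Q\<^esub> x \<in> A"
      using G_bounded_denominator by blast
    \<comment> \<open>\<open>e\<close> clears the denominators of \<open>G R n\<close>; those
      introduced by saturation are cancelled because \<open>A\<close> is itself saturated.\<close>
    have "e \<in> I"
    proof -
      have "e \<odot>\<^bsub>Q\<^esub> x \<in> A" if "x \<in> N" for x
      proof -
        obtain s where s: "x \<in> carrier Q" "s \<in> carrier R" "s \<notin> P" "s \<odot>\<^bsub>Q\<^esub> x \<in> G (carrier R) n"
          using \<open>x \<in> N\<close> by (auto simp: N_def)
        have "s \<odot>\<^bsub>Q\<^esub> (e \<odot>\<^bsub>Q\<^esub> x) = e \<odot>\<^bsub>Q\<^esub> (s \<odot>\<^bsub>Q\<^esub> x)"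
          using s e by (simp add: smult_assoc1[symmetric] m_comm)
        then show ?thesis using A_saturated[OF s(2,3)] e s by simp
      qed
      then show ?thesis using e by (simp add: I_def)
    qed
    ultimately have "\<one> \<in> I" using delta_ideal_eq_carrier e(2) by blast
    \<comment> \<open>Here \<open>n\<close> is positive, so \<open>G R n\<close> contains
      \<open>R v\<close>. With \<open>\<one> \<in> I\<close> this would place \<open>v\<close> in
      \<open>A\<close>, whereas \<open>\<one> \<notin> P\<close>.\<close>
    moreover have "v \<in> N"
    proof -
      have "v \<in> G (carrier R) (Suc 0)"
        using G_SucI[of \<one> "carrier R" "\<zero>\<^bsub>Q\<^esub>" 0] v A_zero by simp
      then have "v \<in> G (carrier R) n" by (rule G_mono[OF oneideal]) (simp add: Suc)
      then show ?thesis using v one_not_P by (auto simp: N_def intro!: bexI[of _ \<one>])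
    qed
    ultimately have "\<one> \<odot>\<^bsub>Q\<^esub> v \<in> A" by (simp add: I_def)
    then show False using v_A one_not_P by simp
  qed
qed

text \<open>Terms are stripped from the top. Above the bottom layer,
  \<open>leading_term_in_P\<close> puts the coefficient of the top derivative into \<open>P\<close>,
  and since \<open>P v \<subseteq> A\<close> that term is absorbed into \<open>A\<close>. What
  remains is \<open>x v \<in> J v + A\<close>, which means \<open>x \<in> J + P = J\<close>.\<close>

lemma smult_generator_in_G:
  assumes J: "ideal J R" "P \<subseteq> J" and x: "x \<in> carrier R" and xG: "x \<odot>\<^bsub>Q\<^esub> v \<in> G J n"
  shows "x \<in> J"
  using xG
proof (induction n)
  case 0
  then show ?case using v_A x J(2) by auto
next
  case (Suc n)
  obtain j g where jg: "j \<in> J" "g \<in> G J n" "x \<odot>\<^bsub>Q\<^esub> v = (D ^^ n) (j \<odot>\<^bsub>Q\<^esub> v) \<oplus>\<^bsub>Q\<^esub> g"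
    by (rule G_SucE[OF Suc.prems])
  have j: "j \<in> carrier R" using jg(1) J_D(1)[OF J(1)] by blast
  have g: "g \<in> carrier Q" using jg(2) by (rule G_carrier[OF J(1)])
  show ?case
  proof (cases n)
    case 0
    have "(\<ominus> j \<oplus> x) \<odot>\<^bsub>Q\<^esub> v = g"
      using jg(3) x j v g 0 by (simp add: R_neg_closed smult_l_distr smult_l_minus M.r_neg1)
    then have "\<ominus> j \<oplus> x \<in> P" using jg(2) 0 v_A[OF R_add_closed[OF R_neg_closed[OF j] x]] by simp
    then have "j \<oplus> (\<ominus> j \<oplus> x) \<in> J" using J_D(3)[OF J(1)] J(2) jg(1) by blast
    moreover have "j \<oplus> (\<ominus> j \<oplus> x) = x" using x j by algebra
    ultimately show ?thesis by simp
  next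
    case (Suc n')
    have sub: "G J n \<subseteq> G (carrier R) n" by (rule G_mono_ideal) (use J_D(1)[OF J(1)] in auto)
    have "x \<odot>\<^bsub>Q\<^esub> v \<in> G (carrier R) (Suc 0)"
      using G_SucI[of x "carrier R" "\<zero>\<^bsub>Q\<^esub>" 0] x v A_zero by simp
    then have "x \<odot>\<^bsub>Q\<^esub> v \<in> G (carrier R) n" by (rule G_mono[OF oneideal]) (simp add: Suc)
    then have "(D ^^ n) (j \<odot>\<^bsub>Q\<^esub> v) \<in> G (carrier R) n"
      using G_diff[OF oneideal] jg sub j v by auto
    then have "j \<in> P" by (rule leading_term_in_P[OF j])
    then have "j \<odot>\<^bsub>Q\<^esub> v \<in> A" using v_A j by simp
    then have "(D ^^ n) (j \<odot>\<^bsub>Q\<^esub> v) \<in> A" by (induction n) (auto simp: A_D)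
    then have "(D ^^ n) (j \<odot>\<^bsub>Q\<^esub> v) \<in> G J n" using G_mono[OF J(1), of _ 0 n] by simp
    then have "x \<odot>\<^bsub>Q\<^esub> v \<in> G J n" unfolding jg(3) using G_add[OF J(1)] jg(2) by simp
    then show ?thesis by (rule Suc.IH)
  qed
qed

text \<open>Here \<open>L = S t\<^sup>k\<^sup>+\<^sup>1 v\<close>. It lies in the submodule \<open>\<Union>n. G J n\<close> with \<open>J = P + t\<^sup>k\<^sup>+\<^sup>1 R\<close>,
  which meets \<open>R v\<close> in \<open>J v\<close>.\<close>

lemma power_chain_strict:
  assumes t: "t \<in> carrier R" "t \<notin> P" and Q': "ideal I R" "P \<subseteq> I" "t \<in> I" "I \<noteq> carrier R"
    and L: "submodule L (diff_op_ring R \<delta>) diff_op_module"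
      "\<And>L'. submodule L' (diff_op_ring R \<delta>) diff_op_module \<Longrightarrow> (t [^] Suc k) \<odot>\<^bsub>Q\<^esub> v \<in> L' \<Longrightarrow> L \<subseteq> L'"
  shows "(t [^] (k::nat)) \<odot>\<^bsub>Q\<^esub> v \<notin> L"
proof
  assume tL: "(t [^] k) \<odot>\<^bsub>Q\<^esub> v \<in> L"
  define J where "J = {p \<oplus> r \<otimes> t [^] Suc k | p r. p \<in> P \<and> r \<in> carrier R}"
  have tk: "t [^] n \<in> carrier R" for n :: nat using t by simp
  have J: "ideal J R" unfolding J_def by (rule ideal_add_principal[OF P_ideal tk])
  have "P \<subseteq> J"
  proof
    fix p assume "p \<in> P"
    then have "p = p \<oplus> \<zero> \<otimes> t [^] Suc k" using P_carrier tk[of "Suc k"] by simp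
    then show "p \<in> J" unfolding J_def using \<open>p \<in> P\<close> by blast
  qed
  have "t [^] Suc k = \<zero> \<oplus> \<one> \<otimes> t [^] Suc k" using tk[of "Suc k"] by simp
  moreover have "\<zero> \<in> P" using P_ideal by (simp add: ideal_iff)
  ultimately have "t [^] Suc k \<in> J" unfolding J_def by blast
  then have "(t [^] Suc k) \<odot>\<^bsub>Q\<^esub> v \<in> G J (Suc 0)"
    using G_SucI[of "t [^] Suc k" J "\<zero>\<^bsub>Q\<^esub>" 0] v A_zero tk[of "Suc k"] by simp
  then have "L \<subseteq> (\<Union>n. G J n)" by (intro L(2) G_union_submodule[OF J]) blast
  then obtain n where "(t [^] k) \<odot>\<^bsub>Q\<^esub> v \<in> G J n" using tL by blast
  then have "t [^] k \<in> J" by (rule smult_generator_in_G[OF J \<open>P \<subseteq> J\<close> tk])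
  then obtain p r where p: "p \<in> P" "r \<in> carrier R" "t [^] k = p \<oplus> r \<otimes> t [^] Suc k"
    by (auto simp: J_def)
  have pR: "p \<in> carrier R" using p(1) P_carrier by blast
  \<comment> \<open>From \<open>t^k \<in> P + t^(k+1) R\<close> it follows that
    \<open>t^k (1 - r t)\<close> lies in \<open>P\<close>. Since \<open>t\<close> is outside the
    prime \<open>P\<close>, the factor \<open>1 - r t\<close> is in \<open>P\<close> and thus in
    \<open>I\<close>, as is \<open>r t\<close>; so \<open>I\<close> would contain
    \<open>\<one>\<close>.\<close>
  have "t [^] k \<otimes> (\<one> \<ominus> r \<otimes> t) = t [^] k \<ominus> r \<otimes> t [^] Suc k"
    using p(2) t(1) tk[of k] unfolding nat_pow_Suc by algebra
  also have "\<dots> = p"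
    unfolding p(3) using pR p(2) tk[of "Suc k"] by algebra
  finally have "t [^] k \<otimes> (\<one> \<ominus> r \<otimes> t) \<in> P" using p(1) by simp
  moreover have "t [^] k \<notin> P"
    by (induction k) (use one_not_P not_P_mult t in auto)
  ultimately have "\<one> \<ominus> r \<otimes> t \<in> P"
    using not_P_mult[OF tk, of "\<one> \<ominus> r \<otimes> t"] p(2) t(1) by auto
  then have "\<one> \<ominus> r \<otimes> t \<in> I" using Q'(2) by blast
  moreover have "r \<otimes> t \<in> I" using Q'(1,3) p(2) by (auto simp: ideal_iff)
  ultimately have "(\<one> \<ominus> r \<otimes> t) \<oplus> r \<otimes> t \<in> I" using Q'(1) by (auto simp: ideal_iff)
  moreover have "(\<one> \<ominus> r \<otimes> t) \<oplus> r \<otimes> t = \<one>" using p(2) t(1) by algebra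
  ultimately show False using ideal.one_imp_carrier[OF Q'(1)] Q'(4) by simp
qed

end

section \<open>The fraction field and the failure of the Artinian condition above dimension
  one\<close>

context simple_derivation
begin

interpretation F: diff_module R \<delta> frac_module frac_deriv
  by (rule frac_diff_module)

abbreviation \<iota> :: "'a \<Rightarrow> ('a \<times> 'a) set" where "\<iota> r \<equiv> frac r \<one>"

lemma iota_closed: "r \<in> carrier R \<Longrightarrow> \<iota> r \<in> fractions"
  by (simp add: fracI)

lemma iota_inj: "\<lbrakk>r \<in> carrier R; s \<in> carrier R\<rbrakk> \<Longrightarrow> \<iota> r = \<iota> s \<longleftrightarrow> r = s"
  by (simp add: frac_eq_iff)

lemma iota_add: "\<lbrakk>r \<in> carrier R; s \<in> carrier R\<rbrakk> \<Longrightarrow> \<iota> r \<oplus>\<^bsub>frac_module\<^esub> \<iota> s = \<iota> (r \<oplus> s)"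
  by (simp add: frac_add)

lemma iota_smult: "\<lbrakk>r \<in> carrier R; s \<in> carrier R\<rbrakk> \<Longrightarrow> r \<odot>\<^bsub>frac_module\<^esub> \<iota> s = \<iota> (r \<otimes> s)"
  by (simp add: frac_smult)

lemma iota_deriv: "r \<in> carrier R \<Longrightarrow> frac_deriv (\<iota> r) = \<iota> (\<delta> r)"
  by (simp add: frac_deriv_frac deriv_one deriv_closed a_minus_def)

lemma iota_smult_den:
  "\<lbrakk>a \<in> carrier R; d \<in> carrier R; d \<noteq> \<zero>\<rbrakk> \<Longrightarrow> d \<odot>\<^bsub>frac_module\<^esub> frac a d = \<iota> a"
  by (simp add: frac_smult frac_eq_iff m_comm)

text \<open>Clearing the denominator of a nonzero element yields a nonzero \<open>a\<close> with
  \<open>\<iota> a \<in> L\<close>, and the elements of \<open>R\<close> lying in \<open>L\<close>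
  form a \<delta>-ideal. Both simplicity and essentiality of the copy of \<open>R\<close> follow
  from this.\<close>

lemma frac_submodule_contains_iota:
  assumes L: "submodule L (diff_op_ring R \<delta>) F.diff_op_module" and "L \<noteq> {\<zero>\<^bsub>frac_module\<^esub>}"
  shows "\<iota> ` carrier R \<subseteq> L"
proof -
  note L' = L[unfolded F.diff_op_submodule_iff frac_module_simps(1)]
  obtain q where q: "q \<in> L" "q \<noteq> \<zero>\<^bsub>frac_module\<^esub>" using L' \<open>L \<noteq> _\<close> by blast
  then have "q \<in> fractions" using L' by blast
  then obtain a d where ad: "a \<in> carrier R" "d \<in> carrier R" "d \<noteq> \<zero>" "q = frac a d" by (rule fracE)
  have a0: "a \<noteq> \<zero>" using q(2) frac_zero[OF ad(1-3)] ad(4) by blast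
  have "d \<odot>\<^bsub>frac_module\<^esub> q \<in> L" using L' ad(2) q(1) by blast
  then have a: "\<iota> a \<in> L" using iota_smult_den[OF ad(1-3)] ad(4) by simp
  define I where "I = {r \<in> carrier R. \<iota> r \<in> L}"
  have "\<iota> \<zero> \<in> L" using L' by (simp add: frac_module_simps)
  moreover have "\<iota> (r \<oplus> s) \<in> L" if "r \<in> carrier R" "s \<in> carrier R" "\<iota> r \<in> L" "\<iota> s \<in> L" for r s
    using L' that iota_add[of r s] by metis
  moreover have smult: "\<iota> (r \<otimes> s) \<in> L" if "r \<in> carrier R" "s \<in> carrier R" "\<iota> s \<in> L" for r s
    using L' that iota_smult[of r s] by metis
  ultimately have "ideal I R" by (auto simp: ideal_iff I_def)
  moreover have "\<delta> r \<in> I" if "r \<in> I" for r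
    using L' that iota_deriv[of r] by (auto simp: I_def deriv_closed)
  moreover have "a \<in> I" using a ad(1) by (simp add: I_def)
  ultimately have "\<one> \<in> I" using delta_ideal_eq_carrier a0 by blast
  then have "\<iota> (r \<otimes> \<one>) \<in> L" if "r \<in> carrier R" for r
    using smult[OF that one_closed] by (simp add: I_def)
  then show ?thesis by auto
qed

lemma iota_submodule: "submodule (\<iota> ` carrier R) (diff_op_ring R \<delta>) F.diff_op_module"
  unfolding F.diff_op_submodule_iff frac_module_simps
  using iota_closed by (auto simp: iota_add iota_smult iota_deriv deriv_closed)

lemma iota_nonzero: "\<iota> ` carrier R \<noteq> {\<zero>\<^bsub>frac_module\<^esub>}"
  using iota_inj[of \<one> \<zero>] by (auto simp: frac_module_simps)

lemma not_diamond:
  assumes P1: "primeideal P1 R" "P1 \<noteq> {\<zero>}" and P2: "primeideal P2 R" "P1 \<subset> P2"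
  shows "\<not> diamond (diff_op_ring R \<delta>)"
proof
  assume diamond: "diamond (diff_op_ring R \<delta>)"
  let ?S = "diff_op_ring R \<delta>" and ?Q = "F.diff_op_module"
  have P1_ideal: "ideal P1 R" and P2_ideal: "ideal P2 R" using P1 P2 by (simp_all add: primeideal_def)
  obtain c where c1: "c \<in> P1" "c \<noteq> \<zero>" using P1(2) P1_ideal by (auto simp: ideal_iff)
  have cR: "c \<in> carrier R" using c1(1) P1_ideal by (auto simp: ideal_iff)
  obtain b P where b: "b \<in> carrier R" and P_def: "P = {r \<in> carrier R. r \<otimes> b \<in> PIdl c}"
    and P_prime: "primeideal P R" "P \<subseteq> P1"
    using ex_associated_prime[OF acc P1(1) c1(1)] by blast
  have not_P_mult: "r \<otimes> s \<notin> P" if "r \<in> carrier R" "s \<in> carrier R" "r \<notin> P" "s \<notin> P" for r s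
    using primeideal.I_prime[OF P_prime(1)] that by blast
  have one_not_P: "\<one> \<notin> P"
    using primeideal.I_notcarr[OF P_prime(1)] ideal.one_imp_carrier primeideal.axioms(1)[OF P_prime(1)] by blast
  have b0: "b \<noteq> \<zero>"
  proof
    assume "b = \<zero>"
    then have "\<one> \<in> P" using cgenideal_ideal[OF cR] by (simp add: P_def ideal_iff)
    with one_not_P show False ..
  qed
  obtain t where t: "t \<in> P2" "t \<notin> P1" using P2(2) by blast
  have tR: "t \<in> carrier R" using t(1) P2_ideal by (auto simp: ideal_iff)
  define v where "v = frac b c"
  have v_closed: "v \<in> fractions" unfolding v_def by (rule fracI[OF b cR c1(2)])
  \<comment> \<open>The localisation of \<open>R\<close> at \<open>P\<close> inside the fractions:
    an element belongs to it if some \<open>s \<notin> P\<close> clears its denominator.\<close>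
  define A where "A = {q \<in> fractions. \<exists>s\<in>carrier R. s \<notin> P \<and> (\<exists>r\<in>carrier R. s \<odot>\<^bsub>frac_module\<^esub> q = \<iota> r)}"
  have AI: "q \<in> A" if "q \<in> fractions" "s \<in> carrier R" "s \<notin> P" "r \<in> carrier R" "s \<odot>\<^bsub>frac_module\<^esub> q = \<iota> r" for q s r
    using that unfolding A_def by blast
  have AE: thesis if "q \<in> A"
    "\<And>s r. q \<in> fractions \<Longrightarrow> s \<in> carrier R \<Longrightarrow> s \<notin> P \<Longrightarrow> r \<in> carrier R \<Longrightarrow> s \<odot>\<^bsub>frac_module\<^esub> q = \<iota> r \<Longrightarrow> thesis" for q thesis
    using that unfolding A_def by blast
  note Q_simps = frac_module_simps(1)
  interpret localised_generator R \<delta> frac_module frac_deriv P A v c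
  proof (intro localised_generator.intro localised_generator_axioms.intro simple_derivation_axioms frac_diff_module P_prime(1))
    show "A \<subseteq> carrier frac_module" by (auto simp: A_def Q_simps)
    show "\<zero>\<^bsub>frac_module\<^esub> \<in> A"
      by (rule AI[of _ \<one> \<zero>]) (auto simp: frac_module_simps fracI one_not_P frac_smult)
    show "x \<oplus>\<^bsub>frac_module\<^esub> y \<in> A" if x: "x \<in> A" and y: "y \<in> A" for x y
    proof -
      obtain s r where s: "x \<in> fractions" "s \<in> carrier R" "s \<notin> P" "r \<in> carrier R" "s \<odot>\<^bsub>frac_module\<^esub> x = \<iota> r"
        by (rule AE[OF x])
      obtain s' r' where s': "y \<in> fractions" "s' \<in> carrier R" "s' \<notin> P" "r' \<in> carrier R" "s' \<odot>\<^bsub>frac_module\<^esub> y = \<iota> r'"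
        by (rule AE[OF y])
      have xy: "x \<in> carrier frac_module" "y \<in> carrier frac_module" using s(1) s'(1) by (simp_all add: Q_simps)
      have "(s \<otimes> s') \<odot>\<^bsub>frac_module\<^esub> (x \<oplus>\<^bsub>frac_module\<^esub> y) =
          s' \<odot>\<^bsub>frac_module\<^esub> (s \<odot>\<^bsub>frac_module\<^esub> x) \<oplus>\<^bsub>frac_module\<^esub> s \<odot>\<^bsub>frac_module\<^esub> (s' \<odot>\<^bsub>frac_module\<^esub> y)"
        using s(2) s'(2) xy by (simp add: F.smult_r_distr F.smult_assoc1[symmetric] m_comm)
      also have "\<dots> = \<iota> (s' \<otimes> r \<oplus> s \<otimes> r')"
        using s s' by (simp add: iota_smult iota_add)
      finally show ?thesis
        using AI[of "x \<oplus>\<^bsub>frac_module\<^esub> y" "s \<otimes> s'" "s' \<otimes> r \<oplus> s \<otimes> r'"] s s' not_P_mult xy F.M.a_closed[of x y] by (simp add: Q_simps)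
    qed
    show "a \<odot>\<^bsub>frac_module\<^esub> x \<in> A" if a: "a \<in> carrier R" and x: "x \<in> A" for a x
    proof -
      obtain s r where s: "x \<in> fractions" "s \<in> carrier R" "s \<notin> P" "r \<in> carrier R" "s \<odot>\<^bsub>frac_module\<^esub> x = \<iota> r"
        by (rule AE[OF x])
      have xQ: "x \<in> carrier frac_module" using s(1) by (simp add: Q_simps)
      have "s \<odot>\<^bsub>frac_module\<^esub> (a \<odot>\<^bsub>frac_module\<^esub> x) = a \<odot>\<^bsub>frac_module\<^esub> (s \<odot>\<^bsub>frac_module\<^esub> x)"
        using a s(2) xQ by (simp add: F.smult_assoc1[symmetric] m_comm)
      then show ?thesis
        using AI[of "a \<odot>\<^bsub>frac_module\<^esub> x" s "a \<otimes> r"] a s F.smult_closed[OF a xQ] by (simp add: iota_smult Q_simps)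
    qed
    show "frac_deriv x \<in> A" if x: "x \<in> A" for x
    proof -
      obtain s r where s: "x \<in> fractions" "s \<in> carrier R" "s \<notin> P" "r \<in> carrier R" "s \<odot>\<^bsub>frac_module\<^esub> x = \<iota> r"
        by (rule AE[OF x])
      have xQ: "x \<in> carrier frac_module" using s(1) by (simp add: Q_simps)
      have d: "\<delta> s \<in> carrier R" "\<delta> r \<in> carrier R" using s by (auto simp: deriv_closed)
      \<comment> \<open>With \<open>s x = r\<close>, differentiating and multiplying by
        \<open>s\<close> gives \<open>s^2 x' = s (\<delta> r) - (\<delta> s) r\<close>, so
        \<open>s \<otimes> s\<close>, again outside \<open>P\<close>, clears the denominator of the
        derivative.\<close>
      have "(s \<otimes> s) \<odot>\<^bsub>frac_module\<^esub> frac_deriv x \<oplus>\<^bsub>frac_module\<^esub> \<iota> (\<delta> s \<otimes> r) = s \<odot>\<^bsub>frac_module\<^esub> frac_deriv (\<iota> r)"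
      proof -
        have "s \<odot>\<^bsub>frac_module\<^esub> frac_deriv (s \<odot>\<^bsub>frac_module\<^esub> x) =
            (s \<otimes> s) \<odot>\<^bsub>frac_module\<^esub> frac_deriv x \<oplus>\<^bsub>frac_module\<^esub> \<delta> s \<odot>\<^bsub>frac_module\<^esub> (s \<odot>\<^bsub>frac_module\<^esub> x)"
          using s(2) d xQ by (simp add: F.D_smult F.smult_r_distr F.smult_assoc1[symmetric] m_comm)
        then show ?thesis using s d by (simp add: iota_smult)
      qed
      also have "\<dots> = \<iota> (s \<otimes> \<delta> r \<ominus> \<delta> s \<otimes> r) \<oplus>\<^bsub>frac_module\<^esub> \<iota> (\<delta> s \<otimes> r)"
      proof -
        have "s \<otimes> \<delta> r \<ominus> \<delta> s \<otimes> r \<oplus> \<delta> s \<otimes> r = s \<otimes> \<delta> r" using s(2,4) d by algebra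
        then show ?thesis using s d by (simp add: iota_deriv iota_smult iota_add)
      qed
      finally have "(s \<otimes> s) \<odot>\<^bsub>frac_module\<^esub> frac_deriv x = \<iota> (s \<otimes> \<delta> r \<ominus> \<delta> s \<otimes> r)"
        using s d iota_closed F.smult_closed[OF m_closed[OF s(2,2)] F.D_closed[OF xQ]]
        by (simp add: F.M.add.right_cancel Q_simps)
      then show ?thesis
        using AI[of "frac_deriv x" "s \<otimes> s" "s \<otimes> \<delta> r \<ominus> \<delta> s \<otimes> r"] s d not_P_mult F.D_closed[OF xQ]
        by (simp add: Q_simps)
    qed
    show "x \<in> A" if s: "s \<in> carrier R" "s \<notin> P" and x: "x \<in> carrier frac_module" and sx: "s \<odot>\<^bsub>frac_module\<^esub> x \<in> A" for s x
    proof -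
      obtain s' r where s': "s' \<in> carrier R" "s' \<notin> P" "r \<in> carrier R" "s' \<odot>\<^bsub>frac_module\<^esub> (s \<odot>\<^bsub>frac_module\<^esub> x) = \<iota> r"
        by (rule AE[OF sx])
      then show ?thesis
        using AI[of x "s' \<otimes> s" r] s x not_P_mult by (simp add: Q_simps F.smult_assoc1)
    qed
    show "v \<in> carrier frac_module" using v_closed by (simp add: Q_simps)
    show "r \<odot>\<^bsub>frac_module\<^esub> v \<in> A \<longleftrightarrow> r \<in> P" if r: "r \<in> carrier R" for r
    proof
      assume rv: "r \<odot>\<^bsub>frac_module\<^esub> v \<in> A"
      obtain s x where s: "s \<in> carrier R" "s \<notin> P" "x \<in> carrier R" "s \<odot>\<^bsub>frac_module\<^esub> (r \<odot>\<^bsub>frac_module\<^esub> v) = \<iota> x"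
        by (rule AE[OF rv])
      \<comment> \<open>Clearing \<open>c\<close> puts \<open>s r b\<close> into \<open>cR\<close>,
        so \<open>s r \<in> P\<close> by the choice of \<open>P\<close> as \<open>(cR : b)\<close>;
        primality removes \<open>s\<close>.\<close>
      then have "s \<otimes> (r \<otimes> b) = x \<otimes> c"
        using r b cR c1(2) by (simp add: v_def frac_smult frac_eq_iff)
      then have "s \<otimes> r \<in> P" using s r b by (auto simp: P_def cgenideal_def m_assoc)
      then show "r \<in> P" using not_P_mult[OF s(1) r s(2)] by blast
    next
      assume "r \<in> P"
      then obtain x where x: "x \<in> carrier R" "r \<otimes> b = x \<otimes> c" by (auto simp: P_def cgenideal_def)
      then have "\<one> \<odot>\<^bsub>frac_module\<^esub> (r \<odot>\<^bsub>frac_module\<^esub> v) = \<iota> x"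
        using r b cR c1(2) by (simp add: v_def frac_smult frac_eq_iff)
      moreover have "r \<odot>\<^bsub>frac_module\<^esub> v \<in> fractions"
        using r b cR c1(2) by (simp add: v_def frac_smult fracI)
      ultimately show "r \<odot>\<^bsub>frac_module\<^esub> v \<in> A" using AI[of _ \<one> x] one_not_P x(1) by simp
    qed
    show "c \<in> P"
      using b cR by (auto simp: P_def cgenideal_def m_comm)
    show "c \<noteq> \<zero>" by (rule c1(2))
  qed
  have Q_carrier: "carrier ?Q = fractions" "\<zero>\<^bsub>?Q\<^esub> = \<zero>\<^bsub>frac_module\<^esub>" "\<And>s x. s \<odot>\<^bsub>?Q\<^esub> x = F.act s x"
    by (simp_all add: F.diff_op_module_def Q_simps)
  define cyc where "cyc x = (\<lambda>s. s \<odot>\<^bsub>?Q\<^esub> x) ` carrier ?S" for x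
  have cyc_sub: "submodule (cyc x) ?S ?Q" and cyc_self: "x \<in> cyc x" if "x \<in> fractions" for x
    using F.diff_op_module.cyclic_submodule[of x] that by (simp_all add: cyc_def Q_carrier)
  have cyc_min: "cyc x \<subseteq> L" if "submodule L ?S ?Q" "x \<in> L" for x L
    using F.diff_op_module.cyclic_submodule_minimal[OF that] by (simp add: cyc_def)
  define M where "M = ?Q\<lparr>carrier := cyc v\<rparr>"
  note M_sub = F.diff_op_module.submodule_restrict_iff[OF cyc_sub[OF v_closed], folded M_def]
  interpret M: left_module ?S M
    unfolding M_def by (rule F.diff_op_module.restrict_left_module[OF cyc_sub[OF v_closed]])
  have "v \<noteq> \<zero>\<^bsub>frac_module\<^esub>" unfolding v_def using frac_zero[OF b cR c1(2)] b0 by blast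
  then have "cyc v \<noteq> {\<zero>\<^bsub>frac_module\<^esub>}" using cyc_self[OF v_closed] by blast
  then have iota_cyc: "\<iota> ` carrier R \<subseteq> cyc v" by (rule frac_submodule_contains_iota[OF cyc_sub[OF v_closed]])
  have "cyclic_module ?S M"
    unfolding cyclic_module_def
    by (intro conjI M.left_module_axioms bexI[of _ v]) (use cyc_self[OF v_closed] in \<open>auto simp: M_def cyc_def\<close>)
  moreover have "essential_ext_of_simple ?S M"
    unfolding essential_ext_of_simple_def
  proof (intro exI conjI)
    have M_eq: "\<zero>\<^bsub>M\<^esub> = \<zero>\<^bsub>frac_module\<^esub>" "M\<lparr>carrier := N\<rparr> = ?Q\<lparr>carrier := N\<rparr>" for N
      by (simp_all add: M_def Q_carrier)
    show "essential_submodule ?S M (\<iota> ` carrier R)"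
      unfolding essential_submodule_def M_sub M_eq
    proof (intro conjI allI impI iota_submodule iota_cyc)
      fix L assume "(submodule L ?S ?Q \<and> L \<subseteq> cyc v) \<and> L \<noteq> {\<zero>\<^bsub>frac_module\<^esub>}"
      then have "\<iota> ` carrier R \<subseteq> L" using frac_submodule_contains_iota by blast
      then have "L \<inter> \<iota> ` carrier R = \<iota> ` carrier R" by blast
      then show "L \<inter> \<iota> ` carrier R \<noteq> {\<zero>\<^bsub>frac_module\<^esub>}" using iota_nonzero by simp
    qed
    show "simple_module ?S (M\<lparr>carrier := \<iota> ` carrier R\<rparr>)"
      unfolding M_eq F.diff_op_module.simple_restrict_iff[OF iota_submodule] Q_carrier
      using iota_nonzero frac_submodule_contains_iota by blast
  qed
  \<comment> \<open>The elements of \<open>M\<close> are fractions and do not have the type over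
    which \<open>diamond\<close> quantifies, hence the detour through
    \<open>diamond_any_type\<close>.\<close>
  ultimately have art: "artinian_module ?S M" by (rule diamond_any_type[OF diamond])
  define w where "w k = (t [^] k) \<odot>\<^bsub>frac_module\<^esub> v" for k :: nat
  have w: "w k \<in> fractions" for k
    using F.smult_closed[of "t [^] k" v] tR v_closed by (simp add: w_def Q_simps)
  have w_Suc: "w (Suc k) = t \<odot>\<^bsub>frac_module\<^esub> w k" for k
    using F.smult_assoc1[of t "t [^] k" v] tR v_closed by (simp add: w_def Q_simps m_comm)
  have smult_in: "a \<odot>\<^bsub>frac_module\<^esub> x \<in> L" if "submodule L ?S ?Q" "a \<in> carrier R" "x \<in> L" for a x L
    using that unfolding F.diff_op_submodule_iff by blast
  have "w (Suc k) \<in> cyc (w k)" for k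
    unfolding w_Suc by (rule smult_in[OF cyc_sub[OF w] tR cyc_self[OF w]])
  then have dec: "cyc (w (Suc k)) \<subseteq> cyc (w k)" for k by (rule cyc_min[OF cyc_sub[OF w]])
  have "w k \<in> cyc v" for k
    unfolding w_def using smult_in[OF cyc_sub[OF v_closed] _ cyc_self[OF v_closed]] tR by simp
  then have "submodule (cyc (w k)) ?S M" for k
    unfolding M_sub using cyc_sub[OF w] cyc_min[OF cyc_sub[OF v_closed]] by blast
  with dec art obtain n where n: "\<forall>m\<ge>n. cyc (w m) = cyc (w n)"
    unfolding artinian_module_def by (elim conjE allE[of _ "\<lambda>k. cyc (w k)"]) auto
  have "w n \<in> cyc (w (Suc n))" using n[rule_format, of "Suc n"] cyc_self[OF w] by simp
  moreover have "w n \<notin> cyc (w (Suc n))"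
    unfolding w_def[of n]
  \<comment> \<open>\<open>t\<close> was chosen outside \<open>P1\<close>, hence outside
    \<open>P\<close>, while \<open>P2\<close> is the proper ideal containing both \<open>P\<close>
    and \<open>t\<close>.\<close>
  proof (rule power_chain_strict[OF tR _ P2_ideal _ t(1)])
    show "t \<notin> P" using t(2) P_prime(2) by blast
    show "P \<subseteq> P2" using P_prime(2) P2(2) by blast
    show "P2 \<noteq> carrier R" using primeideal.I_notcarr[OF P2(1)] by blast
    show "submodule (cyc (w (Suc n))) ?S ?Q" by (rule cyc_sub[OF w])
    show "cyc (w (Suc n)) \<subseteq> L'" if "submodule L' ?S ?Q" "(t [^] Suc n) \<odot>\<^bsub>frac_module\<^esub> v \<in> L'" for L'
      using cyc_min[OF that(1)] that(2) by (simp add: w_def)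
  qed
  ultimately show False by blast
qed

lemma diamond_iff_krull_dim: "diamond (diff_op_ring R \<delta>) \<longleftrightarrow> krull_dim R \<le> 1"
proof
  assume "krull_dim R \<le> 1"
  then have "maximalideal P R" if "primeideal P R" "P \<noteq> {\<zero>}" for P
    using krull_dim_le_1_maximal[OF domain_axioms acc] that by blast
  then show "diamond (diff_op_ring R \<delta>)"
    unfolding diamond_def using cyclic_essential_artinian by blast
next
  assume diamond: "diamond (diff_op_ring R \<delta>)"
  show "krull_dim R \<le> 1"
    unfolding krull_dim_def
  proof (rule SUP_least)
    fix n assume "n \<in> {n. \<exists>P :: nat \<Rightarrow> 'a set. (\<forall>i\<le>n. primeideal (P i) R) \<and> (\<forall>i<n. P i \<subset> P (Suc i))}"
    then obtain P :: "nat \<Rightarrow> 'a set" where P: "\<And>i. i \<le> n \<Longrightarrow> primeideal (P i) R" "\<And>i. i < n \<Longrightarrow> P i \<subset> P (Suc i)"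
      by blast
    show "enat n \<le> 1"
    proof (rule ccontr)
      assume "\<not> enat n \<le> 1"
      then have n: "2 \<le> n" by (simp add: one_enat_def)
      have "\<zero> \<in> P 0" using P(1)[of 0] by (simp add: primeideal_def ideal_iff)
      \<comment> \<open>\<open>P 0\<close> may be any prime; strict inclusion of it in
        \<open>P 1\<close> is what makes \<open>P 1\<close> nonzero.\<close>
      then have "P 1 \<noteq> {\<zero>}" using P(2)[of 0] n by auto
      moreover have "primeideal (P 1) R" "primeideal (P 2) R" "P 1 \<subset> P 2"
        using P(1)[of 1] P(1)[of 2] P(2)[of 1] n by (simp_all add: numeral_2_eq_2)
      ultimately show False using not_diamond diamond by blast
    qed
  qed
qed

end

theorem theorem2p6:
  fixes K :: "('k, 'm) ring_scheme"
    and R :: "('k, 'a, 'n) module_scheme"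
    and \<delta> :: "'a \<Rightarrow> 'a"
  assumes "field K"
    and "ring_char_zero K"
    and "algebra K R"
    and "noetherian_ufd R \<or> affine_domain K R"
    and "derivation R \<delta>"
    and "delta_simple R \<delta>"
  shows "diamond (diff_op_ring R \<delta>) \<longleftrightarrow> krull_dim R \<le> 1"
proof -
  have "domain R"
    using assms(4) by (auto simp: noetherian_ufd_def affine_domain_def noetherian_domain_def)
  moreover have "acc_ideals R"
    using assms(4)
  proof
    assume "noetherian_ufd R"
    then show ?thesis
      by (intro noetherian_ring_imp_acc_ideals) (simp add: noetherian_ufd_def noetherian_domain_def)
  next
    assume "affine_domain K R"
    then show ?thesis
      using finitely_generated_algebra_acc_ideals[OF assms(1,3)] by (simp add: affine_domain_def)
  qed
  ultimately have "simple_derivation R \<delta>"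
    using assms(5,6)
    by (simp add: simple_derivation_def simple_derivation_axioms_def derivation_domain_def)
  then show ?thesis by (rule simple_derivation.diamond_iff_krull_dim)
qed

end
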